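(* Let $\mathcal G\in\mathbf G_{\mathrm{fin}}$ be a noncompact metric graph, $p>2$, and let $W,\rho\in L^\infty(\mathcal G)$ be nonnegative functions. Assume that $u\in H^1_{\mathrm{loc}}(\mathcal G)\cap L^\infty(\mathcal G)$ is a solution of $$\begin{cases}-u''+W(x)u=\rho(x)|u|^{p-2}u&\text{on every edge } e\in\mathcal E,\\ u\text{ is continuous on }\mathcal G,\\ \sum_{e\succ v}\frac{du_e}{dx}(v)=0&\text{at every vertex }v\in\mathcal V,\end{cases}$$ that is stable outside a compact set $C\subset\mathcal G$. Then $u'\in L^2(\mathcal G)$ and $\rho|u|^p\in L^1(\mathcal G)$. In particular, $u$ is uniformly continuous. Moreover, for every half-line $e$ of $\mathcal G$: - if $\liminf_{x\to\infty,\,x\in e}W(x)>0$, then $u|_e\in H^1(e)$ and $\lim_{x\to\infty,\,x\in e}u(x)=0$; - if $\liminf_{x\to\infty,\,x\in e}\rho(x)>0$, then $u|_e\in L^p(e)$ and $\lim_{x\to\infty,\,x\in e}u(x)=0$.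
   Context: Metric graphs: $\mathcal G=(\mathcal E,\mathcal V)$ with edges $\mathcal E$ and vertices $\mathcal V$; each bounded edge $e$ is identified with $[0,\ell_e]$ and each unbounded edge (half-line) with $[0,+\infty)$. $\mathbf G$ is the class of metric graphs that are connected, have at most countably many edges, all of whose vertices are adjacent to finitely many edges, and for which the infimum of the lengths of all edges is positive; $\mathbf G_{\mathrm{fin}}$ is the subclass of graphs with finitely many vertices and edges. A graph is compact if it has finitely many edges, all of finite length. $u_e$ is the restriction of $u$ to $e$. $H^1(\mathcal G)$ is the space of continuous $u:\mathcal G\to\mathbb R$ with $u_e\in H^1(e)$ for every edge and $\sum_e(\|u_e'\|_{L^2(e)}^2+\|u_e\|_{L^2(e)}^2)<\infty$; $H^1_{\mathrm{loc}}(\mathcal G)$ is defined as usual. $C_c(\mathcal G)$ is the space of continuous functions with compact support. The notation $e\succ v$ means that $e$ is incident to $v$, and $\frac{du_e}{dx}(v)$ is the derivative along $e$ at $v$ directed away from $v$. Limits inferior of functions defined a.e. are essential limits inferior. $u\in H^1_{\mathrm{loc}}(\mathcal G)$ is a solution if $\int_{\mathcal G}(u'\varphi'+Wu\varphi)\,dx=\int_{\mathcal G}\rho|u|^{p-2}u\varphi\,dx$ for all $\varphi\in H^1(\mathcal G)\cap C_c(\mathcal G)$. $u$ is stable outside a compact set $C\subseteq\mathcal G$ if for every $\varphi\in H^1(\mathcal G)\cap C_c(\mathcal G)$ with $\mathrm{supp}\,\varphi\subseteq\mathcal G\setminus C$, $$Q_u(\varphi;\mathcal G):=\int_{\mathcal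 G}\bigl(|\varphi'|^2+W|\varphi|^2-(p-1)\rho|u|^{p-2}|\varphi|^2\bigr)dx\ge0.$$ *)

theory Defs
  imports "HOL-Analysis.Analysis"
begin

section \<open>Metric graphs\<close>

text \<open>
  Multiple edges and loops are allowed.  An edge \<open>e\<close> of finite length is identified with
  \<open>[0, len e]\<close>, the coordinate \<open>0\<close> being glued to \<open>origin e\<close> and \<open>len e\<close> to \<open>terminus e\<close>.  An edge
  with \<open>len e = \<infinity>\<close> is a half-line \<open>[0, \<infinity>)\<close> glued to \<open>origin e\<close>; its \<open>terminus\<close> is meaningless.
\<close>

record ('v, 'e) mgraph =
  verts :: "'v set"
  edges :: "'e set"
  origin :: "'e \<Rightarrow> 'v"
  terminus :: "'e \<Rightarrow> 'v"
  len :: "'e \<Rightarrow> ereal"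

definition incident :: "('v, 'e) mgraph \<Rightarrow> 'e \<Rightarrow> 'v \<Rightarrow> bool" where
  "incident G e v \<longleftrightarrow> origin G e = v \<or> (len G e < \<infinity> \<and> terminus G e = v)"

definition edge_dom :: "('v, 'e) mgraph \<Rightarrow> 'e \<Rightarrow> real set" where
  "edge_dom G e = {x. 0 \<le> x \<and> ereal x \<le> len G e}"

definition edge_int :: "('v, 'e) mgraph \<Rightarrow> 'e \<Rightarrow> real set" where
  "edge_int G e = {x. 0 < x \<and> ereal x < len G e}"

datatype ('v, 'e) gpoint = Vertex 'v | Interior 'e real

definition points :: "('v, 'e) mgraph \<Rightarrow> ('v, 'e) gpoint set" where
  "points G = Vertex ` verts G \<union> {Interior e x | e x. e \<in> edges G \<and> x \<in> edge_int G e}"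

definition pt :: "('v, 'e) mgraph \<Rightarrow> 'e \<Rightarrow> real \<Rightarrow> ('v, 'e) gpoint" where
  "pt G e x = (if x = 0 then Vertex (origin G e)
               else if ereal x = len G e then Vertex (terminus G e)
               else Interior e x)"

text \<open>\<open>path_len G P Q L\<close>: some path from \<open>P\<close> to \<open>Q\<close>, a finite concatenation of segments each
  contained in a single edge, has length \<open>L\<close>.\<close>

inductive path_len ::
  "('v, 'e) mgraph \<Rightarrow> ('v, 'e) gpoint \<Rightarrow> ('v, 'e) gpoint \<Rightarrow> real \<Rightarrow> bool" for G where
  path_nil: "P \<in> points G \<Longrightarrow> path_len G P P 0"
| path_snoc: "\<lbrakk>path_len G P (pt G e x) L; e \<in> edges G; x \<in> edge_dom G e; y \<in> edge_dom G e\<rbrakk>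
    \<Longrightarrow> path_len G P (pt G e y) (L + \<bar>x - y\<bar>)"

definition connected_graph :: "('v, 'e) mgraph \<Rightarrow> bool" where
  "connected_graph G \<longleftrightarrow> (\<forall>P\<in>points G. \<forall>Q\<in>points G. \<exists>L. path_len G P Q L)"

text \<open>Outside \<open>points G\<close> the value is irrelevant; \<open>0\<close> keeps the function nonnegative, as the
  locale \<open>Metric_space\<close> demands.\<close>

definition gdist :: "('v, 'e) mgraph \<Rightarrow> ('v, 'e) gpoint \<Rightarrow> ('v, 'e) gpoint \<Rightarrow> real" where
  "gdist G P Q = (if P \<in> points G \<and> Q \<in> points G then Inf {L. path_len G P Q L} else 0)"

definition metric_graph :: "('v, 'e) mgraph \<Rightarrow> bool" where
  "metric_graph G \<longleftrightarrow>
     (\<forall>e\<in>edges G. 0 < len G e \<and> origin G e \<in> verts G \<and>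
        (len G e < \<infinity> \<longrightarrow> terminus G e \<in> verts G))"

definition class_G :: "('v, 'e) mgraph \<Rightarrow> bool" where
  "class_G G \<longleftrightarrow> metric_graph G \<and> connected_graph G \<and> countable (edges G) \<and>
     (\<forall>v\<in>verts G. finite {e \<in> edges G. incident G e v}) \<and>
     0 < (INF e\<in>edges G. len G e)"

definition class_G_fin :: "('v, 'e) mgraph \<Rightarrow> bool" where
  "class_G_fin G \<longleftrightarrow> class_G G \<and> finite (verts G) \<and> finite (edges G)"

definition compact_graph :: "('v, 'e) mgraph \<Rightarrow> bool" where
  "compact_graph G \<longleftrightarrow> finite (edges G) \<and> (\<forall>e\<in>edges G. len G e < \<infinity>)"

text \<open>The next lemmas show that \<open>gdist\<close> is a metric on every graph of the class, so that the
  library's \<open>metric\<close> may be applied to it.\<close>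

lemma path_len_nonneg: "path_len G P Q L \<Longrightarrow> 0 \<le> L"
  by (induction rule: path_len.induct) auto

lemma pt_in_points:
  assumes "metric_graph G" "e \<in> edges G" "x \<in> edge_dom G e"
  shows "pt G e x \<in> points G"
  using assms unfolding metric_graph_def pt_def points_def edge_dom_def edge_int_def
  by (auto simp: order_le_less)

lemma path_len_trans:
  assumes "path_len G Q R M" "path_len G P Q L"
  shows "path_len G P R (L + M)"
  using assms
proof (induction rule: path_len.induct)
  case (path_snoc Q e x M y)
  then show ?case
    using path_len.path_snoc[of G P e x "L + M" y] by (simp add: add.assoc)
qed auto

lemma path_len_sym:
  assumes "metric_graph G" "path_len G P Q L"
  shows "path_len G Q P L"
  using assms(2)
proof (induction rule: path_len.induct)
  case (path_nil P)
  then show ?case by (rule path_len.path_nil)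
next
  case (path_snoc P e x L y)
  have "path_len G (pt G e y) (pt G e x) (0 + \<bar>y - x\<bar>)"
    using path_snoc.hyps pt_in_points[OF assms(1)]
    by (intro path_len.path_snoc path_len.path_nil) auto
  from path_len_trans[OF path_snoc.IH this] show ?case
    by (simp add: abs_minus_commute add.commute)
qed

lemma path_len_lipschitz:
  fixes f :: "('v, 'e) gpoint \<Rightarrow> real"
  assumes "path_len G P Q L"
    and "\<And>e x y. \<lbrakk>e \<in> edges G; x \<in> edge_dom G e; y \<in> edge_dom G e\<rbrakk>
      \<Longrightarrow> \<bar>f (pt G e x) - f (pt G e y)\<bar> \<le> \<bar>x - y\<bar>"
  shows "\<bar>f P - f Q\<bar> \<le> L"
  using assms(1)
proof (induction rule: path_len.induct)
  case (path_snoc P e x L y)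
  then show ?case using assms(2)[of e x y] by linarith
qed simp

lemma separating_function:
  assumes G: "class_G G" and P: "P \<in> points G" and Q: "Q \<in> points G" and "P \<noteq> Q"
  obtains f :: "('v, 'e) gpoint \<Rightarrow> real" where "f P \<noteq> f Q"
    "\<And>e x y. \<lbrakk>e \<in> edges G; x \<in> edge_dom G e; y \<in> edge_dom G e\<rbrakk>
      \<Longrightarrow> \<bar>f (pt G e x) - f (pt G e y)\<bar> \<le> \<bar>x - y\<bar>"
proof -
  have interior: "\<exists>f :: ('v, 'e) gpoint \<Rightarrow> real. f P \<noteq> f Q \<and>
      (\<forall>e\<in>edges G. \<forall>x\<in>edge_dom G e. \<forall>y\<in>edge_dom G e.
        \<bar>f (pt G e x) - f (pt G e y)\<bar> \<le> \<bar>x - y\<bar>)"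
    if PI: "P = Interior e0 x0" and "P \<in> points G" "P \<noteq> Q" for P Q :: "('v, 'e) gpoint" and e0 x0
  proof -
    have x0: "0 < x0" "ereal x0 < len G e0"
      using that by (auto simp: points_def edge_int_def)
    obtain s where s: "0 < s" "ereal (x0 + s) \<le> len G e0"
      using x0(2) ereal_dense2[OF x0(2)]
      by (metis add_diff_cancel_left' diff_gt_0_iff_gt ereal_less_eq(3) less_ereal.simps(1)
          less_imp_le add.commute diff_add_cancel)
    define r where
      "r = min (min x0 s) (case Q of Interior e y \<Rightarrow> if e = e0 then \<bar>x0 - y\<bar> else 1 | _ \<Rightarrow> 1)"
    have r: "0 < r" "r \<le> x0" "r \<le> s"
      using x0 s PI \<open>P \<noteq> Q\<close> by (auto simp: r_def split: gpoint.splits)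
    define f :: "('v, 'e) gpoint \<Rightarrow> real" where
      "f = (\<lambda>R. case R of Vertex v \<Rightarrow> 0
        | Interior e x \<Rightarrow> if e = e0 then max 0 (r - \<bar>x - x0\<bar>) else 0)"
    have "f P = r" using PI r by (simp add: f_def)
    moreover have "f Q = 0"
      by (auto simp: f_def r_def split: gpoint.splits)
    moreover have "f (pt G e x) = (if e = e0 then max 0 (r - \<bar>x - x0\<bar>) else 0)"
      if "x \<in> edge_dom G e" for e x
    proof -
      have "x0 + s \<le> x" if "ereal x = len G e0"
        using s(2) unfolding that[symmetric] by simp
      then show ?thesis
        using r by (auto simp: f_def pt_def)
    qed
    ultimately show ?thesis using r(1)
      by (intro exI[of _ f]) auto
  qed
  have "\<exists>f :: ('v, 'e) gpoint \<Rightarrow> real. f P \<noteq> f Q \<and>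
      (\<forall>e\<in>edges G. \<forall>x\<in>edge_dom G e. \<forall>y\<in>edge_dom G e.
        \<bar>f (pt G e x) - f (pt G e y)\<bar> \<le> \<bar>x - y\<bar>)"
  proof (cases P)
    case (Interior e x)
    from interior[OF this P \<open>P \<noteq> Q\<close>] show ?thesis .
  next
    case PV: (Vertex v)
    show ?thesis
    proof (cases Q)
      case (Interior e x)
      from interior[OF this Q \<open>P \<noteq> Q\<close>[symmetric]] show ?thesis by metis
    next
      case QV: (Vertex w)
      have "0 < (INF e\<in>edges G. len G e)" using G by (simp add: class_G_def)
      then obtain r where "0 < ereal r" and r: "ereal r < (INF e\<in>edges G. len G e)"
        using ereal_dense2 by (metis zero_ereal_def)
      then have "0 < r" by simp
      have rl: "ereal r \<le> len G e" if "e \<in> edges G" for e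
        using r that by (meson INF_lower less_le_not_le order_trans)
      define b where "b = (\<lambda>e x. max 0 (max (if origin G e = v then r - x else 0)
         (if len G e < \<infinity> \<and> terminus G e = v then r - (real_of_ereal (len G e) - x) else 0)))"
      define f :: "('v, 'e) gpoint \<Rightarrow> real" where
        "f = (\<lambda>R. case R of Vertex u \<Rightarrow> if u = v then r else 0 | Interior e x \<Rightarrow> b e x)"
      have fb: "f (pt G e x) = b e x" if e: "e \<in> edges G" and x: "x \<in> edge_dom G e" for e x
      proof (cases "len G e")
        case (real l)
        then show ?thesis using rl[OF e] x \<open>0 < r\<close>
          by (auto simp: f_def b_def pt_def edge_dom_def)
      next
        case PInf
        then show ?thesis using rl[OF e] x \<open>0 < r\<close>
          by (auto simp: f_def b_def pt_def edge_dom_def)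
      next
        case MInf
        then show ?thesis using rl[OF e] by simp
      qed
      have "\<bar>b e x - b e y\<bar> \<le> \<bar>x - y\<bar>" for e x y
        by (auto simp: b_def max_def)
      moreover have "f P \<noteq> f Q"
        using PV QV \<open>P \<noteq> Q\<close> \<open>0 < r\<close> by (simp add: f_def)
      ultimately show ?thesis using fb by (intro exI[of _ f]) auto
    qed
  qed
  then show ?thesis using that by blast
qed

lemma Metric_space_gdist:
  assumes G: "class_G G"
  shows "Metric_space (points G) (gdist G)"
proof
  have mg: "metric_graph G" and cg: "connected_graph G"
    using G by (auto simp: class_G_def)
  have ne: "{L. path_len G P Q L} \<noteq> {}" if "P \<in> points G" "Q \<in> points G" for P Q
    using cg that by (auto simp: connected_graph_def)
  have bdd: "bdd_below {L. path_len G P Q L}" for P Q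
    using path_len_nonneg by (intro bdd_belowI[of _ 0]) auto
  show "0 \<le> gdist G P Q" for P Q
    using cInf_greatest[OF ne, of P Q 0] path_len_nonneg[of G P Q] by (auto simp: gdist_def)
  show "gdist G P Q = gdist G Q P" for P Q
  proof -
    have "{L. path_len G P Q L} = {L. path_len G Q P L}"
      using path_len_sym[OF mg] by blast
    then show ?thesis by (auto simp: gdist_def)
  qed
  fix P Q assume P: "P \<in> points G" and Q: "Q \<in> points G"
  show "gdist G P Q = 0 \<longleftrightarrow> P = Q"
  proof
    assume "P = Q"
    have "Inf {L. path_len G P P L} \<le> 0"
      using P bdd path_nil by (intro cInf_lower) auto
    moreover have "0 \<le> Inf {L. path_len G P P L}"
      using cInf_greatest[OF ne[OF P P], of 0] path_len_nonneg[of G P P] by auto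
    ultimately show "gdist G P Q = 0" using \<open>P = Q\<close> P by (simp add: gdist_def)
  next
    assume 0: "gdist G P Q = 0"
    show "P = Q"
    proof (rule ccontr)
      assume "P \<noteq> Q"
      obtain f :: "('a, 'b) gpoint \<Rightarrow> real" where f: "f P \<noteq> f Q"
        "\<And>e x y. \<lbrakk>e \<in> edges G; x \<in> edge_dom G e; y \<in> edge_dom G e\<rbrakk>
          \<Longrightarrow> \<bar>f (pt G e x) - f (pt G e y)\<bar> \<le> \<bar>x - y\<bar>"
        using separating_function[OF G P Q \<open>P \<noteq> Q\<close>] by metis
      have "\<bar>f P - f Q\<bar> \<le> Inf {L. path_len G P Q L}"
        using path_len_lipschitz[of G P Q _ f] f(2) by (intro cInf_greatest[OF ne[OF P Q]]) auto
      then show False using 0 f(1) P Q by (simp add: gdist_def)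
    qed
  qed
  fix R assume R: "R \<in> points G"
  have "gdist G P R \<le> L + M" if L: "path_len G P Q L" and M: "path_len G Q R M" for L M
    using path_len_trans[OF M L] P R bdd by (auto simp: gdist_def intro!: cInf_lower)
  then have "gdist G P R - L \<le> M" if "path_len G P Q L" "path_len G Q R M" for L M
    using that by (simp add: diff_le_eq add.commute)
  then have "gdist G P R - L \<le> Inf {M. path_len G Q R M}" if "path_len G P Q L" for L
    using that by (intro cInf_greatest[OF ne[OF Q R]]) auto
  then have "gdist G P R - gdist G Q R \<le> L" if "path_len G P Q L" for L
    using that Q R by (simp add: gdist_def[of G Q] diff_le_eq add.commute)
  then have "gdist G P R - gdist G Q R \<le> Inf {L. path_len G P Q L}"
    by (intro cInf_greatest[OF ne[OF P Q]]) auto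
  then have "gdist G P R - gdist G Q R \<le> gdist G P Q"
    using P Q by (simp add: gdist_def[of G P Q])
  then show "gdist G P R \<le> gdist G P Q + gdist G Q R" by linarith
qed

definition gmetric :: "('v, 'e) mgraph \<Rightarrow> ('v, 'e) gpoint metric" where
  "gmetric G = metric (points G, gdist G)"

abbreviation gtop :: "('v, 'e) mgraph \<Rightarrow> ('v, 'e) gpoint topology" where
  "gtop G \<equiv> mtopology_of (gmetric G)"

lemma mspace_gmetric: "class_G G \<Longrightarrow> mspace (gmetric G) = points G"
  and mdist_gmetric: "class_G G \<Longrightarrow> mdist (gmetric G) = gdist G"
  using Metric_space_gdist[of G]
  by (simp_all add: gmetric_def Metric_space.mspace_metric Metric_space.mdist_metric)


section \<open>Lebesgue and Sobolev spaces on intervals\<close>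

definition Lp_on :: "real \<Rightarrow> real set \<Rightarrow> (real \<Rightarrow> real) \<Rightarrow> bool" where
  "Lp_on q J f \<longleftrightarrow> f \<in> borel_measurable (lebesgue_on J) \<and>
     integrable (lebesgue_on J) (\<lambda>x. \<bar>f x\<bar> powr q)"

definition L1_loc_on :: "real set \<Rightarrow> (real \<Rightarrow> real) \<Rightarrow> bool" where
  "L1_loc_on J f \<longleftrightarrow> (\<forall>K. compact K \<and> K \<subseteq> J \<longrightarrow> integrable (lebesgue_on K) f)"

text \<open>\<open>C1_test J \<psi> \<psi>'\<close>: \<open>\<psi>\<close> is a \<open>C\<^sup>1\<close> function with compact support in the open set \<open>J\<close>
  and derivative \<open>\<psi>'\<close>.\<close>

definition C1_test :: "real set \<Rightarrow> (real \<Rightarrow> real) \<Rightarrow> (real \<Rightarrow> real) \<Rightarrow> bool" where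
  "C1_test J \<psi> \<psi>' \<longleftrightarrow> (\<forall>x. (\<psi> has_real_derivative \<psi>' x) (at x)) \<and> continuous_on UNIV \<psi>' \<and>
     (\<exists>K. compact K \<and> K \<subseteq> J \<and> (\<forall>x. x \<notin> K \<longrightarrow> \<psi> x = 0))"

definition is_weak_deriv :: "real set \<Rightarrow> (real \<Rightarrow> real) \<Rightarrow> (real \<Rightarrow> real) \<Rightarrow> bool" where
  "is_weak_deriv J f g \<longleftrightarrow> L1_loc_on J f \<and> L1_loc_on J g \<and>
     (\<forall>\<psi> \<psi>'. C1_test J \<psi> \<psi>' \<longrightarrow>
        integral\<^sup>L (lebesgue_on J) (\<lambda>x. f x * \<psi>' x) = - integral\<^sup>L (lebesgue_on J) (\<lambda>x. g x * \<psi> x))"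

text \<open>The weak derivative is determined up to null sets; some representative is chosen.\<close>

definition weak_deriv :: "real set \<Rightarrow> (real \<Rightarrow> real) \<Rightarrow> real \<Rightarrow> real" where
  "weak_deriv J f = (SOME g. is_weak_deriv J f g)"

definition H1_on :: "real set \<Rightarrow> (real \<Rightarrow> real) \<Rightarrow> bool" where
  "H1_on J f \<longleftrightarrow> Lp_on 2 J f \<and> (\<exists>g. is_weak_deriv J f g) \<and> Lp_on 2 J (weak_deriv J f)"


section \<open>Function spaces on metric graphs\<close>

text \<open>
  Functions defined everywhere on the graph are functions on \<open>gpoint\<close>.  Functions defined almost
  everywhere (elements of \<open>L\<^sup>q\<close>, weak derivatives) are families indexed by the edges, each
  considered on the open edge only: the vertices form a null set.
\<close>

definition restr :: "('v, 'e) mgraph \<Rightarrow> (('v, 'e) gpoint \<Rightarrow> real) \<Rightarrow> 'e \<Rightarrow> real \<Rightarrow> real" where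
  "restr G u e x = u (pt G e x)"

definition graph_deriv :: "('v, 'e) mgraph \<Rightarrow> (('v, 'e) gpoint \<Rightarrow> real) \<Rightarrow> 'e \<Rightarrow> real \<Rightarrow> real" where
  "graph_deriv G u e = weak_deriv (edge_int G e) (restr G u e)"

definition gintegral :: "('v, 'e) mgraph \<Rightarrow> ('e \<Rightarrow> real \<Rightarrow> real) \<Rightarrow> real" where
  "gintegral G f = (\<Sum>\<^sub>\<infinity>e\<in>edges G. integral\<^sup>L (lebesgue_on (edge_int G e)) (f e))"

definition gLp :: "('v, 'e) mgraph \<Rightarrow> real \<Rightarrow> ('e \<Rightarrow> real \<Rightarrow> real) \<Rightarrow> bool" where
  "gLp G q f \<longleftrightarrow> (\<forall>e\<in>edges G. Lp_on q (edge_int G e) (f e)) \<and>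
     (\<lambda>e. integral\<^sup>L (lebesgue_on (edge_int G e)) (\<lambda>x. \<bar>f e x\<bar> powr q)) summable_on edges G"

definition gLinf :: "('v, 'e) mgraph \<Rightarrow> ('e \<Rightarrow> real \<Rightarrow> real) \<Rightarrow> bool" where
  "gLinf G f \<longleftrightarrow> (\<forall>e\<in>edges G. f e \<in> borel_measurable (lebesgue_on (edge_int G e))) \<and>
     (\<exists>M. \<forall>e\<in>edges G. AE x in lebesgue_on (edge_int G e). \<bar>f e x\<bar> \<le> M)"

definition gnonneg :: "('v, 'e) mgraph \<Rightarrow> ('e \<Rightarrow> real \<Rightarrow> real) \<Rightarrow> bool" where
  "gnonneg G f \<longleftrightarrow> (\<forall>e\<in>edges G. AE x in lebesgue_on (edge_int G e). 0 \<le> f e x)"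

definition gcontinuous :: "('v, 'e) mgraph \<Rightarrow> (('v, 'e) gpoint \<Rightarrow> real) \<Rightarrow> bool" where
  "gcontinuous G u \<longleftrightarrow> continuous_map (gtop G) euclideanreal u"

definition gsupp :: "('v, 'e) mgraph \<Rightarrow> (('v, 'e) gpoint \<Rightarrow> real) \<Rightarrow> ('v, 'e) gpoint set" where
  "gsupp G u = gtop G closure_of {P \<in> points G. u P \<noteq> 0}"

definition gC_c :: "('v, 'e) mgraph \<Rightarrow> (('v, 'e) gpoint \<Rightarrow> real) set" where
  "gC_c G = {u. gcontinuous G u \<and> compactin (gtop G) (gsupp G u)}"

definition gH1 :: "('v, 'e) mgraph \<Rightarrow> (('v, 'e) gpoint \<Rightarrow> real) set" where
  "gH1 G = {u. gcontinuous G u \<and> (\<forall>e\<in>edges G. H1_on (edge_int G e) (restr G u e)) \<and>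
     (\<lambda>e. integral\<^sup>L (lebesgue_on (edge_int G e)) (\<lambda>x. (graph_deriv G u e x)\<^sup>2) +
          integral\<^sup>L (lebesgue_on (edge_int G e)) (\<lambda>x. (restr G u e x)\<^sup>2)) summable_on edges G}"

text \<open>\<open>H\<^sup>1\<close> on bounded parts of the edges, up to and including the vertices (so that, on a bounded
  edge, the condition is \<open>H\<^sup>1\<close> on the whole edge).\<close>

definition gH1_loc :: "('v, 'e) mgraph \<Rightarrow> (('v, 'e) gpoint \<Rightarrow> real) set" where
  "gH1_loc G = {u. gcontinuous G u \<and>
     (\<forall>e\<in>edges G. (\<exists>g. is_weak_deriv (edge_int G e) (restr G u e) g) \<and>
        (\<forall>b. Lp_on 2 (edge_int G e \<inter> {..b}) (restr G u e) \<and>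
             Lp_on 2 (edge_int G e \<inter> {..b}) (graph_deriv G u e)))}"


section \<open>Solutions and stability\<close>

definition solution ::
  "('v, 'e) mgraph \<Rightarrow> real \<Rightarrow> ('e \<Rightarrow> real \<Rightarrow> real) \<Rightarrow> ('e \<Rightarrow> real \<Rightarrow> real) \<Rightarrow>
     (('v, 'e) gpoint \<Rightarrow> real) \<Rightarrow> bool" where
  "solution G p W \<rho> u \<longleftrightarrow> u \<in> gH1_loc G \<and>
     (\<forall>\<phi> \<in> gH1 G \<inter> gC_c G.
        gintegral G (\<lambda>e x. graph_deriv G u e x * graph_deriv G \<phi> e x + W e x * restr G u e x * restr G \<phi> e x)
      = gintegral G (\<lambda>e x. \<rho> e x * \<bar>restr G u e x\<bar> powr (p - 2) * restr G u e x * restr G \<phi> e x))"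

definition Q_form ::
  "('v, 'e) mgraph \<Rightarrow> real \<Rightarrow> ('e \<Rightarrow> real \<Rightarrow> real) \<Rightarrow> ('e \<Rightarrow> real \<Rightarrow> real) \<Rightarrow>
     (('v, 'e) gpoint \<Rightarrow> real) \<Rightarrow> (('v, 'e) gpoint \<Rightarrow> real) \<Rightarrow> real" where
  "Q_form G p W \<rho> u \<phi> = gintegral G (\<lambda>e x.
     \<bar>graph_deriv G \<phi> e x\<bar>\<^sup>2 + W e x * \<bar>restr G \<phi> e x\<bar>\<^sup>2
     - (p - 1) * \<rho> e x * \<bar>restr G u e x\<bar> powr (p - 2) * \<bar>restr G \<phi> e x\<bar>\<^sup>2)"

definition stable_outside ::
  "('v, 'e) mgraph \<Rightarrow> real \<Rightarrow> ('e \<Rightarrow> real \<Rightarrow> real) \<Rightarrow> ('e \<Rightarrow> real \<Rightarrow> real) \<Rightarrow>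
     (('v, 'e) gpoint \<Rightarrow> real) \<Rightarrow> ('v, 'e) gpoint set \<Rightarrow> bool" where
  "stable_outside G p W \<rho> u C \<longleftrightarrow>
     (\<forall>\<phi> \<in> gH1 G \<inter> gC_c G. gsupp G \<phi> \<subseteq> points G - C \<longrightarrow> 0 \<le> Q_form G p W \<rho> u \<phi>)"

definition ess_inf_on :: "real set \<Rightarrow> (real \<Rightarrow> real) \<Rightarrow> ereal" where
  "ess_inf_on A f = Sup {a. AE x in lebesgue_on A. a \<le> ereal (f x)}"

definition ess_liminf_at_top :: "(real \<Rightarrow> real) \<Rightarrow> ereal" where
  "ess_liminf_at_top f = (SUP R\<in>{0<..}. ess_inf_on {R<..} f)"

end

theory Submission
  imports Defs
begin

text \<open>
  On a half-line beyond \<open>C\<close>, insert \<open>u \<eta>\<^sup>2\<close> in the equation and \<open>u \<eta>\<close> in the stability inequality, with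
  \<open>\<eta>\<close> a cutoff that rises and falls on intervals of unit length.  Subtracting gives
  \<open>(p - 2) \<integral> \<rho> |u|\<^sup>p \<eta>\<^sup>2 \<le> \<integral> u\<^sup>2 \<eta>'\<^sup>2\<close>, which is bounded independently of the length of the plateau since
  \<open>u\<close> is bounded; Young's inequality in the equation then bounds \<open>\<integral> (u'\<^sup>2 + W u\<^sup>2) \<eta>\<^sup>2\<close> as well.  Testing
  the equation on a single edge shows that \<open>u''\<close> is bounded, hence \<open>u\<close>, being bounded, is Lipschitz on each
  edge and on the graph; a Lipschitz function with an integrable power tends to \<open>0\<close> (Barbalat).
\<close>

section \<open>Weak derivatives on the line\<close>

text \<open>The equation tested with \<open>u \<eta>\<^sup>2\<close> and the stability form at
  \<open>u \<eta>\<close> have the same quadratic terms up to \<open>(u \<eta>')\<^sup>2\<close>,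
  because \<open>((u \<eta>)')\<^sup>2 = u' (u \<eta>\<^sup>2)' + (u \<eta>')\<^sup>2\<close>. The
  term \<open>\<rho> |u|\<^sup>p\<close> has weight 1 in one and \<open>p - 1\<close> in the other,
  hence the factor \<open>p - 2\<close>. Ramps of unit length give \<open>|\<eta>'| \<le> 2\<close>
  on a set of measure at most 2, so the error is at most \<open>8 B\<^sup>2\<close> when
  \<open>|u| \<le> B\<close>.

  The obstacle is that weak derivatives are accessible only through integrals against
  \<open>C\<^sup>1\<close> functions, and \<open>weak_deriv\<close> is an arbitrary representative.
  The Lipschitz bound is therefore obtained without pointwise values of \<open>u'\<close>: second
  differences of \<open>u\<close> are limits of integrals of \<open>u\<close> against second
  derivatives of trapezoids, and two integrations by parts shift these derivatives to
  \<open>u\<close>. All test functions are extended by zero from a compact part of one open edge,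
  which reduces the estimates to intervals. Bounded edges and the initial part of a half-line are
  covered by \<open>gH1_loc\<close> and the bound on \<open>u\<close>.\<close>

text \<open>Dynkin argument: the Borel sets over which the integral vanishes are closed under
  complements, thanks to the zero total integral, and under countable disjoint unions; the open
  intervals form a generating family stable under intersection.\<close>

lemma AE_lebesgue_eq_zero_if_Ioo:
  fixes f :: "real \<Rightarrow> real"
  assumes f: "integrable lebesgue f" and tot: "integral\<^sup>L lebesgue f = 0"
    and ioo: "\<And>a b. a < b \<Longrightarrow> (\<integral>x. indicator {a<..<b} x * f x \<partial>lebesgue) = 0"
  shows "AE x in lebesgue. f x = 0"
proof -
  \<comment> \<open>Open intervals generate the Borel sets only, so a Borel representative takes the
    place of the Lebesgue measurable \<open>f\<close>.\<close>
  obtain g where g[measurable]: "g \<in> borel_measurable lborel" and fg: "AE x in lborel. f x = g x"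
    using completion_ex_borel_measurable_real[OF borel_measurable_integrable[OF f]] by auto
  have fg': "AE x in lebesgue. f x = g x" using fg by (rule AE_completion)
  have gl: "integrable lebesgue g"
    using f fg' g by (subst integrable_cong_AE[of _ _ f]) (auto intro: measurable_completion)
  then have gi: "integrable lborel g" by (simp add: integrable_completion g)
  have eq: "(\<integral>x. indicator A x * g x \<partial>lborel) = (\<integral>x. indicator A x * f x \<partial>lebesgue)"
    if A: "A \<in> sets borel" for A
  proof -
    have "(\<integral>x. indicator A x * g x \<partial>lborel) = (\<integral>x. indicator A x * g x \<partial>lebesgue)"
      using A by (intro integral_completion[symmetric]) simp
    also have "\<dots> = (\<integral>x. indicator A x * f x \<partial>lebesgue)"
      using fg' A borel_measurable_integrable[OF f] borel_measurable_integrable[OF gl]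
      by (intro integral_cong_AE borel_measurable_times borel_measurable_indicator) auto
    finally show ?thesis .
  qed
  have int: "set_integrable lborel A g" if "A \<in> sets borel" for A
    unfolding set_integrable_def using that gi by (intro integrable_mult_indicator) auto
  have gen: "sets borel = sigma_sets UNIV (range (\<lambda>(a, b). {a<..<b::real}))"
  proof -
    have eq: "(\<lambda>(a, b). box a b) = (\<lambda>(a, b). {a<..<b::real})" by (auto simp: fun_eq_iff box_real)
    show ?thesis by (subst borel_eq_box) (simp only: eq sets_measure_of subset_UNIV Pow_UNIV)
  qed
  have z: "set_lebesgue_integral lborel A g = 0" if "A \<in> sets lborel" for A
  proof -
    have uni: "set_lebesgue_integral lborel UNIV g = 0"
      using eq[of UNIV] tot by (simp add: set_lebesgue_integral_def)
    have "Int_stable (range (\<lambda>(a, b). {a<..<b::real}))" "range (\<lambda>(a, b). {a<..<b::real}) \<subseteq> Pow UNIV"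
      "A \<in> sigma_sets UNIV (range (\<lambda>(a, b). {a<..<b::real}))"
      using that by (auto simp: Int_stable_def gen)
    then show ?thesis
    proof (induction rule: sigma_sets_induct_disjoint)
      case (basic A)
      then obtain a b where A: "A = {a<..<b}" by auto
      show ?case
      proof (cases "a < b")
        case True
        then show ?thesis using ioo[of a b] eq[of A] by (simp add: A set_lebesgue_integral_def)
      qed (simp add: A set_lebesgue_integral_def)
    next
      case (compl A)
      then have A: "A \<in> sets borel" by (simp add: gen)
      have "set_lebesgue_integral lborel (A \<union> (UNIV - A)) g
          = set_lebesgue_integral lborel A g + set_lebesgue_integral lborel (UNIV - A) g"
        using A by (intro set_integral_Un int) auto
      then show ?case using compl uni by simp
    next
      case (union A)
      then have A: "A i \<in> sets borel" for i by (auto simp: gen)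
      have "set_lebesgue_integral lborel (\<Union>i. A i) g = (\<Sum>i. set_lebesgue_integral lborel (A i) g)"
        using A union(1) by (intro lebesgue_integral_countable_add int) (auto simp: disjoint_family_on_def)
      then show ?case using union by simp
    qed (auto simp: set_lebesgue_integral_def)
  qed
  have "AE x in lborel. g x = 0"
    by (intro sigma_finite_measure.density_zero gi z) unfold_locales
  then have "AE x in lborel. f x = 0" using fg by auto
  then show ?thesis by (rule AE_completion)
qed

text \<open>Truncated powers and their divided differences give an explicit \<open>C\<^sup>2\<close> function \<open>ramp2\<close>
  whose first derivative \<open>step1\<close> is a \<open>C\<^sup>1\<close> step from 0 to 1 and whose second derivative
  \<open>hat\<close> is a continuous bump of unit mass on \<open>[0, 1]\<close>.\<close>

definition hat :: "real \<Rightarrow> real" where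
  "hat t = 4 * max 0 t - 8 * max 0 (t - 1/2) + 4 * max 0 (t - 1)"

definition step1 :: "real \<Rightarrow> real" where
  "step1 t = 2 * (max 0 t)\<^sup>2 - 4 * (max 0 (t - 1/2))\<^sup>2 + 2 * (max 0 (t - 1))\<^sup>2"

definition ramp2 :: "real \<Rightarrow> real" where
  "ramp2 t = 2/3 * (max 0 t) ^ 3 - 4/3 * (max 0 (t - 1/2)) ^ 3 + 2/3 * (max 0 (t - 1)) ^ 3"

text \<open>At the kink the difference quotient is a positive power of \<open>max 0 h\<close> and
  tends to 0. This requires an exponent of at least 2, whence \<open>Suc (Suc n)\<close>.\<close>

lemma DERIV_trunc_power:
  "((\<lambda>t::real. (max 0 t) ^ Suc (Suc n)) has_real_derivative real (Suc (Suc n)) * (max 0 t) ^ Suc n) (at t)"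
proof -
  consider "t > 0" | "t < 0" | "t = 0" by linarith
  then show ?thesis
  proof cases
    case 1
    have "((\<lambda>t::real. t ^ Suc (Suc n)) has_real_derivative real (Suc (Suc n)) * t ^ Suc n) (at t)"
      using DERIV_pow[of "Suc (Suc n)" t] by (simp del: power_Suc)
    moreover have ev: "\<forall>\<^sub>F s in nhds t. s ^ Suc (Suc n) = (max 0 s) ^ Suc (Suc n)"
      using eventually_nhds_in_open[of "{0<..}" t] 1
      by (auto elim!: eventually_mono simp: max_def)
    ultimately show ?thesis
      using DERIV_cong_ev[OF refl ev refl] 1 by (simp add: max_def del: power_Suc)
  next
    case 2
    have "\<forall>\<^sub>F s in nhds t. 0 = (max 0 s) ^ Suc (Suc n)"
      using eventually_nhds_in_open[of "{..<0}" t] 2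
      by (auto elim!: eventually_mono simp: max_def)
    from DERIV_cong_ev[OF refl this refl, THEN iffD1, OF DERIV_const]
    show ?thesis using 2 by (simp add: max_def)
  next
    case 3
    have "(\<lambda>h::real. (max 0 h) ^ Suc n) \<midarrow>0\<rightarrow> (max 0 0) ^ Suc n"
      by (intro tendsto_intros)
    then have lim: "(\<lambda>h::real. (max 0 h) ^ Suc n) \<midarrow>0\<rightarrow> 0" by simp
    have "(\<lambda>h::real. (max 0 h) ^ Suc (Suc n) / h) \<midarrow>0\<rightarrow> 0"
      by (rule Lim_transform_eventually[OF lim])
         (auto simp: eventually_at_filter max_def intro!: always_eventually)
    then show ?thesis unfolding 3 DERIV_def by (simp del: power_Suc)
  qed
qed

lemma DERIV_step1: "(step1 has_real_derivative hat t) (at t)"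
proof -
  have d: "((\<lambda>t. (max 0 (t - c))\<^sup>2) has_real_derivative 2 * max 0 (t - c)) (at t)" for c :: real
    using DERIV_shift[of "\<lambda>t::real. (max 0 t)\<^sup>2" "2 * max 0 (t - c)" t "- c"]
      DERIV_trunc_power[of 0 "t - c"] by (simp add: numeral_2_eq_2)
  show ?thesis unfolding step1_def[abs_def] hat_def
    using DERIV_add[OF DERIV_diff[OF DERIV_cmult[OF d[of 0], of 2]
      DERIV_cmult[OF d[of "1/2"], of 4]] DERIV_cmult[OF d[of 1], of 2]] by simp
qed

lemma DERIV_ramp2: "(ramp2 has_real_derivative step1 t) (at t)"
proof -
  have d: "((\<lambda>t. (max 0 (t - c)) ^ 3) has_real_derivative 3 * (max 0 (t - c))\<^sup>2) (at t)" for c :: real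
    using DERIV_shift[of "\<lambda>t::real. (max 0 t) ^ 3" "3 * (max 0 (t - c))\<^sup>2" t "- c"]
      DERIV_trunc_power[of 1 "t - c"] by (simp add: numeral_2_eq_2 numeral_3_eq_3)
  show ?thesis unfolding ramp2_def[abs_def] step1_def
    using DERIV_add[OF DERIV_diff[OF DERIV_cmult[OF d[of 0], of "2/3"]
      DERIV_cmult[OF d[of "1/2"], of "4/3"]] DERIV_cmult[OF d[of 1], of "2/3"]] by simp
qed

lemma continuous_on_hat: "continuous_on S hat"
  unfolding hat_def[abs_def] by (intro continuous_intros)

lemma hat_bounds: "0 \<le> hat t" "hat t \<le> 2"
  by (auto simp: hat_def max_def)

lemma hat_outside: "t \<le> 0 \<or> 1 \<le> t \<Longrightarrow> hat t = 0"
  by (auto simp: hat_def max_def)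

lemma step1_le_0 [simp]: "t \<le> 0 \<Longrightarrow> step1 t = 0"
  by (auto simp: step1_def)

lemma step1_ge_1 [simp]: "1 \<le> t \<Longrightarrow> step1 t = 1"
  by (auto simp: step1_def max_def power2_eq_square algebra_simps)

lemma mono_step1: "s \<le> t \<Longrightarrow> step1 s \<le> step1 t"
  by (rule DERIV_nonneg_imp_nondecreasing[of s t]) (auto intro: DERIV_step1 hat_bounds)

lemma step1_bounds: "0 \<le> step1 t" "step1 t \<le> 1"
  using mono_step1[of 0 t] mono_step1[of t 0] mono_step1[of 1 t] mono_step1[of t 1]
  by (cases "t \<le> 0"; cases "t \<le> 1"; simp)+

lemma ramp2_le_0 [simp]: "t \<le> 0 \<Longrightarrow> ramp2 t = 0"
  by (auto simp: ramp2_def)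

text \<open>The offset \<open>1/2\<close> is the centre of mass of \<open>hat\<close>. It is the
  same for every translate and cancels in the differences of ramps that form a trapezoid.\<close>

lemma ramp2_ge_1: "1 \<le> t \<Longrightarrow> ramp2 t = t - 1/2"
  by (auto simp: ramp2_def max_def power3_eq_cube algebra_simps)

lemma ramp2_mono_lipschitz:
  assumes "s \<le> t"
  shows "ramp2 s \<le> ramp2 t" "ramp2 t - ramp2 s \<le> t - s"
proof -
  show "ramp2 s \<le> ramp2 t"
    by (rule DERIV_nonneg_imp_nondecreasing[OF assms]) (auto intro: DERIV_ramp2 step1_bounds)
  have "s - ramp2 s \<le> t - ramp2 t"
    by (rule DERIV_nonneg_imp_nondecreasing[OF assms])
       (auto intro!: derivative_eq_intros DERIV_ramp2 exI[of _ "1 - step1 _"] simp: step1_bounds)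
  then show "ramp2 t - ramp2 s \<le> t - s" by simp
qed

lemma integral_hat: "integral\<^sup>L lborel hat = 1"
proof -
  have "has_bochner_integral lborel (\<lambda>x. hat x * indicator {0..1} x) (step1 1 - step1 0)"
    using DERIV_step1 continuous_on_hat[of UNIV]
    by (intro has_bochner_integral_FTC_Icc_real) (auto simp: continuous_on_eq_continuous_at)
  moreover have "hat x * indicator {0..1} x = hat x" for x
    using hat_outside[of x] by (cases "0 < x \<and> x < 1") (auto simp: indicator_def)
  ultimately show ?thesis by (simp add: has_bochner_integral_integral_eq)
qed

section \<open>Integrability against compactly supported functions\<close>

lemma
  fixes f :: "real \<Rightarrow> real"
  assumes "K \<subseteq> J" "K \<in> sets lebesgue" "J \<in> sets lebesgue" "\<And>x. x \<in> J \<Longrightarrow> x \<notin> K \<Longrightarrow> f x = 0"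
  shows integrable_lebesgue_on_zero_outside: "integrable (lebesgue_on J) f \<longleftrightarrow> integrable (lebesgue_on K) f"
    and integral_lebesgue_on_zero_outside: "integral\<^sup>L (lebesgue_on J) f = integral\<^sup>L (lebesgue_on K) f"
proof -
  have eq: "(\<lambda>x. if x \<in> J then f x else 0) = (\<lambda>x. if x \<in> K then f x else 0)"
    using assms by fastforce
  show "integrable (lebesgue_on J) f \<longleftrightarrow> integrable (lebesgue_on K) f"
    using Lebesgue_Measure.integrable_restrict_UNIV[of J f] Lebesgue_Measure.integrable_restrict_UNIV[of K f] assms eq by simp
  show "integral\<^sup>L (lebesgue_on J) f = integral\<^sup>L (lebesgue_on K) f"
    using Lebesgue_Measure.integral_restrict_UNIV[of J f] Lebesgue_Measure.integral_restrict_UNIV[of K f] assms eq by simp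
qed

lemma integrable_times_bounded:
  fixes f h :: "'a \<Rightarrow> real"
  assumes "integrable M f" "h \<in> borel_measurable M" "AE x in M. \<bar>h x\<bar> \<le> B"
  shows "integrable M (\<lambda>x. f x * h x)"
proof (rule Bochner_Integration.integrable_bound)
  show "integrable M (\<lambda>x. B * \<bar>f x\<bar>)" using assms(1) by auto
  show "(\<lambda>x. f x * h x) \<in> borel_measurable M"
    using assms by (intro borel_measurable_times) auto
  show "AE x in M. norm (f x * h x) \<le> norm (B * \<bar>f x\<bar>)"
    using assms(3)
  proof eventually_elim
    case (elim x)
    then show ?case
      using mult_left_mono[OF elim, of "\<bar>f x\<bar>"] by (simp add: abs_mult mult.commute)
  qed
qed

lemma integrable_times_continuous_on:
  fixes f h :: "real \<Rightarrow> real"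
  assumes "compact K" "integrable (lebesgue_on K) f" "continuous_on K h"
  shows "integrable (lebesgue_on K) (\<lambda>x. f x * h x)"
proof -
  have "bounded (h ` K)" using assms compact_continuous_image compact_imp_bounded by blast
  then obtain B where "\<And>x. x \<in> K \<Longrightarrow> \<bar>h x\<bar> \<le> B" by (auto simp: bounded_iff)
  moreover have "K \<in> sets lebesgue" using \<open>compact K\<close> by (simp add: compact_imp_closed)
  ultimately show ?thesis
    using assms by (intro integrable_times_bounded[where B = B])
      (auto simp: continuous_imp_measurable_on_sets_lebesgue intro!: AE_I2)
qed

lemma L1_loc_on_times_continuous:
  assumes "L1_loc_on J f" "continuous_on J h"
  shows "L1_loc_on J (\<lambda>x. f x * h x)"
  unfolding L1_loc_on_def
proof (intro allI impI, elim conjE)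
  fix K assume K: "compact K" "K \<subseteq> J"
  show "integrable (lebesgue_on K) (\<lambda>x. f x * h x)"
    using assms K unfolding L1_loc_on_def
    by (intro integrable_times_continuous_on[OF K(1)] continuous_on_subset[OF assms(2) K(2)]) blast
qed

lemma L1_loc_on_continuous: "continuous_on J f \<Longrightarrow> L1_loc_on J f"
  unfolding L1_loc_on_def
proof (intro allI impI, elim conjE)
  fix K assume f: "continuous_on J f" and K: "compact K" "K \<subseteq> J"
  have "integrable (lebesgue_on K) (\<lambda>x. 1::real)"
    using finite_measure.integrable_const[OF finite_measure_lebesgue_on[OF lmeasurable_compact[OF K(1)]]] .
  from integrable_times_continuous_on[OF K(1) this continuous_on_subset[OF f K(2)]]
  show "integrable (lebesgue_on K) f" by simp
qed

lemma L1_loc_on_add: "L1_loc_on J f \<Longrightarrow> L1_loc_on J g \<Longrightarrow> L1_loc_on J (\<lambda>x. f x + g x)"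
  unfolding L1_loc_on_def by auto

lemma L1_loc_on_diff: "L1_loc_on J f \<Longrightarrow> L1_loc_on J g \<Longrightarrow> L1_loc_on J (\<lambda>x. f x - g x)"
  unfolding L1_loc_on_def by auto

lemma DERIV_imp_continuous_on:
  fixes f :: "real \<Rightarrow> real"
  assumes "\<And>x. (f has_real_derivative f' x) (at x)"
  shows "continuous_on S f"
  using assms by (meson DERIV_isCont continuous_at_imp_continuous_on)

text \<open>The complement of \<open>K\<close> is open and the function vanishes on it, so the
  derivative vanishes there too: one compact set serves both.\<close>

lemma C1_testE:
  assumes "C1_test J \<psi> \<psi>'"
  obtains K where "compact K" "K \<subseteq> J" "\<And>x. x \<notin> K \<Longrightarrow> \<psi> x = 0" "\<And>x. x \<notin> K \<Longrightarrow> \<psi>' x = 0"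
proof -
  obtain K where K: "compact K" "K \<subseteq> J" "\<And>x. x \<notin> K \<Longrightarrow> \<psi> x = 0"
    using assms by (auto simp: C1_test_def)
  have "\<psi>' x = 0" if "x \<notin> K" for x
  proof -
    have "open (- K)" using compact_imp_closed[OF K(1)] by (rule open_Compl)
    then have "\<forall>\<^sub>F y in nhds x. \<psi> y = 0"
      using eventually_nhds_in_open[of "- K" x] that K(3) by (auto elim: eventually_mono)
    then have "(\<psi> has_real_derivative 0) (at x)"
      using DERIV_cong_ev[of x x \<psi> "\<lambda>_. 0" 0 0] by simp
    moreover have "(\<psi> has_real_derivative \<psi>' x) (at x)" using assms by (simp add: C1_test_def)
    ultimately show ?thesis by (rule DERIV_unique[symmetric])
  qed
  with K that show ?thesis by blast
qed

lemma C1_test_continuous: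
  assumes "C1_test J \<psi> \<psi>'"
  shows "continuous_on S \<psi>" "continuous_on S \<psi>'"
proof -
  show "continuous_on S \<psi>"
    using assms unfolding C1_test_def by (intro DERIV_imp_continuous_on) blast
  show "continuous_on S \<psi>'"
    using assms unfolding C1_test_def by (blast intro: continuous_on_subset)
qed

text \<open>The product vanishes outside the same compact set as \<open>\<psi>\<close>. This is the
  source of the product rule for weak derivatives, and it supplies the square of a cutoff as a test
  function.\<close>

lemma C1_test_mult:
  assumes "C1_test J \<psi> \<psi>'" and z: "\<And>x. (\<zeta> has_real_derivative \<zeta>' x) (at x)" "continuous_on UNIV \<zeta>'"
  shows "C1_test J (\<lambda>x. \<zeta> x * \<psi> x) (\<lambda>x. \<zeta> x * \<psi>' x + \<zeta>' x * \<psi> x)"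
proof -
  have "continuous_on UNIV \<zeta>" using z(1) by (rule DERIV_imp_continuous_on)
  then have "continuous_on UNIV (\<lambda>x. \<zeta> x * \<psi>' x + \<zeta>' x * \<psi> x)"
    using C1_test_continuous[OF assms(1)] z by (intro continuous_intros)
  moreover have "((\<lambda>x. \<zeta> x * \<psi> x) has_real_derivative \<zeta> x * \<psi>' x + \<zeta>' x * \<psi> x) (at x)" for x
  proof -
    have "(\<psi> has_real_derivative \<psi>' x) (at x)" using assms(1) unfolding C1_test_def by blast
    from DERIV_mult[OF z(1) this] show ?thesis by (simp add: algebra_simps)
  qed
  moreover have "\<exists>K. compact K \<and> K \<subseteq> J \<and> (\<forall>x. x \<notin> K \<longrightarrow> \<zeta> x * \<psi> x = 0)"
  proof -
    obtain K where "compact K" "K \<subseteq> J" "\<forall>x. x \<notin> K \<longrightarrow> \<psi> x = 0"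
      using assms(1) unfolding C1_test_def by blast
    then show ?thesis by (intro exI[of _ K]) simp
  qed
  ultimately show ?thesis unfolding C1_test_def by blast
qed

lemma integrable_L1_loc_times_compact_support:
  assumes J: "J \<in> sets lebesgue" and f: "L1_loc_on J f" and K: "compact K" "K \<subseteq> J"
    and h: "continuous_on K h" "\<And>x. x \<notin> K \<Longrightarrow> h x = 0"
  shows "integrable (lebesgue_on J) (\<lambda>x. f x * h x)"
proof -
  have "integrable (lebesgue_on K) (\<lambda>x. f x * h x)"
    using f K h by (intro integrable_times_continuous_on) (auto simp: L1_loc_on_def)
  then show ?thesis
    using J K h by (subst integrable_lebesgue_on_zero_outside[of K]) (auto simp: compact_imp_closed)
qed

lemma integrable_L1_loc_times_test:
  assumes "J \<in> sets lebesgue" "L1_loc_on J f" "C1_test J \<psi> \<psi>'"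
  shows "integrable (lebesgue_on J) (\<lambda>x. f x * \<psi> x)" "integrable (lebesgue_on J) (\<lambda>x. f x * \<psi>' x)"
proof -
  obtain K where K: "compact K" "K \<subseteq> J" "\<And>x. x \<notin> K \<Longrightarrow> \<psi> x = 0" "\<And>x. x \<notin> K \<Longrightarrow> \<psi>' x = 0"
    by (rule C1_testE[OF assms(3)]) (rule that)
  show "integrable (lebesgue_on J) (\<lambda>x. f x * \<psi> x)" "integrable (lebesgue_on J) (\<lambda>x. f x * \<psi>' x)"
    by (rule integrable_L1_loc_times_compact_support[OF assms(1,2) K(1,2) C1_test_continuous(1)[OF assms(3)] K(3)], assumption,
        rule integrable_L1_loc_times_compact_support[OF assms(1,2) K(1,2) C1_test_continuous(2)[OF assms(3)] K(4)])
qed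

section \<open>The fundamental lemma of the calculus of variations\<close>

text \<open>A smoothed indicator of \<open>{a..b}\<close> whose ramps have width
  \<open>(b - a) / Suc n\<close>. The \<open>+ 1\<close> puts the falling ramp to the left of
  \<open>b\<close>, so the support stays in \<open>{a..b}\<close>; \<open>Suc n\<close> keeps the
  ramps no wider than the interval. For \<open>n = 0\<close> the two ramps cancel.\<close>

definition plateau :: "real \<Rightarrow> real \<Rightarrow> nat \<Rightarrow> real \<Rightarrow> real" where
  "plateau a b n s = step1 ((s - a) * (real (Suc n) / (b - a)))
     - step1 ((s - b) * (real (Suc n) / (b - a)) + 1)"

lemma
  assumes ab: "a < b"
  shows C1_test_plateau: "{a..b} \<subseteq> J \<Longrightarrow> \<exists>\<psi>'. C1_test J (plateau a b n) \<psi>'"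
    and abs_plateau_le_1: "\<bar>plateau a b n s\<bar> \<le> 1"
    and plateau_outside: "s \<notin> {a..b} \<Longrightarrow> plateau a b n s = 0"
    and plateau_tendsto: "(\<lambda>n. plateau a b n s) \<longlonglongrightarrow> indicator {a<..<b} s"
proof -
  define c where "c = (\<lambda>n. real (Suc n) / (b - a))"
  define \<psi> where "\<psi> = plateau a b"
  then have plateau_psi: "plateau a b = \<psi>" by simp
  have \<psi>_def: "\<psi> n = (\<lambda>s. step1 ((s - a) * c n) - step1 ((s - b) * c n + 1))" for n
    by (simp add: fun_eq_iff \<psi>_def plateau_def c_def)
  have c: "c n > 0" "(b - a) * c n = real (Suc n)" for n using ab by (auto simp: c_def)
  have lo: "\<psi> n s = 0" if "s \<le> a" for n s
  proof -
    have "(s - b) * c n \<le> (a - b) * c n" using that c(1)[of n] by (intro mult_right_mono) auto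
    also have "\<dots> = - real (Suc n)" using c(2)[of n] by (simp add: algebra_simps)
    finally show ?thesis using that c(1)[of n] by (auto simp: \<psi>_def mult_le_0_iff)
  qed
  have hi: "\<psi> n s = 0" if "b \<le> s" for n s
  proof -
    have "(b - a) * c n \<le> (s - a) * c n" using that c(1)[of n] by (intro mult_right_mono) auto
    then have "1 \<le> (s - a) * c n" using c(2)[of n] by simp
    then show ?thesis using that c(1)[of n] by (simp add: \<psi>_def)
  qed
  have zero: "\<psi> n s = 0" if "s \<notin> {a..b}" for n s using that lo[of s n] hi[of s n] by auto
  show "plateau a b n s = 0" if "s \<notin> {a..b}"
    using zero[OF that] by (simp only: plateau_psi)
  show "\<bar>plateau a b n s\<bar> \<le> 1"
    using step1_bounds[of "(s - a) * c n"] step1_bounds[of "(s - b) * c n + 1"]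
    by (simp add: \<psi>_def plateau_psi abs_le_iff)
  have d: "(\<psi> n has_real_derivative hat ((s - a) * c n) * c n - hat ((s - b) * c n + 1) * c n) (at s)" for s
  proof -
    have "((\<lambda>s. step1 ((s - a) * c n)) has_real_derivative hat ((s - a) * c n) * c n) (at s)"
      by (rule DERIV_chain2[OF DERIV_step1]) (auto intro!: derivative_eq_intros)
    moreover have "((\<lambda>s. step1 ((s - b) * c n + 1)) has_real_derivative hat ((s - b) * c n + 1) * c n) (at s)"
      by (rule DERIV_chain2[OF DERIV_step1]) (auto intro!: derivative_eq_intros)
    ultimately show ?thesis unfolding \<psi>_def by (rule DERIV_diff)
  qed
  have "continuous_on UNIV (\<lambda>s. hat ((s - a) * c n) * c n - hat ((s - b) * c n + 1) * c n)"
    unfolding hat_def by (intro continuous_intros)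
  then show "\<exists>\<psi>'. C1_test J (plateau a b n) \<psi>'" if "{a..b} \<subseteq> J"
    unfolding plateau_psi C1_test_def using d zero[of _ n] that
    by (intro exI[of _ "\<lambda>s. hat ((s - a) * c n) * c n - hat ((s - b) * c n + 1) * c n"] conjI allI
        exI[of _ "{a..b}"]) auto
  have lim: "filterlim (\<lambda>n. d * c n) at_top sequentially" if "d > 0" for d
  proof -
    have "filterlim (\<lambda>n. (d / (b - a)) * real (Suc n)) at_top sequentially"
      using that ab
      by (intro filterlim_tendsto_pos_mult_at_top[OF tendsto_const]
          filterlim_compose[OF filterlim_real_sequentially filterlim_Suc]) auto
    then show ?thesis by (simp add: c_def)
  qed
  show "(\<lambda>n. plateau a b n s) \<longlonglongrightarrow> indicator {a<..<b} s"
    unfolding plateau_psi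
  proof (cases "a < s \<and> s < b")
    case True
    have "\<forall>\<^sub>F n in sequentially. 1 \<le> (s - a) * c n" "\<forall>\<^sub>F n in sequentially. 1 \<le> (b - s) * c n"
      using lim[of "s - a"] lim[of "b - s"] True by (auto simp: filterlim_at_top)
    then have "\<forall>\<^sub>F n in sequentially. \<psi> n s = 1"
    proof eventually_elim
      case (elim n)
      then have "(s - b) * c n + 1 \<le> 0" by (simp add: algebra_simps)
      then show ?case using elim by (simp add: \<psi>_def)
    qed
    then show "(\<lambda>n. \<psi> n s) \<longlonglongrightarrow> indicator {a<..<b} s"
      using True by (simp add: tendsto_eventually)
  next
    case False
    then have "\<psi> n s = 0" for n using lo[of s n] hi[of s n] by auto
    then show "(\<lambda>n. \<psi> n s) \<longlonglongrightarrow> indicator {a<..<b} s"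
      using False by (auto simp: indicator_def)
  qed
qed

text \<open>Plateaus converge boundedly to the indicator of an open interval, so by dominated
  convergence \<open>g\<close> has zero integral over every interval that is compactly contained in
  \<open>J\<close>. This gives \<open>g = 0\<close> almost everywhere on each compact interval in
  \<open>J\<close>, and countably many of these cover \<open>J\<close>.\<close>

lemma AE_zero_if_orthogonal_to_tests:
  assumes J: "open J" and g: "L1_loc_on J g"
    and orth: "\<And>\<psi> \<psi>'. C1_test J \<psi> \<psi>' \<Longrightarrow> integral\<^sup>L (lebesgue_on J) (\<lambda>x. g x * \<psi> x) = 0"
  shows "AE x in lebesgue_on J. g x = 0"
proof -
  have Jm: "J \<in> sets lebesgue" using J by auto
  have Ioo: "(\<integral>x. indicator {a<..<b} x * (if x \<in> {c..d} then g x else 0) \<partial>lebesgue) = 0"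
    if ab: "a < b" "{a..b} \<subseteq> {c..d}" "{c..d} \<subseteq> J" for a b c d
  proof -
    define F where "F = (\<lambda>x. if x \<in> {c..d} then g x else 0)"
    have F: "integrable lebesgue F"
      using g ab unfolding F_def L1_loc_on_def by (subst Lebesgue_Measure.integrable_restrict_UNIV) auto
    define \<psi> where "\<psi> = plateau a b"
    have "{a..b} \<subseteq> J" using ab by auto
    note plateau = C1_test_plateau[OF ab(1) this, folded \<psi>_def] abs_plateau_le_1[OF ab(1), folded \<psi>_def]
      plateau_outside[OF ab(1), folded \<psi>_def] plateau_tendsto[OF ab(1), folded \<psi>_def]
    have 0: "(\<integral>x. \<psi> n x * F x \<partial>lebesgue) = 0" for n
    proof -
      obtain \<psi>' where t: "C1_test J (\<psi> n) \<psi>'" using plateau(1) by blast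
      have "(\<integral>x. \<psi> n x * F x \<partial>lebesgue) = (\<integral>x. (if x \<in> {c..d} then g x * \<psi> n x else 0) \<partial>lebesgue)"
        by (intro Bochner_Integration.integral_cong) (auto simp: F_def)
      also have "\<dots> = integral\<^sup>L (lebesgue_on {c..d}) (\<lambda>x. g x * \<psi> n x)"
        by (intro Lebesgue_Measure.integral_restrict_UNIV) auto
      also have "\<dots> = integral\<^sup>L (lebesgue_on J) (\<lambda>x. g x * \<psi> n x)"
        using ab plateau(3)[of _ n] Jm
        by (intro integral_lebesgue_on_zero_outside[symmetric]) auto
      finally show ?thesis using orth[OF t] by simp
    qed
    have m: "\<psi> n \<in> borel_measurable lebesgue" for n
      using plateau(1)[of n] C1_test_continuous(1)[of J "\<psi> n" _ UNIV]
      by (auto intro!: measurable_completion borel_measurable_continuous_onI)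
    have "(\<lambda>n. \<integral>x. \<psi> n x * F x \<partial>lebesgue) \<longlonglongrightarrow> (\<integral>x. indicator {a<..<b} x * F x \<partial>lebesgue)"
    proof (rule integral_dominated_convergence[where w = "\<lambda>x. \<bar>F x\<bar>"])
      show "(\<lambda>x. indicator {a<..<b} x * F x) \<in> borel_measurable lebesgue"
        using borel_measurable_integrable[OF F] by (intro borel_measurable_times borel_measurable_indicator) auto
      show "(\<lambda>x. \<psi> n x * F x) \<in> borel_measurable lebesgue" for n
        using borel_measurable_integrable[OF F] m by (intro borel_measurable_times) auto
      show "integrable lebesgue (\<lambda>x. \<bar>F x\<bar>)" using F by auto
      show "AE x in lebesgue. (\<lambda>n. \<psi> n x * F x) \<longlonglongrightarrow> indicator {a<..<b} x * F x"
        using plateau(4) by (intro AE_I2 tendsto_mult tendsto_const)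
      show "AE x in lebesgue. norm (\<psi> n x * F x) \<le> \<bar>F x\<bar>" for n
        using plateau(2)[of n] by (intro AE_I2) (auto simp: abs_mult intro: mult_left_le_one_le)
    qed
    then have "(\<integral>x. indicator {a<..<b} x * F x \<partial>lebesgue) = 0"
      unfolding 0 by (rule LIMSEQ_unique[OF _ tendsto_const])
    then show ?thesis by (simp add: F_def)
  qed
  have box: "AE x in lebesgue. x \<in> {c..d} \<longrightarrow> g x = 0" if cd: "{c..d} \<subseteq> J" for c d
  proof -
    define F where "F = (\<lambda>x. if x \<in> {c..d} then g x else 0)"
    have F: "integrable lebesgue F"
      using g cd unfolding F_def L1_loc_on_def by (subst Lebesgue_Measure.integrable_restrict_UNIV) auto
    \<comment> \<open>Clipping \<open>{a<..<b}\<close> to \<open>{c..d}\<close> may leave a closed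
      endpoint, whereas the clipped interval used below is open; the discrepancy lies in this null
      set.\<close>
    have ae: "AE x in lebesgue. x \<notin> {c, d}"
      by (intro AE_not_in) (auto simp: negligible_finite negligible_iff_null_sets[symmetric])
    have z: "(\<integral>x. indicator {a<..<b} x * F x \<partial>lebesgue) = 0" for a b
    proof -
      have "(\<integral>x. indicator {a<..<b} x * F x \<partial>lebesgue)
          = (\<integral>x. indicator {max a c<..<min b d} x * F x \<partial>lebesgue)"
        using ae borel_measurable_integrable[OF F]
        by (intro integral_cong_AE borel_measurable_times borel_measurable_indicator)
          (auto simp: F_def indicator_def elim: eventually_mono)
      also have "\<dots> = 0"
      proof (cases "max a c < min b d")
        case True
        then show ?thesis using Ioo[OF True, of c d] cd unfolding F_def by auto
      next
        case False
        then have "{max a c<..<min b d} = {}" by auto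
        then show ?thesis by (simp only:) simp
      qed
      finally show ?thesis .
    qed
    \<comment> \<open>The total integral is an interval integral as well: the enlarged open interval
      contains the set where \<open>F\<close> can be nonzero.\<close>
    have "integral\<^sup>L lebesgue F = (\<integral>x. indicator {c-1<..<d+1} x * F x \<partial>lebesgue)"
      by (intro Bochner_Integration.integral_cong) (auto simp: F_def indicator_def)
    then have "AE x in lebesgue. F x = 0"
      using z by (intro AE_lebesgue_eq_zero_if_Ioo F) auto
    then show ?thesis by (auto simp: F_def elim: eventually_mono)
  qed
  obtain \<D> where D: "countable \<D>" "\<D> \<subseteq> Pow J" "\<And>X. X \<in> \<D> \<Longrightarrow> \<exists>a b. X = cbox a b" "\<Union>\<D> = J"
    by (rule open_countable_Union_open_cbox[OF J]) (rule that)
  have "AE x in lebesgue. \<forall>X\<in>\<D>. x \<in> X \<longrightarrow> g x = 0"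
    unfolding AE_ball_countable[OF D(1)]
  proof
    fix X assume "X \<in> \<D>"
    then obtain a b where X: "X = cbox a b" using D(3) by blast
    with \<open>X \<in> \<D>\<close> D(2) have "{a..b} \<subseteq> J" by auto
    then show "AE x in lebesgue. x \<in> X \<longrightarrow> g x = 0" using box X by simp
  qed
  then show ?thesis
    using D(4) Jm by (auto simp: AE_restrict_space_iff elim: eventually_mono)
qed

section \<open>Calculus of weak derivatives\<close>

text \<open>The difference of the two candidates is orthogonal to all test functions. Consequently
  the representative picked by \<open>SOME\<close> may be replaced almost everywhere by any
  derivative computed by hand.\<close>

lemma is_weak_deriv_unique:
  assumes J: "open J" and "is_weak_deriv J f g" "is_weak_deriv J f h"
  shows "AE x in lebesgue_on J. g x = h x"
proof -
  have Jm: "J \<in> sets lebesgue" using J by auto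
  have L: "L1_loc_on J g" "L1_loc_on J h" using assms by (auto simp: is_weak_deriv_def)
  have "AE x in lebesgue_on J. g x - h x = 0"
  proof (rule AE_zero_if_orthogonal_to_tests[OF J L1_loc_on_diff[OF L]])
    fix \<psi> \<psi>' assume t: "C1_test J \<psi> \<psi>'"
    have "integral\<^sup>L (lebesgue_on J) (\<lambda>x. (g x - h x) * \<psi> x)
        = integral\<^sup>L (lebesgue_on J) (\<lambda>x. g x * \<psi> x) - integral\<^sup>L (lebesgue_on J) (\<lambda>x. h x * \<psi> x)"
      unfolding left_diff_distrib
      by (intro Bochner_Integration.integral_diff integrable_L1_loc_times_test(1)[OF Jm _ t] L)
    also have "\<dots> = 0"
    proof -
      have "integral\<^sup>L (lebesgue_on J) (\<lambda>x. f x * \<psi>' x) = - integral\<^sup>L (lebesgue_on J) (\<lambda>x. g x * \<psi> x)"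
        "integral\<^sup>L (lebesgue_on J) (\<lambda>x. f x * \<psi>' x) = - integral\<^sup>L (lebesgue_on J) (\<lambda>x. h x * \<psi> x)"
        using assms(2,3) t unfolding is_weak_deriv_def by blast+
      then show ?thesis by linarith
    qed
    finally show "integral\<^sup>L (lebesgue_on J) (\<lambda>x. (g x - h x) * \<psi> x) = 0" .
  qed
  then show ?thesis by simp
qed

lemma is_weak_deriv_weak_deriv: "is_weak_deriv J f g \<Longrightarrow> is_weak_deriv J f (weak_deriv J f)"
  unfolding weak_deriv_def by (rule someI[of "is_weak_deriv J f"])

lemma AE_weak_deriv_eq:
  assumes "open J" "is_weak_deriv J f g"
  shows "AE x in lebesgue_on J. weak_deriv J f x = g x"
  using is_weak_deriv_unique[OF assms(1) is_weak_deriv_weak_deriv[OF assms(2)] assms(2)] .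

text \<open>Testing \<open>w\<close> with \<open>\<zeta> \<psi>\<close>, which is again a test
  function, gives the Leibniz rule with the classical derivative of \<open>\<zeta>\<close> inside
  the integrals.\<close>

lemma is_weak_deriv_mult:
  assumes J: "open J" and w: "is_weak_deriv J w g"
    and z: "\<And>x. (\<zeta> has_real_derivative \<zeta>' x) (at x)" "continuous_on UNIV \<zeta>'"
  shows "is_weak_deriv J (\<lambda>x. w x * \<zeta> x) (\<lambda>x. g x * \<zeta> x + w x * \<zeta>' x)"
proof -
  have Jm: "J \<in> sets lebesgue" using J by auto
  have L: "L1_loc_on J w" "L1_loc_on J g" using w by (auto simp: is_weak_deriv_def)
  have c: "continuous_on J \<zeta>" "continuous_on J \<zeta>'"
    by (rule DERIV_imp_continuous_on[OF z(1)]) (rule continuous_on_subset[OF z(2) subset_UNIV])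
  have "integral\<^sup>L (lebesgue_on J) (\<lambda>x. w x * \<zeta> x * \<psi>' x)
      = - integral\<^sup>L (lebesgue_on J) (\<lambda>x. (g x * \<zeta> x + w x * \<zeta>' x) * \<psi> x)"
    if t: "C1_test J \<psi> \<psi>'" for \<psi> \<psi>'
  proof -
    note zt = C1_test_mult[OF t z]
    have i: "integrable (lebesgue_on J) (\<lambda>x. w x * \<zeta> x * \<psi>' x)"
      "integrable (lebesgue_on J) (\<lambda>x. w x * \<zeta>' x * \<psi> x)"
      "integrable (lebesgue_on J) (\<lambda>x. g x * \<zeta> x * \<psi> x)"
      using integrable_L1_loc_times_test(2)[OF Jm L1_loc_on_times_continuous[OF L(1) c(1)] t]
        integrable_L1_loc_times_test(1)[OF Jm L1_loc_on_times_continuous[OF L(1) c(2)] t]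
        integrable_L1_loc_times_test(1)[OF Jm L1_loc_on_times_continuous[OF L(2) c(1)] t] .
    have "integral\<^sup>L (lebesgue_on J) (\<lambda>x. w x * (\<zeta> x * \<psi>' x + \<zeta>' x * \<psi> x))
        = - integral\<^sup>L (lebesgue_on J) (\<lambda>x. g x * (\<zeta> x * \<psi> x))"
      using w zt unfolding is_weak_deriv_def by blast
    moreover have "integral\<^sup>L (lebesgue_on J) (\<lambda>x. w x * (\<zeta> x * \<psi>' x + \<zeta>' x * \<psi> x))
        = integral\<^sup>L (lebesgue_on J) (\<lambda>x. w x * \<zeta> x * \<psi>' x) + integral\<^sup>L (lebesgue_on J) (\<lambda>x. w x * \<zeta>' x * \<psi> x)"
      unfolding distrib_left mult.assoc[symmetric] by (rule Bochner_Integration.integral_add[OF i(1,2)])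
    moreover have "integral\<^sup>L (lebesgue_on J) (\<lambda>x. (g x * \<zeta> x + w x * \<zeta>' x) * \<psi> x)
        = integral\<^sup>L (lebesgue_on J) (\<lambda>x. g x * \<zeta> x * \<psi> x) + integral\<^sup>L (lebesgue_on J) (\<lambda>x. w x * \<zeta>' x * \<psi> x)"
      unfolding distrib_right by (rule Bochner_Integration.integral_add[OF i(3,2)])
    ultimately show ?thesis by (simp add: mult.assoc)
  qed
  moreover have "L1_loc_on J (\<lambda>x. w x * \<zeta> x)"
    by (rule L1_loc_on_times_continuous[OF L(1) c(1)])
  moreover have "L1_loc_on J (\<lambda>x. g x * \<zeta> x + w x * \<zeta>' x)"
    by (rule L1_loc_on_add[OF L1_loc_on_times_continuous[OF L(2) c(1)] L1_loc_on_times_continuous[OF L(1) c(2)]])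
  ultimately show ?thesis unfolding is_weak_deriv_def by blast
qed

text \<open>The claim is that \<open>\<psi>'\<close> has zero integral. As \<open>J\<close> need not
  be an interval, the integral moves to the support and from there to an interval
  \<open>{-a..a}\<close> around it, possibly larger than \<open>J\<close>, at whose ends
  \<open>\<psi>\<close> vanishes.\<close>

lemma is_weak_deriv_const:
  assumes J: "open J"
  shows "is_weak_deriv J (\<lambda>x. c) (\<lambda>x. 0)"
proof -
  have Jm: "J \<in> sets lebesgue" using J by auto
  have 0: "integral\<^sup>L (lebesgue_on J) \<psi>' = 0" if t: "C1_test J \<psi> \<psi>'" for \<psi> \<psi>'
  proof -
    obtain K where K: "compact K" "K \<subseteq> J" "\<And>x. x \<notin> K \<Longrightarrow> \<psi> x = 0" "\<And>x. x \<notin> K \<Longrightarrow> \<psi>' x = 0"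
      by (rule C1_testE[OF t]) (rule that)
    obtain r where r: "\<And>x. x \<in> K \<Longrightarrow> \<bar>x\<bar> \<le> r" "r > 0"
      using compact_imp_bounded[OF K(1)] by (auto simp: bounded_pos)
    define a where "a = r + 1"
    have "- a \<notin> K" "a \<notin> K" using r(1)[of "- a"] r(1)[of a] r(2) by (auto simp: a_def)
    then have ends: "\<psi> (- a) = 0" "\<psi> a = 0" using K(3) by auto
    have Ka: "K \<subseteq> {-a..a}" using r(1) by (force simp: a_def abs_le_iff)
    have Km: "K \<in> sets lebesgue" using K(1) by (simp add: compact_imp_closed)
    have "integral\<^sup>L (lebesgue_on J) \<psi>' = integral\<^sup>L (lebesgue_on K) \<psi>'"
      using K Km Jm by (intro integral_lebesgue_on_zero_outside) auto
    also have "\<dots> = integral\<^sup>L (lebesgue_on {-a..a}) \<psi>'"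
      using K Km Ka by (intro integral_lebesgue_on_zero_outside[symmetric]) auto
    also have "\<dots> = integral {-a..a} \<psi>'"
      using C1_test_continuous(2)[OF t, of "{-a..a}"]
      by (intro lebesgue_integral_eq_integral continuous_imp_integrable_real) auto
    also have "\<dots> = \<psi> a - \<psi> (- a)"
      using t r(2) unfolding C1_test_def has_real_derivative_iff_has_vector_derivative
      by (intro integral_unique fundamental_theorem_of_calculus)
        (auto simp: a_def intro: has_vector_derivative_at_within)
    finally show ?thesis using ends by simp
  qed
  show ?thesis
    unfolding is_weak_deriv_def using L1_loc_on_continuous[of J] 0 by simp
qed

lemma AE_lebesgue_on_subset:
  assumes "AE x in lebesgue_on J. P x" "K \<subseteq> J" "K \<in> sets lebesgue" "J \<in> sets lebesgue"
  shows "AE x in lebesgue_on K. P x"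
proof -
  have "AE x in lebesgue. x \<in> J \<longrightarrow> P x" using assms by (simp add: AE_restrict_space_iff)
  then have "AE x in lebesgue. x \<in> K \<longrightarrow> P x" by (rule eventually_mono) (use assms(2) in blast)
  then show ?thesis using assms by (simp add: AE_restrict_space_iff)
qed

section \<open>Lipschitz bounds from bounded second weak derivatives\<close>

text \<open>An approximate Dirac mass at \<open>a\<close>, spread over \<open>[a, a + e]\<close>. It
  is one-sided, so when several of them are combined only the rightmost point needs extra room
  inside \<open>J\<close>.\<close>

definition hat_at :: "real \<Rightarrow> real \<Rightarrow> real \<Rightarrow> real" where
  "hat_at e a s = hat ((s - a) / e) / e"

lemma hat_at_nonneg: "0 < e \<Longrightarrow> 0 \<le> hat_at e a s"
  by (simp add: hat_at_def hat_bounds)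

lemma hat_at_outside:
  assumes "0 < e" "s \<notin> {a..a + e}"
  shows "hat_at e a s = 0"
proof -
  have "(s - a) / e \<le> 0 \<or> 1 \<le> (s - a) / e"
    using assms by (auto simp: divide_le_0_iff pos_le_divide_eq)
  then show ?thesis by (simp add: hat_at_def hat_outside)
qed

lemma continuous_on_hat_at: "0 < e \<Longrightarrow> continuous_on S (hat_at e a)"
  unfolding hat_at_def[abs_def] hat_def[abs_def] by (intro continuous_intros) auto

lemma integral_hat_at:
  assumes "0 < e"
  shows "integral\<^sup>L (lebesgue_on {a..a + e}) (hat_at e a) = 1"
proof -
  have "integral\<^sup>L (lebesgue_on {a..a + e}) (hat_at e a)
      = integral\<^sup>L lebesgue (\<lambda>s. if s \<in> {a..a + e} then hat_at e a s else 0)"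
    by (rule Lebesgue_Measure.integral_restrict_UNIV[symmetric]) auto
  also have "\<dots> = integral\<^sup>L lebesgue (hat_at e a)"
    using hat_at_outside[OF assms] by (intro Bochner_Integration.integral_cong) auto
  also have "\<dots> = integral\<^sup>L lborel (hat_at e a)"
    using continuous_on_hat_at[OF assms] by (intro integral_completion) (simp add: borel_measurable_continuous_onI)
  also have "\<dots> = \<bar>e\<bar> *\<^sub>R integral\<^sup>L lborel (\<lambda>x. hat_at e a (a + e * x))"
    using assms by (intro lborel_integral_real_affine) simp
  also have "\<dots> = 1"
    using assms by (simp add: hat_at_def integral_hat)
  finally show ?thesis .
qed

text \<open>Since \<open>hat_at\<close> is nonnegative with unit mass, the integral is an average of
  \<open>f\<close> over \<open>[a, a + e]\<close> and deviates from \<open>f a\<close> by at most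
  the oscillation there.\<close>

lemma abs_integral_hat_at_diff_le:
  assumes J: "J \<in> sets lebesgue" and e: "0 < e" and sub: "{a..a + e} \<subseteq> J"
    and f: "continuous_on J f" and osc: "\<And>s. s \<in> {a..a + e} \<Longrightarrow> \<bar>f s - f a\<bar> \<le> \<eta>"
  shows "\<bar>integral\<^sup>L (lebesgue_on J) (\<lambda>s. f s * hat_at e a s) - f a\<bar> \<le> \<eta>"
proof -
  let ?K = "{a..a + e}" and ?k = "hat_at e a"
  have k: "integrable (lebesgue_on ?K) ?k"
    using continuous_imp_integrable_real[OF continuous_on_hat_at[OF e]] .
  have fk: "integrable (lebesgue_on ?K) (\<lambda>s. f s * ?k s)"
    by (intro continuous_imp_integrable_real continuous_on_mult continuous_on_hat_at[OF e]
        continuous_on_subset[OF f sub])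
  have "integral\<^sup>L (lebesgue_on J) (\<lambda>s. f s * ?k s) = integral\<^sup>L (lebesgue_on ?K) (\<lambda>s. f s * ?k s)"
    using hat_at_outside[OF e] by (intro integral_lebesgue_on_zero_outside sub J) auto
  moreover have "integral\<^sup>L (lebesgue_on ?K) (\<lambda>s. (f s - f a) * ?k s)
      = integral\<^sup>L (lebesgue_on ?K) (\<lambda>s. f s * ?k s) - integral\<^sup>L (lebesgue_on ?K) (\<lambda>s. f a * ?k s)"
    unfolding left_diff_distrib using k fk by (intro Bochner_Integration.integral_diff) auto
  moreover have "integral\<^sup>L (lebesgue_on ?K) (\<lambda>s. f a * ?k s) = f a"
    using integral_hat_at[OF e] by simp
  moreover have "\<bar>integral\<^sup>L (lebesgue_on ?K) (\<lambda>s. (f s - f a) * ?k s)\<bar> \<le> \<eta>"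
  proof -
    have i: "integrable (lebesgue_on ?K) (\<lambda>s. (f s - f a) * ?k s)"
      unfolding left_diff_distrib using k fk by auto
    have "\<bar>integral\<^sup>L (lebesgue_on ?K) (\<lambda>s. (f s - f a) * ?k s)\<bar>
        \<le> integral\<^sup>L (lebesgue_on ?K) (\<lambda>s. \<bar>(f s - f a) * ?k s\<bar>)"
      by (rule integral_abs_bound)
    also have "\<dots> \<le> integral\<^sup>L (lebesgue_on ?K) (\<lambda>s. \<eta> * ?k s)"
    proof (rule integral_mono)
      show "\<bar>(f s - f a) * ?k s\<bar> \<le> \<eta> * ?k s" if "s \<in> space (lebesgue_on ?K)" for s
        using that osc[of s] hat_at_nonneg[OF e, of a s] by (simp add: abs_mult mult_right_mono)
    qed (use i k in auto)
    also have "\<dots> = \<eta>" using integral_hat_at[OF e] by simp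
    finally show ?thesis .
  qed
  ultimately show ?thesis by linarith
qed

text \<open>The test function is a \<open>C\<^sup>2\<close> trapezoid of height \<open>t\<close>, whose second derivative
  approximates the sum of four Dirac masses with signs.\<close>

lemma second_difference_le_of_weak_deriv_aux:
  assumes J: "open J" "is_interval J" and f: "continuous_on J f"
    and fg: "is_weak_deriv J f g" and gh: "is_weak_deriv J g h"
    and H: "AE x in lebesgue_on J. \<bar>h x\<bar> \<le> H" "0 \<le> H"
    and xy: "x \<le> y" "0 < t" "x \<in> J" "y + t \<in> J"
  shows "\<bar>(f (x + t) - f x) - (f (y + t) - f y)\<bar> \<le> H * t * (y - x + t)"
proof (rule field_le_epsilon)
  fix d :: real assume "0 < d"
  have Jm: "J \<in> sets lebesgue" using J by auto
  \<comment> \<open>Error budget: four smoothed point values cost \<open>\<eta>\<close> each, and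
    widening the support by \<open>e < \<eta>\<close> costs at most \<open>H * t * \<eta>\<close>.
    Together this is exactly \<open>d\<close>.\<close>
  define \<eta> where "\<eta> = d / (4 + H * t)"
  have "0 < 4 + H * t" using H(2) xy(2) by (intro add_pos_nonneg) auto
  then have \<eta>: "0 < \<eta>" "\<eta> * (4 + H * t) = d"
    using \<open>0 < d\<close> by (auto simp: \<eta>_def)
  have sub: "{x..y + t} \<subseteq> J"
  proof
    fix s assume "s \<in> {x..y + t}"
    then show "s \<in> J" using J(2) xy(3,4) unfolding is_interval_1 by (meson atLeastAtMost_iff)
  qed
  have osc: "\<forall>\<^sub>F e in at_right 0. \<forall>s\<in>{a..a + e}. \<bar>f s - f a\<bar> \<le> \<eta>" if "a \<in> J" for a
  proof -
    have "isCont f a" using f J(1) that by (simp add: continuous_on_eq_continuous_at)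
    then obtain r where r: "r > 0" "\<And>s. \<bar>s - a\<bar> < r \<Longrightarrow> \<bar>f s - f a\<bar> < \<eta>"
      using \<eta>(1) unfolding continuous_at_eps_delta by (auto simp: dist_real_def)
    have "\<forall>\<^sub>F e in at_right 0. e < r" using r(1) by (rule order_tendstoD(2)[OF tendsto_ident_at])
    then show ?thesis
    proof eventually_elim
      case (elim e)
      then show ?case using r(2) by (force intro: less_imp_le)
    qed
  qed
  have inJ: "\<forall>\<^sub>F e in at_right 0. y + t + e \<in> J"
  proof -
    have "((\<lambda>e. y + t + e) \<longlongrightarrow> y + t + 0) (at_right 0)" by (intro tendsto_intros)
    then show ?thesis using xy(4) J(1) by (auto simp: tendsto_def)
  qed
  have "\<forall>\<^sub>F e in at_right (0::real). e < \<eta>" "\<forall>\<^sub>F e in at_right (0::real). 0 < e"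
    using \<eta>(1) by (auto intro: order_tendstoD(2)[OF tendsto_ident_at] eventually_at_right_less)
  moreover have "x + t \<in> J" "y \<in> J" using sub xy by auto
  ultimately have "\<forall>\<^sub>F e in at_right 0. 0 < e \<and> e < \<eta> \<and> y + t + e \<in> J \<and>
      (\<forall>a\<in>{x, x + t, y, y + t}. \<forall>s\<in>{a..a + e}. \<bar>f s - f a\<bar> \<le> \<eta>)"
    using osc[OF xy(3)] osc[of "x + t"] osc[of y] osc[OF xy(4)] inJ
    by (simp add: eventually_conj_iff)
  then have "\<exists>e. 0 < e \<and> e < \<eta> \<and> y + t + e \<in> J \<and>
      (\<forall>a\<in>{x, x + t, y, y + t}. \<forall>s\<in>{a..a + e}. \<bar>f s - f a\<bar> \<le> \<eta>)"
    by (rule eventually_happens'[rotated]) simp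
  then obtain e where e: "0 < e" "e < \<eta>" "y + t + e \<in> J"
    "\<And>a s. a \<in> {x, x + t, y, y + t} \<Longrightarrow> s \<in> {a..a + e} \<Longrightarrow> \<bar>f s - f a\<bar> \<le> \<eta>"
    by blast
  let ?K = "{x..y + t + e}"
  have K: "?K \<subseteq> J"
  proof
    fix s assume "s \<in> ?K"
    then show "s \<in> J" using J(2) xy(3) e(3) unfolding is_interval_1 by (meson atLeastAtMost_iff)
  qed
  define R where "R = (\<lambda>a s. e * ramp2 ((s - a) / e))"
  define S where "S = (\<lambda>a s. step1 ((s - a) / e))"
  have dR: "(R a has_real_derivative S a s) (at s)" for a s
  proof -
    have "((\<lambda>s. ramp2 ((s - a) / e)) has_real_derivative step1 ((s - a) / e) * (1 / e)) (at s)"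
      by (rule DERIV_chain2[OF DERIV_ramp2]) (use e(1) in \<open>auto intro!: derivative_eq_intros\<close>)
    from DERIV_cmult[OF this, of e] show ?thesis using e(1) by (simp add: R_def S_def)
  qed
  have dS: "(S a has_real_derivative hat_at e a s) (at s)" for a s
  proof -
    have "((\<lambda>s. step1 ((s - a) / e)) has_real_derivative hat ((s - a) / e) * (1 / e)) (at s)"
      by (rule DERIV_chain2[OF DERIV_step1]) (use e(1) in \<open>auto intro!: derivative_eq_intros\<close>)
    then show ?thesis by (simp add: S_def hat_at_def)
  qed
  define \<psi> where "\<psi> = (\<lambda>s. (R x s - R (x + t) s) - (R y s - R (y + t) s))"
  define \<psi>' where "\<psi>' = (\<lambda>s. (S x s - S (x + t) s) - (S y s - S (y + t) s))"
  define \<psi>'' where "\<psi>'' = (\<lambda>s. (hat_at e x s - hat_at e (x + t) s) - (hat_at e y s - hat_at e (y + t) s))"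
  have zero: "\<psi> s = 0 \<and> \<psi>' s = 0" if "s \<notin> ?K" for s
  proof (cases "s < x")
    case True
    then have "(s - a) / e \<le> 0" if "a \<in> {x, x + t, y, y + t}" for a
      using that e(1) xy by (auto simp: divide_le_0_iff)
    then show ?thesis by (simp add: \<psi>_def \<psi>'_def R_def S_def)
  next
    case False
    then have far: "1 \<le> (s - a) / e" if "a \<in> {x, x + t, y, y + t}" for a
      using that \<open>s \<notin> ?K\<close> e(1) xy by (auto simp: pos_le_divide_eq)
    \<comment> \<open>To the right of all four corners each ramp is affine with slope 1, and the
      shifts cancel: \<open>(- x + (x + t)) - (- y + (y + t)) = 0\<close>.\<close>
    have "S a s = 1 \<and> R a s = s - a - e / 2" if "a \<in> {x, x + t, y, y + t}" for a
      using far[OF that] e(1) by (simp add: R_def S_def ramp2_ge_1 field_simps)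
    then show ?thesis by (simp add: \<psi>_def \<psi>'_def)
  qed
  have cont: "continuous_on UNIV \<psi>'" "continuous_on UNIV \<psi>''"
    unfolding \<psi>'_def \<psi>''_def
    by (intro continuous_intros DERIV_imp_continuous_on[OF dS] continuous_on_hat_at[OF e(1)])+
  have t1: "C1_test J \<psi> \<psi>'"
    unfolding C1_test_def
  proof (intro conjI allI)
    show "(\<psi> has_real_derivative \<psi>' s) (at s)" for s
      unfolding \<psi>_def \<psi>'_def by (intro DERIV_diff dR)
    show "\<exists>K. compact K \<and> K \<subseteq> J \<and> (\<forall>s. s \<notin> K \<longrightarrow> \<psi> s = 0)"
      using K zero by (intro exI[of _ ?K]) auto
  qed (rule cont)
  have t2: "C1_test J \<psi>' \<psi>''"
    unfolding C1_test_def
  proof (intro conjI allI)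
    show "(\<psi>' has_real_derivative \<psi>'' s) (at s)" for s
      unfolding \<psi>''_def \<psi>'_def by (intro DERIV_diff dS)
    show "\<exists>K. compact K \<and> K \<subseteq> J \<and> (\<forall>s. s \<notin> K \<longrightarrow> \<psi>' s = 0)"
      using K zero by (intro exI[of _ ?K]) auto
  qed (rule cont)
  \<comment> \<open>The rising and the falling half both take values in \<open>[0, t]\<close>, so
    their difference is at most \<open>t\<close> in absolute value even if the two ramps
    overlap.\<close>
  have tr: "0 \<le> R a s - R (a + t) s \<and> R a s - R (a + t) s \<le> t" for a s
  proof -
    have le: "(s - (a + t)) / e \<le> (s - a) / e" using xy(2) e(1) by (simp add: divide_right_mono)
    have "e * (ramp2 ((s - a) / e) - ramp2 ((s - (a + t)) / e)) \<le> e * ((s - a) / e - (s - (a + t)) / e)"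
      using ramp2_mono_lipschitz(2)[OF le] e(1) by (intro mult_left_mono) auto
    also have "\<dots> = t" using e(1) by (simp add: field_simps)
    finally show ?thesis
      using mult_left_mono[OF ramp2_mono_lipschitz(1)[OF le], of e] e(1) by (simp add: R_def algebra_simps)
  qed
  have b\<psi>: "\<bar>\<psi> s\<bar> \<le> t" for s using tr[of x s] tr[of y s] by (simp add: \<psi>_def abs_le_iff)
  have L: "L1_loc_on J g" "L1_loc_on J h" "L1_loc_on J f"
    using fg gh by (auto simp: is_weak_deriv_def)
  define A where "A = (\<lambda>a. integral\<^sup>L (lebesgue_on J) (\<lambda>s. f s * hat_at e a s))"
  have near: "\<bar>A a - f a\<bar> \<le> \<eta>" if "a \<in> {x, x + t, y, y + t}" for a
  proof -
    have "{a..a + e} \<subseteq> J" using that K xy by auto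
    then show ?thesis unfolding A_def using e that
      by (intro abs_integral_hat_at_diff_le Jm f) auto
  qed
  have int: "integrable (lebesgue_on J) (\<lambda>s. f s * hat_at e a s)" if "a \<in> {x, x + t, y, y + t}" for a
  proof -
    have "{a..a + e} \<subseteq> J" using that K xy by auto
    then show ?thesis
      using hat_at_outside[OF e(1)]
      by (intro integrable_L1_loc_times_compact_support[OF Jm L(3) compact_Icc] continuous_on_hat_at[OF e(1)]) auto
  qed
  \<comment> \<open>Two integrations by parts, with \<open>\<psi>'\<close> as the test function for
    \<open>f\<close> and \<open>\<psi>\<close> as the one for \<open>g\<close>; the two signs
    cancel.\<close>
  have "(A x - A (x + t)) - (A y - A (y + t)) = integral\<^sup>L (lebesgue_on J) (\<lambda>s. f s * \<psi>'' s)"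
    unfolding A_def \<psi>''_def right_diff_distrib using int by simp
  also have "\<dots> = - integral\<^sup>L (lebesgue_on J) (\<lambda>s. g s * \<psi>' s)"
    using fg t2 unfolding is_weak_deriv_def by blast
  also have "\<dots> = integral\<^sup>L (lebesgue_on J) (\<lambda>s. h s * \<psi> s)"
  proof -
    have "integral\<^sup>L (lebesgue_on J) (\<lambda>s. g s * \<psi>' s) = - integral\<^sup>L (lebesgue_on J) (\<lambda>s. h s * \<psi> s)"
      using gh t1 unfolding is_weak_deriv_def by blast
    then show ?thesis by simp
  qed
  finally have eq: "(A x - A (x + t)) - (A y - A (y + t)) = integral\<^sup>L (lebesgue_on J) (\<lambda>s. h s * \<psi> s)" .
  have "\<bar>integral\<^sup>L (lebesgue_on J) (\<lambda>s. h s * \<psi> s)\<bar> \<le> integral\<^sup>L (lebesgue_on J) (\<lambda>s. \<bar>h s * \<psi> s\<bar>)"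
    by (rule integral_abs_bound)
  also have "\<dots> = integral\<^sup>L (lebesgue_on ?K) (\<lambda>s. \<bar>h s * \<psi> s\<bar>)"
    using zero by (intro integral_lebesgue_on_zero_outside Jm K) auto
  also have "\<dots> \<le> integral\<^sup>L (lebesgue_on ?K) (\<lambda>s. H * t)"
  proof (rule integral_mono_AE)
    have "integrable (lebesgue_on J) (\<lambda>s. \<bar>h s * \<psi> s\<bar>)"
      using integrable_L1_loc_times_test(1)[OF Jm L(2) t1] by (rule integrable_abs)
    then show "integrable (lebesgue_on ?K) (\<lambda>s. \<bar>h s * \<psi> s\<bar>)"
      using zero by (subst (asm) integrable_lebesgue_on_zero_outside[OF K _ Jm]) auto
    show "integrable (lebesgue_on ?K) (\<lambda>s. H * t)"
      by (rule continuous_imp_integrable_real) simp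
    have "AE s in lebesgue_on ?K. \<bar>h s\<bar> \<le> H"
      by (rule AE_lebesgue_on_subset[OF H(1) K _ Jm]) simp
    then show "AE s in lebesgue_on ?K. \<bar>h s * \<psi> s\<bar> \<le> H * t"
    proof eventually_elim
      case (elim s)
      then show ?case using b\<psi>[of s] H(2) unfolding abs_mult by (intro mult_mono) auto
    qed
  qed
  also have "\<dots> = H * t * (y + t + e - x)"
    using xy e(1) by (simp add: measure_restrict_space)
  also have "\<dots> \<le> H * t * (y - x + t + \<eta>)"
    using e(2) H(2) xy(2) by (intro mult_left_mono) auto
  finally have "\<bar>(A x - A (x + t)) - (A y - A (y + t))\<bar> \<le> H * t * (y - x + t + \<eta>)"
    unfolding eq .
  moreover have "H * t * (y - x + t + \<eta>) + 4 * \<eta> = H * t * (y - x + t) + d"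
    using \<eta>(2) by (simp add: algebra_simps)
  ultimately show "\<bar>(f (x + t) - f x) - (f (y + t) - f y)\<bar> \<le> H * t * (y - x + t) + d"
    using near[of x] near[of y] near[of "x + t"] near[of "y + t"] by simp
qed

lemma second_difference_le_of_weak_deriv:
  assumes "open J" "is_interval J" "continuous_on J f"
    and "is_weak_deriv J f g" "is_weak_deriv J g h"
    and "AE x in lebesgue_on J. \<bar>h x\<bar> \<le> H" "0 \<le> H"
    and "0 < t" "x \<in> J" "x + t \<in> J" "y \<in> J" "y + t \<in> J"
  shows "\<bar>(f (x + t) - f x) - (f (y + t) - f y)\<bar> \<le> H * t * (\<bar>x - y\<bar> + t)"
proof (cases "x \<le> y")
  case True
  then show ?thesis
    using second_difference_le_of_weak_deriv_aux[OF assms(1-7) True assms(8,9,12)] by simp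
next
  case False
  then show ?thesis
    using second_difference_le_of_weak_deriv_aux[OF assms(1-7) _ assms(8,11,10)] by simp
qed

text \<open>Every increment of \<open>f\<close> over a step \<open>t\<close> is close to the increments over the \<open>n\<close> consecutive
  steps that start at \<open>c\<close>, and these telescope to a quantity bounded by \<open>2 * B\<close>.\<close>

lemma lipschitz_on_of_bounded_second_weak_deriv:
  assumes J: "open J" "is_interval J" and f: "continuous_on J f"
    and w: "is_weak_deriv J f g" "is_weak_deriv J g h"
    and H: "AE x in lebesgue_on J. \<bar>h x\<bar> \<le> H" "0 \<le> H"
    and B: "\<And>x. x \<in> J \<Longrightarrow> \<bar>f x\<bar> \<le> B" "0 \<le> B"
    and r: "0 < r" "\<And>x. x \<in> J \<Longrightarrow> \<exists>c. c \<in> J \<and> c + r \<in> J \<and> \<bar>x - c\<bar> \<le> r"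
  shows "(4 * B / r + 3 * H * r)-lipschitz_on J f"
proof -
  have inc: "\<bar>f (x + t) - f x\<bar> \<le> (4 * B / r + 3 * H * r) * t"
    if x: "x \<in> J" "x + t \<in> J" and t: "0 < t" for x t
  proof (cases "t \<le> r")
    case False
    have "\<bar>f (x + t) - f x\<bar> \<le> 2 * B" using B(1)[OF x(1)] B(1)[OF x(2)] by linarith
    also have "\<dots> \<le> 2 * B / r * t"
      using False B(2) r(1) mult_left_mono[of r t "2 * B"] by (simp add: field_simps)
    also have "\<dots> \<le> (4 * B / r + 3 * H * r) * t"
      using B(2) H(2) r(1) t by (intro mult_right_mono) (auto simp: divide_right_mono intro!: add_increasing2)
    finally show ?thesis .
  next
    case True
    \<comment> \<open>An interval of length \<open>r\<close> that starts at \<open>x\<close> could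
      leave \<open>J\<close>; the one at \<open>c\<close> fits and is still within \<open>r\<close>
      of \<open>x\<close>.\<close>
    obtain c where c: "c \<in> J" "c + r \<in> J" "\<bar>x - c\<bar> \<le> r" using r(2)[OF x(1)] by blast
    define n where "n = nat \<lfloor>r / t\<rfloor>"
    have "1 \<le> r / t" using True t by (simp add: pos_le_divide_eq)
    then have n1: "1 \<le> n" by (simp add: n_def le_nat_iff)
    have "real n \<le> r / t" "r / t < real n + 1"
      using \<open>1 \<le> r / t\<close> by (auto simp: n_def)
    then have n: "real n * t \<le> r" "r < (real n + 1) * t"
      using t by (auto simp: field_simps)
    \<comment> \<open>The \<open>n\<close> steps cover at least half of the length \<open>r\<close>.
      This turns the bound \<open>2 * B / n\<close> of the telescoped sum into
      \<open>4 * B / r * t\<close>.\<close>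
    have n2: "r \<le> 2 * (real n * t)"
    proof -
      have "(real n + 1) * t \<le> (2 * real n) * t" using n1 t by (intro mult_right_mono) auto
      then show ?thesis using n(2) by linarith
    qed
    define y where "y = (\<lambda>k. c + real k * t)"
    have y: "y k \<in> J" if "k \<le> n" for k
    proof -
      have "real k * t \<le> real n * t" "0 \<le> real k * t" using that t by (auto intro: mult_right_mono)
      then have "c \<le> y k" "y k \<le> c + r" using n(1) unfolding y_def by linarith+
      then show ?thesis using J(2) c unfolding is_interval_1 by blast
    qed
    have ys: "y (Suc k) = y k + t" for k by (simp add: y_def algebra_simps)
    \<comment> \<open>The factor 3 collects \<open>|x - c| \<le> r\<close>,
      \<open>|c - y k| \<le> r\<close> and \<open>t \<le> r\<close>. It becomes the curvature part
      \<open>3 * H * r\<close> of the Lipschitz constant.\<close>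
    have step: "\<bar>(f (x + t) - f x) - (f (y (Suc k)) - f (y k))\<bar> \<le> H * t * (3 * r)" if "k < n" for k
    proof -
      have "y k \<in> J" "y k + t \<in> J" using y[of k] y[of "Suc k"] that by (auto simp: ys)
      then have "\<bar>(f (x + t) - f x) - (f (y k + t) - f (y k))\<bar> \<le> H * t * (\<bar>x - y k\<bar> + t)"
        by (intro second_difference_le_of_weak_deriv[OF J f w H t x])
      also have "\<dots> \<le> H * t * (3 * r)"
      proof (intro mult_left_mono)
        have "real k * t \<le> real n * t" "0 \<le> real k * t" using that t by (auto intro: mult_right_mono)
        then have "\<bar>c - y k\<bar> \<le> r" using n(1) unfolding y_def by linarith
        then show "\<bar>x - y k\<bar> + t \<le> 3 * r" using c(3) True by linarith
      qed (use H(2) t in auto)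
      finally show ?thesis by (simp add: ys)
    qed
    have "(\<Sum>k<n. (f (x + t) - f x) - (f (y (Suc k)) - f (y k)))
        = real n * (f (x + t) - f x) - (f (y n) - f (y 0))"
      using sum_lessThan_telescope[of "\<lambda>k. f (y k)" n] by (simp add: sum_subtractf)
    moreover have "\<bar>\<Sum>k<n. (f (x + t) - f x) - (f (y (Suc k)) - f (y k))\<bar> \<le> real n * (H * t * (3 * r))"
    proof (rule order_trans[OF sum_abs])
      show "(\<Sum>k<n. \<bar>(f (x + t) - f x) - (f (y (Suc k)) - f (y k))\<bar>) \<le> real n * (H * t * (3 * r))"
        using sum_mono[of "{..<n}" "\<lambda>k. \<bar>(f (x + t) - f x) - (f (y (Suc k)) - f (y k))\<bar>" "\<lambda>_. H * t * (3 * r)"]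
          step by simp
    qed
    moreover have "\<bar>f (y n) - f (y 0)\<bar> \<le> 2 * B"
      using B(1)[OF y[of n]] B(1)[OF y[of 0]] by (simp add: abs_le_iff)
    ultimately have "\<bar>real n * (f (x + t) - f x)\<bar> \<le> real n * (H * t * (3 * r)) + 2 * B" by linarith
    also have "2 * B \<le> real n * (4 * B / r * t)"
    proof -
      have "2 * B / r * r \<le> 2 * B / r * (2 * (real n * t))"
        using n2 B(2) r(1) by (intro mult_left_mono) auto
      then show ?thesis using r(1) by (simp add: field_simps)
    qed
    finally have "real n * \<bar>f (x + t) - f x\<bar> \<le> real n * ((4 * B / r + 3 * H * r) * t)"
      unfolding abs_mult by (simp add: algebra_simps)
    then show ?thesis using n1 by simp
  qed
  show ?thesis
  proof (rule lipschitz_onI)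
    fix x y assume xy: "x \<in> J" "y \<in> J"
    consider "x < y" | "x = y" | "y < x" by linarith
    then show "dist (f x) (f y) \<le> (4 * B / r + 3 * H * r) * dist x y"
    proof cases
      case 1
      then show ?thesis using inc[of x "y - x"] xy by (simp add: dist_real_def abs_minus_commute)
    next
      case 3
      then show ?thesis using inc[of y "x - y"] xy by (simp add: dist_real_def)
    qed simp
  qed (use B(2) H(2) r(1) in auto)
qed

section \<open>Test functions supported on one edge\<close>

lemma edge_int_subset_edge_dom: "edge_int G e \<subseteq> edge_dom G e"
  by (auto simp: edge_int_def edge_dom_def)

lemma pt_edge_int: "x \<in> edge_int G e \<Longrightarrow> pt G e x = Interior e x"
  by (auto simp: edge_int_def pt_def)

lemma edge_int_infinite: "len G e = \<infinity> \<Longrightarrow> edge_int G e = {0<..}"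
  and edge_dom_infinite: "len G e = \<infinity> \<Longrightarrow> edge_dom G e = {0..}"
  and edge_int_finite: "len G e = ereal l \<Longrightarrow> edge_int G e = {0<..<l}"
  and edge_dom_finite: "len G e = ereal l \<Longrightarrow> edge_dom G e = {0..l}"
  by (auto simp: edge_int_def edge_dom_def)

lemma edge_length_cases:
  assumes "metric_graph G" "e \<in> edges G"
  obtains "len G e = \<infinity>" | l where "len G e = ereal l" "0 < l"
  using assms by (cases "len G e") (auto simp: metric_graph_def)

lemma
  assumes "metric_graph G" "e \<in> edges G"
  shows open_edge_int: "open (edge_int G e)"
    and is_interval_edge_int: "is_interval (edge_int G e)"
    and closure_edge_int: "closure (edge_int G e) = edge_dom G e"
  using assms by (auto elim!: edge_length_cases simp: edge_int_infinite edge_dom_infinite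
      edge_int_finite edge_dom_finite is_interval_oo is_interval_io)

lemma edge_int_sets_lebesgue: "metric_graph G \<Longrightarrow> e \<in> edges G \<Longrightarrow> edge_int G e \<in> sets lebesgue"
  using open_edge_int by fastforce

lemma points_cases:
  assumes G: "metric_graph G" and "P \<in> points G"
  obtains v where "v \<in> verts G" "P = Vertex v"
  | e x where "e \<in> edges G" "x \<in> edge_int G e" "P = Interior e x" "P = pt G e x"
  using assms pt_edge_int unfolding points_def by fastforce

lemma gdist_pt_le:
  assumes G: "class_G G" and e: "e \<in> edges G" "x \<in> edge_dom G e" "y \<in> edge_dom G e"
  shows "gdist G (pt G e x) (pt G e y) \<le> \<bar>x - y\<bar>"
proof -
  have mg: "metric_graph G" using G by (simp add: class_G_def)
  have P: "pt G e x \<in> points G" "pt G e y \<in> points G" using pt_in_points[OF mg] e by auto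
  have "path_len G (pt G e x) (pt G e y) (0 + \<bar>x - y\<bar>)"
    using P e by (intro path_len.intros)
  then show ?thesis
    using P path_len_nonneg by (auto simp: gdist_def intro!: cInf_lower bdd_belowI[of _ 0])
qed

text \<open>Increments along the segments of a path add up, so edgewise bounds with a common
  constant survive for the path distance. After division by the constant the edgewise hypothesis is
  that of \<open>path_len_lipschitz\<close>; the infimum over all paths finishes.\<close>

lemma Lipschitz_continuous_map_graph:
  fixes u :: "('v, 'e) gpoint \<Rightarrow> real"
  assumes G: "class_G G"
    and u: "\<And>e x y. \<lbrakk>e \<in> edges G; x \<in> edge_dom G e; y \<in> edge_dom G e\<rbrakk>
      \<Longrightarrow> \<bar>u (pt G e x) - u (pt G e y)\<bar> \<le> B * \<bar>x - y\<bar>"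
  shows "Lipschitz_continuous_map (gmetric G) euclidean_metric u"
proof -
  \<comment> \<open>Nothing is assumed about the sign of \<open>B\<close>, and a strictly positive
    constant is needed to divide by.\<close>
  define K where "K = \<bar>B\<bar> + 1"
  have K: "0 < K" "B \<le> K" by (auto simp: K_def)
  have path: "\<bar>u P - u Q\<bar> \<le> K * L" if "path_len G P Q L" for P Q L
  proof -
    have "\<bar>u P / K - u Q / K\<bar> \<le> L"
    proof (rule path_len_lipschitz[OF that])
      fix e x y assume exy: "e \<in> edges G" "x \<in> edge_dom G e" "y \<in> edge_dom G e"
      have "\<bar>u (pt G e x) - u (pt G e y)\<bar> \<le> K * \<bar>x - y\<bar>"
        using u[OF exy] mult_right_mono[OF K(2), of "\<bar>x - y\<bar>"] by linarith
      then show "\<bar>u (pt G e x) / K - u (pt G e y) / K\<bar> \<le> \<bar>x - y\<bar>"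
        using K(1) by (simp add: diff_divide_distrib[symmetric] abs_divide pos_divide_le_eq mult.commute)
    qed
    then show ?thesis
      using K(1) by (simp add: diff_divide_distrib[symmetric] abs_divide pos_divide_le_eq mult.commute)
  qed
  have "\<bar>u P - u Q\<bar> \<le> K * gdist G P Q" if PQ: "P \<in> points G" "Q \<in> points G" for P Q
  proof -
    have "{L. path_len G P Q L} \<noteq> {}"
      using G PQ by (auto simp: class_G_def connected_graph_def)
    moreover have "\<bar>u P - u Q\<bar> / K \<le> L" if "L \<in> {L. path_len G P Q L}" for L
      using path[of P Q L] that K(1) by (simp add: pos_divide_le_eq mult.commute)
    ultimately have "\<bar>u P - u Q\<bar> / K \<le> Inf {L. path_len G P Q L}" by (rule cInf_greatest)
    then show ?thesis using PQ K(1) by (simp add: gdist_def pos_divide_le_eq mult.commute)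
  qed
  then show ?thesis
    unfolding Lipschitz_continuous_map_def
    using mspace_gmetric[OF G] mdist_gmetric[OF G] by (auto simp: dist_real_def)
qed

lemma continuous_map_pt:
  assumes G: "class_G G" and e: "e \<in> edges G"
  shows "continuous_map (top_of_set (edge_dom G e)) (gtop G) (pt G e)"
proof -
  have mg: "metric_graph G" using G by (simp add: class_G_def)
  have "Lipschitz_continuous_map (submetric euclidean_metric (edge_dom G e)) (gmetric G) (pt G e)"
    unfolding Lipschitz_continuous_map_def
    using gdist_pt_le[OF G e] pt_in_points[OF mg e] mspace_gmetric[OF G] mdist_gmetric[OF G]
    by (auto simp: dist_real_def intro!: exI[of _ 1])
  from Lipschitz_continuous_imp_continuous_map[OF this]
  show ?thesis by (simp add: mtopology_of_submetric)
qed

lemma continuous_on_restr: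
  assumes "class_G G" "e \<in> edges G" "gcontinuous G u"
  shows "continuous_on (edge_dom G e) (restr G u e)"
  using continuous_map_compose[OF continuous_map_pt[OF assms(1,2)], of euclideanreal u] assms(3)
  unfolding gcontinuous_def by (simp add: comp_def restr_def[abs_def])

lemma topspace_gtop: "class_G G \<Longrightarrow> topspace (gtop G) = points G"
  by (simp add: mspace_gmetric)

lemma Hausdorff_space_gtop: "Hausdorff_space (gtop G)"
  unfolding mtopology_of_def by (intro Metric_space.Hausdorff_space_mtopology) simp

text \<open>The edge coordinate is continuous, so compactness passes to the image, and in the
  Hausdorff space \<open>gtop G\<close> compact sets are closed. The closedness is what locates
  supports.\<close>

lemma
  assumes G: "class_G G" and e: "e \<in> edges G"
    and K: "compact K" "K \<subseteq> edge_dom G e"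
  shows compactin_pt_image: "compactin (gtop G) (pt G e ` K)"
    and closedin_pt_image: "closedin (gtop G) (pt G e ` K)"
proof -
  show "compactin (gtop G) (pt G e ` K)"
    using continuous_map_pt[OF G e] K
    by (intro image_compactin[of "top_of_set (edge_dom G e)"]) (simp_all add: compactin_subtopology)
  then show "closedin (gtop G) (pt G e ` K)"
    by (rule compactin_imp_closedin[OF Hausdorff_space_gtop])
qed

section \<open>Extension by zero from one edge\<close>

text \<open>Extension of \<open>\<zeta>\<close> by zero to the whole graph. The value 0 at the
  vertices matches \<open>\<zeta>\<close> when its support is compact in the open edge; see
  \<open>bump_pt\<close>.\<close>

definition bump :: "'e \<Rightarrow> (real \<Rightarrow> real) \<Rightarrow> ('v, 'e) gpoint \<Rightarrow> real" where
  "bump e \<zeta> P = (case P of Vertex v \<Rightarrow> 0 | Interior e' x \<Rightarrow> if e' = e then \<zeta> x else 0)"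

lemma bump_pt:
  assumes "C1_test (edge_int G e) \<zeta> \<zeta>'"
  shows "bump e \<zeta> (pt G e' x) = (if e' = e then \<zeta> x else 0)"
proof -
  obtain K where K: "compact K" "K \<subseteq> edge_int G e" "\<And>x. x \<notin> K \<Longrightarrow> \<zeta> x = 0" "\<And>x. x \<notin> K \<Longrightarrow> \<zeta>' x = 0"
    by (rule C1_testE[OF assms]) (rule that)
  from K(2,3) have "\<zeta> x = 0" if "x = 0 \<or> ereal x = len G e" for x
    using that by (force simp: edge_int_def)
  then show ?thesis by (auto simp: bump_def pt_def)
qed

lemma C1_test_lipschitz:
  assumes "C1_test J \<zeta> \<zeta>'"
  obtains B where "\<And>x y. \<bar>\<zeta> x - \<zeta> y\<bar> \<le> B * \<bar>x - y\<bar>"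
proof -
  obtain K where K: "compact K" "K \<subseteq> J" "\<And>x. x \<notin> K \<Longrightarrow> \<zeta> x = 0" "\<And>x. x \<notin> K \<Longrightarrow> \<zeta>' x = 0"
    by (rule C1_testE[OF assms]) (rule that)
  have "bounded (\<zeta>' ` K)"
    by (intro compact_imp_bounded compact_continuous_image C1_test_continuous(2)[OF assms] K(1))
  then obtain B where B: "\<And>x. x \<in> K \<Longrightarrow> \<bar>\<zeta>' x\<bar> \<le> B" "B > 0" by (auto simp: bounded_pos)
  then have B': "\<bar>\<zeta>' x\<bar> \<le> B" for x using K(4)[of x] by (cases "x \<in> K") auto
  have d: "(\<zeta> has_real_derivative \<zeta>' x) (at x)" for x using assms unfolding C1_test_def by blast
  have "norm (\<zeta> x - \<zeta> y) \<le> B * norm (x - y)" for x y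
    by (rule field_differentiable_bound[of UNIV \<zeta> \<zeta>']) (auto intro: d B')
  then have "\<bar>\<zeta> x - \<zeta> y\<bar> \<le> B * \<bar>x - y\<bar>" for x y by simp
  then show ?thesis by (rule that)
qed

lemma gcontinuous_bump:
  assumes G: "class_G G" and e: "e \<in> edges G" and t: "C1_test (edge_int G e) \<zeta> \<zeta>'"
  shows "gcontinuous G (bump e \<zeta>)"
proof -
  obtain B where B: "\<And>x y. \<bar>\<zeta> x - \<zeta> y\<bar> \<le> B * \<bar>x - y\<bar>" by (rule C1_test_lipschitz[OF t]) (rule that)
  have "Lipschitz_continuous_map (gmetric G) euclidean_metric (bump e \<zeta>)"
  proof (rule Lipschitz_continuous_map_graph[OF G, of _ "\<bar>B\<bar>"])
    fix e' x y
    have "B * \<bar>x - y\<bar> \<le> \<bar>B\<bar> * \<bar>x - y\<bar>" by (intro mult_right_mono) auto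
    then show "\<bar>bump e \<zeta> (pt G e' x) - bump e \<zeta> (pt G e' y)\<bar> \<le> \<bar>B\<bar> * \<bar>x - y\<bar>"
      using B[of x y] by (auto simp: bump_pt[OF t])
  qed
  from Lipschitz_continuous_imp_continuous_map[OF this] show ?thesis
    by (simp add: gcontinuous_def)
qed

text \<open>The points where the product is nonzero lie in the image of \<open>K\<close>, which is
  already closed, so taking the closure adds nothing outside it. The factor \<open>w\<close> is kept
  general to allow both a constant and \<open>u\<close> itself.\<close>

lemma
  assumes G: "class_G G" and e: "e \<in> edges G" and t: "C1_test (edge_int G e) \<zeta> \<zeta>'"
    and w: "gcontinuous G w" and K: "compact K" "K \<subseteq> edge_int G e" "\<And>x. x \<notin> K \<Longrightarrow> \<zeta> x = 0"
  shows gsupp_mult_bump: "gsupp G (\<lambda>P. w P * bump e \<zeta> P) \<subseteq> pt G e ` K"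
    and mult_bump_in_gC_c: "(\<lambda>P. w P * bump e \<zeta> P) \<in> gC_c G"
proof -
  have mg: "metric_graph G" using G by (simp add: class_G_def)
  have Kd: "K \<subseteq> edge_dom G e" by (rule order_trans[OF K(2) edge_int_subset_edge_dom])
  have "{P \<in> points G. w P * bump e \<zeta> P \<noteq> 0} \<subseteq> pt G e ` K"
  proof
    fix P assume P: "P \<in> {P \<in> points G. w P * bump e \<zeta> P \<noteq> 0}"
    then obtain e' x where x: "P = Interior e' x" "x \<in> edge_int G e'"
      by (auto simp: bump_def elim!: points_cases[OF mg] split: if_splits)
    then have "e' = e" "\<zeta> x \<noteq> 0" using P by (auto simp: bump_def split: if_splits)
    then show "P \<in> pt G e ` K" using x K(3) pt_edge_int by (metis image_eqI)
  qed
  then show s: "gsupp G (\<lambda>P. w P * bump e \<zeta> P) \<subseteq> pt G e ` K"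
    unfolding gsupp_def by (rule closure_of_minimal[OF _ closedin_pt_image[OF G e K(1) Kd]])
  have "compactin (gtop G) (gsupp G (\<lambda>P. w P * bump e \<zeta> P))"
    by (rule closed_compactin[OF compactin_pt_image[OF G e K(1) Kd] s]) (simp add: gsupp_def)
  moreover have "gcontinuous G (\<lambda>P. w P * bump e \<zeta> P)"
    using w gcontinuous_bump[OF G e t] unfolding gcontinuous_def by (rule continuous_map_real_mult)
  ultimately show "(\<lambda>P. w P * bump e \<zeta> P) \<in> gC_c G" by (simp add: gC_c_def)
qed

text \<open>Local integrability gives measurability on compact sets; countably many compact
  intervals exhaust the open set \<open>J\<close>, and the pieces are glued.\<close>

lemma L1_loc_on_imp_measurable:
  assumes J: "open J" and f: "L1_loc_on J f"
  shows "f \<in> borel_measurable (lebesgue_on J)"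
proof -
  obtain \<D> where D: "countable \<D>" "\<D> \<subseteq> Pow J" "\<And>X. X \<in> \<D> \<Longrightarrow> \<exists>a b. X = cbox a b" "\<Union>\<D> = J"
    by (rule open_countable_Union_open_cbox[OF J]) (rule that)
  have c: "compact X" "X \<subseteq> J" if "X \<in> \<D>" for X
    using D(2) D(3)[OF that] that by auto
  show ?thesis
  proof (rule measurable_piecewise_restrict[OF D(1)])
    show "space (lebesgue_on J) \<subseteq> \<Union>\<D>" using D(4) by simp
    fix X assume X: "X \<in> \<D>"
    show "X \<inter> space (lebesgue_on J) \<in> sets (lebesgue_on J)"
      using c[OF X] J by (auto simp: sets_restrict_space compact_imp_closed intro!: image_eqI[of _ _ X])
    have "restrict_space (lebesgue_on J) X = lebesgue_on X"
      using c[OF X] J by (subst restrict_restrict_space) (auto simp: Int_absorb1 compact_imp_closed)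
    then show "f \<in> borel_measurable (restrict_space (lebesgue_on J) X)"
      using f c[OF X] by (simp add: L1_loc_on_def borel_measurable_integrable)
  qed
qed

lemma Lp_on_2_iff:
  "Lp_on 2 J f \<longleftrightarrow> f \<in> borel_measurable (lebesgue_on J) \<and> integrable (lebesgue_on J) (\<lambda>x. (f x)\<^sup>2)"
  by (simp add: Lp_on_def powr_numeral)

lemma C1_test_DERIV: "C1_test J \<zeta> \<zeta>' \<Longrightarrow> (\<zeta> has_real_derivative \<zeta>' x) (at x)"
  and C1_test_continuous_deriv: "C1_test J \<zeta> \<zeta>' \<Longrightarrow> continuous_on UNIV \<zeta>'"
  by (simp_all add: C1_test_def)

text \<open>The square of \<open>w \<zeta>\<close> and the three terms in the square of its
  derivative \<open>g \<zeta> + w \<zeta>'\<close>. Local integrability suffices because every term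
  has compact support.\<close>

lemma L1_loc_on_L2_times_continuous_integrable:
  assumes J: "J \<in> sets lebesgue" and w: "continuous_on J w" and g: "L1_loc_on J g" "L1_loc_on J (\<lambda>x. (g x)\<^sup>2)"
    and t: "C1_test J \<zeta> \<zeta>'"
  shows "integrable (lebesgue_on J) (\<lambda>x. (w x * \<zeta> x)\<^sup>2)"
    and "integrable (lebesgue_on J) (\<lambda>x. (w x * \<zeta>' x)\<^sup>2)"
    and "integrable (lebesgue_on J) (\<lambda>x. (g x * \<zeta> x)\<^sup>2)"
    and "integrable (lebesgue_on J) (\<lambda>x. g x * \<zeta> x * (w x * \<zeta>' x))"
proof -
  obtain K where K: "compact K" "K \<subseteq> J" "\<And>x. x \<notin> K \<Longrightarrow> \<zeta> x = 0" "\<And>x. x \<notin> K \<Longrightarrow> \<zeta>' x = 0"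
    by (rule C1_testE[OF t]) (rule that)
  note c = C1_test_continuous[OF t]
  have w2: "L1_loc_on J (\<lambda>x. (w x)\<^sup>2)" by (intro L1_loc_on_continuous continuous_intros w)
  have gw: "L1_loc_on J (\<lambda>x. g x * w x)" by (rule L1_loc_on_times_continuous[OF g(1) w])
  have 1: "integrable (lebesgue_on J) (\<lambda>x. (w x)\<^sup>2 * (\<zeta> x)\<^sup>2)"
    using K(3) by (intro integrable_L1_loc_times_compact_support[OF J w2 K(1,2)] continuous_intros c) simp
  have 2: "integrable (lebesgue_on J) (\<lambda>x. (w x)\<^sup>2 * (\<zeta>' x)\<^sup>2)"
    using K(4) by (intro integrable_L1_loc_times_compact_support[OF J w2 K(1,2)] continuous_intros c) simp
  have 3: "integrable (lebesgue_on J) (\<lambda>x. (g x)\<^sup>2 * (\<zeta> x)\<^sup>2)"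
    using K(3) by (intro integrable_L1_loc_times_compact_support[OF J g(2) K(1,2)] continuous_intros c) simp
  have 4: "integrable (lebesgue_on J) (\<lambda>x. (g x * w x) * (\<zeta> x * \<zeta>' x))"
    using K(3) by (intro integrable_L1_loc_times_compact_support[OF J gw K(1,2)] continuous_intros c) simp
  show "integrable (lebesgue_on J) (\<lambda>x. (w x * \<zeta> x)\<^sup>2)" using 1 by (simp add: power_mult_distrib)
  show "integrable (lebesgue_on J) (\<lambda>x. (w x * \<zeta>' x)\<^sup>2)" using 2 by (simp add: power_mult_distrib)
  show "integrable (lebesgue_on J) (\<lambda>x. (g x * \<zeta> x)\<^sup>2)" using 3 by (simp add: power_mult_distrib)
  show "integrable (lebesgue_on J) (\<lambda>x. g x * \<zeta> x * (w x * \<zeta>' x))" using 4 by (simp add: mult_ac)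
qed

text \<open>\<open>H1_on\<close> speaks of the chosen \<open>weak_deriv\<close>, so square
  integrability is proved for the derivative given by the product rule and carried over by almost
  everywhere equality.\<close>

lemma H1_on_mult_test:
  assumes J: "open J" and w: "continuous_on J w" "is_weak_deriv J w g" and g: "L1_loc_on J (\<lambda>x. (g x)\<^sup>2)"
    and t: "C1_test J \<zeta> \<zeta>'"
  shows "H1_on J (\<lambda>x. w x * \<zeta> x)"
proof -
  have Jm: "J \<in> sets lebesgue" using J by auto
  have wd: "is_weak_deriv J (\<lambda>x. w x * \<zeta> x) (\<lambda>x. g x * \<zeta> x + w x * \<zeta>' x)"
    by (rule is_weak_deriv_mult[OF J w(2) C1_test_DERIV[OF t] C1_test_continuous_deriv[OF t]])
  have L: "L1_loc_on J g" "L1_loc_on J (\<lambda>x. w x * \<zeta> x)" "L1_loc_on J (weak_deriv J (\<lambda>x. w x * \<zeta> x))"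
    "L1_loc_on J (\<lambda>x. g x * \<zeta> x + w x * \<zeta>' x)"
    using w(2) wd is_weak_deriv_weak_deriv[OF wd] unfolding is_weak_deriv_def by blast+
  note i = L1_loc_on_L2_times_continuous_integrable[OF Jm w(1) L(1) g t]
  have "integrable (lebesgue_on J) (\<lambda>x. (g x * \<zeta> x)\<^sup>2 + (w x * \<zeta>' x)\<^sup>2 + 2 * (g x * \<zeta> x * (w x * \<zeta>' x)))"
    using i by auto
  then have sq: "integrable (lebesgue_on J) (\<lambda>x. (g x * \<zeta> x + w x * \<zeta>' x)\<^sup>2)"
    by (simp add: power2_sum mult.assoc)
  note m = L1_loc_on_imp_measurable[OF J L(3)] L1_loc_on_imp_measurable[OF J L(4)]
  have "AE x in lebesgue_on J. (g x * \<zeta> x + w x * \<zeta>' x)\<^sup>2 = (weak_deriv J (\<lambda>x. w x * \<zeta> x) x)\<^sup>2"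
    using AE_weak_deriv_eq[OF J wd] by (rule eventually_mono) simp
  then have "integrable (lebesgue_on J) (\<lambda>x. (weak_deriv J (\<lambda>x. w x * \<zeta> x) x)\<^sup>2)"
    by (rule integrable_cong_AE_imp[OF sq borel_measurable_power[OF m(1)]])
  then show ?thesis
    using i(1) wd m(1) L1_loc_on_imp_measurable[OF J L(2)] unfolding H1_on_def Lp_on_2_iff by blast
qed

lemma weak_deriv_zero: "open J \<Longrightarrow> AE x in lebesgue_on J. weak_deriv J (\<lambda>x. 0) x = 0"
  using AE_weak_deriv_eq[OF _ is_weak_deriv_const] .

lemma H1_on_zero:
  assumes "open J"
  shows "H1_on J (\<lambda>x. 0)"
proof -
  have "C1_test J (\<lambda>x. 0) (\<lambda>x. 0)" by (auto simp: C1_test_def intro: exI[of _ "{}"])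
  from H1_on_mult_test[OF assms _ is_weak_deriv_const[OF assms] _ this, of 0]
  show ?thesis by (simp add: L1_loc_on_continuous)
qed

lemma gintegral_eq_integral_edge:
  assumes "finite (edges G)" "e \<in> edges G"
    and "\<And>e'. e' \<in> edges G \<Longrightarrow> e' \<noteq> e \<Longrightarrow> AE x in lebesgue_on (edge_int G e'). F e' x = 0"
  shows "gintegral G F = integral\<^sup>L (lebesgue_on (edge_int G e)) (F e)"
proof -
  have "(\<Sum>e'\<in>edges G - {e}. integral\<^sup>L (lebesgue_on (edge_int G e')) (F e')) = 0"
    using assms(3) by (intro sum.neutral) (auto intro: integral_eq_zero_AE)
  then show ?thesis
    using sum.remove[OF assms(1,2), of "\<lambda>e'. integral\<^sup>L (lebesgue_on (edge_int G e')) (F e')"]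
    by (simp add: gintegral_def assms(1))
qed

lemma restr_mult_bump:
  assumes "C1_test (edge_int G e) \<zeta> \<zeta>'"
  shows "restr G (\<lambda>P. w P * bump e \<zeta> P) e' = (\<lambda>x. if e' = e then restr G w e x * \<zeta> x else 0)"
  by (auto simp: restr_def bump_pt[OF assms])

text \<open>On the other edges the function is identically zero, and the sum over edges is finite.
  Only \<open>w\<close> on the edge \<open>e\<close> has to be weakly differentiable, with a locally
  square integrable derivative.\<close>

lemma mult_bump_in_gH1:
  assumes G: "class_G_fin G" and e: "e \<in> edges G" and t: "C1_test (edge_int G e) \<zeta> \<zeta>'"
    and w: "gcontinuous G w" "is_weak_deriv (edge_int G e) (restr G w e) g"
    and g: "L1_loc_on (edge_int G e) (\<lambda>x. (g x)\<^sup>2)"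
  shows "(\<lambda>P. w P * bump e \<zeta> P) \<in> gH1 G"
proof -
  have cG: "class_G G" and mg: "metric_graph G" and fin: "finite (edges G)"
    using G by (auto simp: class_G_fin_def class_G_def)
  have cont: "continuous_on (edge_int G e) (restr G w e)"
    by (rule continuous_on_subset[OF continuous_on_restr[OF cG e w(1)] edge_int_subset_edge_dom])
  have "gcontinuous G (\<lambda>P. w P * bump e \<zeta> P)"
    using w(1) gcontinuous_bump[OF cG e t] unfolding gcontinuous_def by (rule continuous_map_real_mult)
  moreover have "H1_on (edge_int G e') (restr G (\<lambda>P. w P * bump e \<zeta> P) e')" if "e' \<in> edges G" for e'
    using H1_on_mult_test[OF open_edge_int[OF mg e] cont w(2) g t] H1_on_zero[OF open_edge_int[OF mg that]]
    by (cases "e' = e") (simp_all add: restr_mult_bump[OF t])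
  ultimately show ?thesis by (simp add: gH1_def fin summable_on_finite)
qed

lemma graph_deriv_mult_bump:
  assumes G: "metric_graph G" and e: "e \<in> edges G" and t: "C1_test (edge_int G e) \<zeta> \<zeta>'"
    and w: "is_weak_deriv (edge_int G e) (restr G w e) g"
  shows "AE x in lebesgue_on (edge_int G e).
    graph_deriv G (\<lambda>P. w P * bump e \<zeta> P) e x = g x * \<zeta> x + restr G w e x * \<zeta>' x"
  unfolding graph_deriv_def restr_mult_bump[OF t]
  using AE_weak_deriv_eq[OF open_edge_int[OF G e]
      is_weak_deriv_mult[OF open_edge_int[OF G e] w C1_test_DERIV[OF t] C1_test_continuous_deriv[OF t]]]
  by simp

lemma graph_deriv_mult_bump_other:
  assumes G: "metric_graph G" and e: "e' \<in> edges G" "e' \<noteq> e" and t: "C1_test (edge_int G e) \<zeta> \<zeta>'"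
  shows "AE x in lebesgue_on (edge_int G e'). graph_deriv G (\<lambda>P. w P * bump e \<zeta> P) e' x = 0"
  unfolding graph_deriv_def restr_mult_bump[OF t]
  using weak_deriv_zero[OF open_edge_int[OF G e(1)]] e(2) by simp

lemma graph_deriv_measurable:
  assumes "metric_graph G" "e \<in> edges G" "is_weak_deriv (edge_int G e) (restr G u e) g"
  shows "graph_deriv G u e \<in> borel_measurable (lebesgue_on (edge_int G e))"
  unfolding graph_deriv_def
  using L1_loc_on_imp_measurable[OF open_edge_int[OF assms(1,2)]] is_weak_deriv_weak_deriv[OF assms(3)]
  unfolding is_weak_deriv_def by blast

lemma graph_deriv_mult_bump_measurable:
  assumes G: "metric_graph G" and e: "e \<in> edges G" and t: "C1_test (edge_int G e) \<zeta> \<zeta>'"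
    and w: "is_weak_deriv (edge_int G e) (restr G w e) g"
  shows "graph_deriv G (\<lambda>P. w P * bump e \<zeta> P) e \<in> borel_measurable (lebesgue_on (edge_int G e))"
proof (rule graph_deriv_measurable[OF G e])
  show "is_weak_deriv (edge_int G e) (restr G (\<lambda>P. w P * bump e \<zeta> P) e) (\<lambda>x. g x * \<zeta> x + restr G w e x * \<zeta>' x)"
    using is_weak_deriv_mult[OF open_edge_int[OF G e] w C1_test_DERIV[OF t] C1_test_continuous_deriv[OF t]]
    by (simp add: restr_mult_bump[OF t])
qed

lemma restr_measurable:
  assumes "class_G G" "e \<in> edges G" "gcontinuous G u"
  shows "restr G u e \<in> borel_measurable (lebesgue_on (edge_int G e))"
proof -
  have mg: "metric_graph G" using assms by (simp add: class_G_def)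
  show ?thesis
    using continuous_on_subset[OF continuous_on_restr[OF assms] edge_int_subset_edge_dom]
    by (rule L1_loc_on_imp_measurable[OF open_edge_int[OF mg assms(2)] L1_loc_on_continuous])
qed

section \<open>The equation and the stability form on a single edge\<close>

text \<open>Serves two purposes: \<open>w = 1\<close> yields the equation on the open edge in the
  distributional sense, and \<open>w = u\<close> with a squared cutoff yields the energy identity.
  The representative \<open>graph_deriv\<close> of the test function is replaced by the explicit
  product rule.\<close>

lemma solution_edge_test:
  assumes G: "class_G_fin G" and e: "e \<in> edges G" and W: "gLinf G W" and \<rho>: "gLinf G \<rho>"
    and u: "solution G p W \<rho> u" and t: "C1_test (edge_int G e) \<zeta> \<zeta>'"
    and w: "gcontinuous G w" "is_weak_deriv (edge_int G e) (restr G w e) g"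
    and g: "L1_loc_on (edge_int G e) (\<lambda>x. (g x)\<^sup>2)"
  shows "integral\<^sup>L (lebesgue_on (edge_int G e)) (\<lambda>x. graph_deriv G u e x * (g x * \<zeta> x + restr G w e x * \<zeta>' x)
        + W e x * restr G u e x * (restr G w e x * \<zeta> x))
    = integral\<^sup>L (lebesgue_on (edge_int G e)) (\<lambda>x. \<rho> e x * \<bar>restr G u e x\<bar> powr (p - 2) * restr G u e x * (restr G w e x * \<zeta> x))"
proof -
  have cG: "class_G G" and mg: "metric_graph G" and fin: "finite (edges G)"
    using G by (auto simp: class_G_fin_def class_G_def)
  let ?J = "edge_int G e" and ?\<phi> = "\<lambda>P. w P * bump e \<zeta> P"
  obtain K where K: "compact K" "K \<subseteq> ?J" "\<And>x. x \<notin> K \<Longrightarrow> \<zeta> x = 0" "\<And>x. x \<notin> K \<Longrightarrow> \<zeta>' x = 0"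
    by (rule C1_testE[OF t]) (rule that)
  have \<phi>: "?\<phi> \<in> gH1 G \<inter> gC_c G"
    using mult_bump_in_gH1[OF G e t w g] mult_bump_in_gC_c[OF cG e t w(1) K(1-3)] by blast
  have u1: "u \<in> gH1_loc G" using u by (simp add: solution_def)
  then obtain g0 where g0: "is_weak_deriv ?J (restr G u e) g0" and cu: "gcontinuous G u"
    using e by (auto simp: gH1_loc_def)
  have meas: "graph_deriv G u e \<in> borel_measurable (lebesgue_on ?J)" "restr G u e \<in> borel_measurable (lebesgue_on ?J)"
    "W e \<in> borel_measurable (lebesgue_on ?J)" "g \<in> borel_measurable (lebesgue_on ?J)"
    "restr G w e \<in> borel_measurable (lebesgue_on ?J)"
    "graph_deriv G ?\<phi> e \<in> borel_measurable (lebesgue_on ?J)"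
    "restr G ?\<phi> e \<in> borel_measurable (lebesgue_on ?J)"
    using graph_deriv_measurable[OF mg e g0] restr_measurable[OF cG e cu] W e w restr_measurable[OF cG e w(1)]
      L1_loc_on_imp_measurable[OF open_edge_int[OF mg e]] \<phi> restr_measurable[OF cG e, of ?\<phi>]
      graph_deriv_mult_bump_measurable[OF mg e t w(2)]
    by (auto simp: gLinf_def is_weak_deriv_def gH1_def H1_on_def)
  have tm: "\<zeta> \<in> borel_measurable (lebesgue_on ?J)" "\<zeta>' \<in> borel_measurable (lebesgue_on ?J)"
    using C1_test_continuous[OF t]
    by (auto intro!: continuous_imp_measurable_on_sets_lebesgue edge_int_sets_lebesgue[OF mg e])
  have "gintegral G (\<lambda>e x. graph_deriv G u e x * graph_deriv G ?\<phi> e x + W e x * restr G u e x * restr G ?\<phi> e x)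
      = gintegral G (\<lambda>e x. \<rho> e x * \<bar>restr G u e x\<bar> powr (p - 2) * restr G u e x * restr G ?\<phi> e x)"
    using u \<phi> unfolding solution_def by blast
  moreover have "gintegral G (\<lambda>e x. graph_deriv G u e x * graph_deriv G ?\<phi> e x + W e x * restr G u e x * restr G ?\<phi> e x)
      = integral\<^sup>L (lebesgue_on ?J) (\<lambda>x. graph_deriv G u e x * graph_deriv G ?\<phi> e x + W e x * restr G u e x * restr G ?\<phi> e x)"
  proof (rule gintegral_eq_integral_edge[OF fin e])
    fix e' assume e': "e' \<in> edges G" "e' \<noteq> e"
    show "AE x in lebesgue_on (edge_int G e'). graph_deriv G u e' x * graph_deriv G ?\<phi> e' x
        + W e' x * restr G u e' x * restr G ?\<phi> e' x = 0"
      using graph_deriv_mult_bump_other[OF mg e' t, of w]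
      by (rule eventually_mono) (simp add: restr_mult_bump[OF t] e'(2))
  qed
  moreover have "\<dots> = integral\<^sup>L (lebesgue_on ?J) (\<lambda>x. graph_deriv G u e x * (g x * \<zeta> x + restr G w e x * \<zeta>' x)
        + W e x * restr G u e x * (restr G w e x * \<zeta> x))"
  proof (rule integral_cong_AE)
    show "AE x in lebesgue_on ?J. graph_deriv G u e x * graph_deriv G ?\<phi> e x + W e x * restr G u e x * restr G ?\<phi> e x
        = graph_deriv G u e x * (g x * \<zeta> x + restr G w e x * \<zeta>' x) + W e x * restr G u e x * (restr G w e x * \<zeta> x)"
      using graph_deriv_mult_bump[OF mg e t w(2)] by (rule eventually_mono) (simp add: restr_mult_bump[OF t])
  qed (intro borel_measurable_add borel_measurable_times meas tm)+
  moreover have "gintegral G (\<lambda>e x. \<rho> e x * \<bar>restr G u e x\<bar> powr (p - 2) * restr G u e x * restr G ?\<phi> e x)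
      = integral\<^sup>L (lebesgue_on ?J) (\<lambda>x. \<rho> e x * \<bar>restr G u e x\<bar> powr (p - 2) * restr G u e x * (restr G w e x * \<zeta> x))"
    by (subst gintegral_eq_integral_edge[OF fin e]) (simp_all add: restr_mult_bump[OF t])
  ultimately show ?thesis by simp
qed

text \<open>The set \<open>K\<close> is an explicit parameter because admissibility depends on where
  the support lies: its image in the graph must miss \<open>C\<close>. The lemma is meant for
  \<open>w = u\<close> and a cutoff \<open>\<zeta>\<close>.\<close>

lemma stable_edge_test:
  assumes G: "class_G_fin G" and e: "e \<in> edges G" and W: "gLinf G W" and \<rho>: "gLinf G \<rho>"
    and u: "gcontinuous G u" "stable_outside G p W \<rho> u C" and t: "C1_test (edge_int G e) \<zeta> \<zeta>'"
    and w: "gcontinuous G w" "is_weak_deriv (edge_int G e) (restr G w e) g"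
    and g: "L1_loc_on (edge_int G e) (\<lambda>x. (g x)\<^sup>2)"
    and K: "compact K" "K \<subseteq> edge_int G e" "\<And>x. x \<notin> K \<Longrightarrow> \<zeta> x = 0" "pt G e ` K \<inter> C = {}"
  shows "0 \<le> integral\<^sup>L (lebesgue_on (edge_int G e)) (\<lambda>x. (g x * \<zeta> x + restr G w e x * \<zeta>' x)\<^sup>2
        + W e x * (restr G w e x * \<zeta> x)\<^sup>2
        - (p - 1) * \<rho> e x * \<bar>restr G u e x\<bar> powr (p - 2) * (restr G w e x * \<zeta> x)\<^sup>2)"
proof -
  have cG: "class_G G" and mg: "metric_graph G" and fin: "finite (edges G)"
    using G by (auto simp: class_G_fin_def class_G_def)
  let ?J = "edge_int G e" and ?\<phi> = "\<lambda>P. w P * bump e \<zeta> P"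
  have \<phi>: "?\<phi> \<in> gH1 G \<inter> gC_c G"
    using mult_bump_in_gH1[OF G e t w g] mult_bump_in_gC_c[OF cG e t w(1) K(1-3)] by blast
  have "gsupp G ?\<phi> \<subseteq> points G"
    unfolding gsupp_def topspace_gtop[OF cG, symmetric] by (rule closure_of_subset_topspace)
  then have "gsupp G ?\<phi> \<subseteq> points G - C"
    using gsupp_mult_bump[OF cG e t w(1) K(1-3)] K(4) by blast
  then have "0 \<le> Q_form G p W \<rho> u ?\<phi>"
    using u(2) \<phi> unfolding stable_outside_def by blast
  have meas: "restr G u e \<in> borel_measurable (lebesgue_on ?J)"
    "W e \<in> borel_measurable (lebesgue_on ?J)" "\<rho> e \<in> borel_measurable (lebesgue_on ?J)"
    "g \<in> borel_measurable (lebesgue_on ?J)" "restr G w e \<in> borel_measurable (lebesgue_on ?J)"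
    "graph_deriv G ?\<phi> e \<in> borel_measurable (lebesgue_on ?J)"
    "restr G ?\<phi> e \<in> borel_measurable (lebesgue_on ?J)"
    using restr_measurable[OF cG e u(1)] W \<rho> e w restr_measurable[OF cG e w(1)]
      L1_loc_on_imp_measurable[OF open_edge_int[OF mg e]] \<phi> restr_measurable[OF cG e, of ?\<phi>]
      graph_deriv_mult_bump_measurable[OF mg e t w(2)]
    by (auto simp: gLinf_def is_weak_deriv_def gH1_def H1_on_def)
  have tm: "\<zeta> \<in> borel_measurable (lebesgue_on ?J)" "\<zeta>' \<in> borel_measurable (lebesgue_on ?J)"
    using C1_test_continuous[OF t]
    by (auto intro!: continuous_imp_measurable_on_sets_lebesgue edge_int_sets_lebesgue[OF mg e])
  have "Q_form G p W \<rho> u ?\<phi> = integral\<^sup>L (lebesgue_on ?J) (\<lambda>x. \<bar>graph_deriv G ?\<phi> e x\<bar>\<^sup>2 + W e x * \<bar>restr G ?\<phi> e x\<bar>\<^sup>2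
     - (p - 1) * \<rho> e x * \<bar>restr G u e x\<bar> powr (p - 2) * \<bar>restr G ?\<phi> e x\<bar>\<^sup>2)"
    unfolding Q_form_def
  proof (rule gintegral_eq_integral_edge[OF fin e])
    fix e' assume e': "e' \<in> edges G" "e' \<noteq> e"
    show "AE x in lebesgue_on (edge_int G e'). \<bar>graph_deriv G ?\<phi> e' x\<bar>\<^sup>2 + W e' x * \<bar>restr G ?\<phi> e' x\<bar>\<^sup>2
     - (p - 1) * \<rho> e' x * \<bar>restr G u e' x\<bar> powr (p - 2) * \<bar>restr G ?\<phi> e' x\<bar>\<^sup>2 = 0"
      using graph_deriv_mult_bump_other[OF mg e' t, of w]
      by (rule eventually_mono) (simp add: restr_mult_bump[OF t] e'(2))
  qed
  also have "\<dots> = integral\<^sup>L (lebesgue_on ?J) (\<lambda>x. (g x * \<zeta> x + restr G w e x * \<zeta>' x)\<^sup>2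
        + W e x * (restr G w e x * \<zeta> x)\<^sup>2
        - (p - 1) * \<rho> e x * \<bar>restr G u e x\<bar> powr (p - 2) * (restr G w e x * \<zeta> x)\<^sup>2)"
  proof (rule integral_cong_AE)
    show "AE x in lebesgue_on ?J. \<bar>graph_deriv G ?\<phi> e x\<bar>\<^sup>2 + W e x * \<bar>restr G ?\<phi> e x\<bar>\<^sup>2
       - (p - 1) * \<rho> e x * \<bar>restr G u e x\<bar> powr (p - 2) * \<bar>restr G ?\<phi> e x\<bar>\<^sup>2
      = (g x * \<zeta> x + restr G w e x * \<zeta>' x)\<^sup>2 + W e x * (restr G w e x * \<zeta> x)\<^sup>2
        - (p - 1) * \<rho> e x * \<bar>restr G u e x\<bar> powr (p - 2) * (restr G w e x * \<zeta> x)\<^sup>2"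
      using graph_deriv_mult_bump[OF mg e t w(2)] by (rule eventually_mono) (simp add: restr_mult_bump[OF t])
  qed (intro borel_measurable_add borel_measurable_diff borel_measurable_times borel_measurable_power
        borel_measurable_abs borel_measurable_const powr_real_measurable meas tm)+
  finally show ?thesis using \<open>0 \<le> Q_form G p W \<rho> u ?\<phi>\<close> by simp
qed

section \<open>Energy of stable solutions on half-lines\<close>

lemma set_integrable_lebesgue_iff:
  fixes f :: "real \<Rightarrow> real"
  shows "A \<in> sets lebesgue \<Longrightarrow> set_integrable lebesgue A f \<longleftrightarrow> integrable (lebesgue_on A) f"
  by (simp add: set_integrable_def integrable_restrict_space)

lemma integrable_lebesgue_on_subset:
  fixes f :: "real \<Rightarrow> real"
  assumes "integrable (lebesgue_on A) f" "K \<subseteq> A" "K \<in> sets lebesgue" "A \<in> sets lebesgue"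
  shows "integrable (lebesgue_on K) f"
  using set_integrable_subset[of lebesgue A f K] assms by (simp add: set_integrable_lebesgue_iff)

lemma integrable_lebesgue_on_Un:
  fixes f :: "real \<Rightarrow> real"
  assumes "integrable (lebesgue_on A) f" "integrable (lebesgue_on B) f" "A \<in> sets lebesgue" "B \<in> sets lebesgue"
  shows "integrable (lebesgue_on (A \<union> B)) f"
  using set_integrable_Un[of lebesgue A f B] assms by (simp add: set_integrable_lebesgue_iff)

lemma integral_lebesgue_on_mono_set:
  fixes f :: "real \<Rightarrow> real"
  assumes "integrable (lebesgue_on B) f" "AE x in lebesgue_on B. 0 \<le> f x"
    and "A \<subseteq> B" "A \<in> sets lebesgue" "B \<in> sets lebesgue"
  shows "integral\<^sup>L (lebesgue_on A) f \<le> integral\<^sup>L (lebesgue_on B) f"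
  using assms by (intro integral_mono_lebesgue_on_AE) auto

text \<open>Monotone convergence. The truncations are extended by zero so that they share one
  measure space; the sign of \<open>h\<close> makes them increase and the uniform bound makes their
  integrals converge.\<close>

lemma integrable_halfline_of_bounded_integrals:
  fixes h :: "real \<Rightarrow> real"
  assumes nonneg: "AE x in lebesgue_on {c..}. 0 \<le> h x"
    and int: "\<And>n::nat. integrable (lebesgue_on {c..real n}) h"
    and bound: "\<And>n::nat. integral\<^sup>L (lebesgue_on {c..real n}) h \<le> C"
  shows "integrable (lebesgue_on {c..}) h"
proof -
  define F where "F = (\<lambda>n x. if x \<in> {c..real n} then h x else 0)"
  have Fi: "integrable lebesgue (F n)" "integral\<^sup>L lebesgue (F n) = integral\<^sup>L (lebesgue_on {c..real n}) h" for n
    using int[of n] unfolding F_def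
    by (auto simp: Lebesgue_Measure.integrable_restrict_UNIV Lebesgue_Measure.integral_restrict_UNIV
        simp del: atLeastAtMost_iff)
  have nn: "AE x in lebesgue. x \<in> {c..} \<longrightarrow> 0 \<le> h x"
    using nonneg by (simp add: AE_restrict_space_iff)
  have inc: "incseq (\<lambda>n. integral\<^sup>L lebesgue (F n))"
  proof (rule incseq_SucI)
    fix n
    have "AE x in lebesgue. F n x \<le> F (Suc n) x"
      using nn by (rule eventually_mono) (auto simp: F_def)
    then show "integral\<^sup>L lebesgue (F n) \<le> integral\<^sup>L lebesgue (F (Suc n))"
      by (rule integral_mono_AE[OF Fi(1) Fi(1)])
  qed
  have "\<exists>L. (\<lambda>n. integral\<^sup>L lebesgue (F n)) \<longlonglongrightarrow> L"
    using incseq_convergent[OF inc, of C] bound Fi(2) by metis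
  then obtain L where L: "(\<lambda>n. integral\<^sup>L lebesgue (F n)) \<longlonglongrightarrow> L" by blast
  have lim: "(\<lambda>n. F n x) \<longlonglongrightarrow> (if x \<in> {c..} then h x else 0)" for x
  proof (rule tendsto_eventually)
    obtain N where "x \<le> real N" using real_arch_simple by blast
    then show "\<forall>\<^sub>F n in sequentially. F n x = (if x \<in> {c..} then h x else 0)"
      unfolding eventually_sequentially F_def by (intro exI[of _ N]) auto
  qed
  have "integrable lebesgue (\<lambda>x. if x \<in> {c..} then h x else 0)"
  proof (rule integrable_monotone_convergence[of lebesgue F _ L])
    show "AE x in lebesgue. mono (\<lambda>n. F n x)"
      using nn by (rule eventually_mono) (auto simp: F_def mono_def)
    show "AE x in lebesgue. (\<lambda>n. F n x) \<longlonglongrightarrow> (if x \<in> {c..} then h x else 0)"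
      using lim by (intro AE_I2)
    show "(\<lambda>x. if x \<in> {c..} then h x else 0) \<in> borel_measurable lebesgue"
      using borel_measurable_integrable[OF Fi(1)] lim by (rule borel_measurable_LIMSEQ_real[rotated])
  qed (use Fi L in auto)
  then show ?thesis
    by (subst (asm) Lebesgue_Measure.integrable_restrict_UNIV) auto
qed

section \<open>The energy estimate for a fixed cutoff\<close>

text \<open>Write \<open>A\<close>, \<open>X\<close>, \<open>V\<close>, \<open>R\<close> for the
  integrals of \<open>(g \<eta>)\<^sup>2\<close>, \<open>g \<eta> f \<eta>'\<close>,
  \<open>W (f \<eta>)\<^sup>2\<close> and the \<open>\<rho>\<close> term. The equation reads
  \<open>A + 2 X + V = R\<close>, stability reads \<open>A + 2 X + D + V \<ge> (p - 1) R\<close>, so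
  \<open>(p - 2) R \<le> D\<close>. With \<open>2 X \<ge> - A / 2 - 2 D\<close> this gives
  \<open>A / 2 + V \<le> R + 2 D\<close>, hence both remaining bounds. The hypotheses
  \<open>eq\<close> and \<open>st\<close> have the form in which the single-edge tests deliver
  them.\<close>

lemma caccioppoli_of_stable:
  assumes J: "open J" and p: "2 < p"
    and f: "continuous_on J f" "\<And>x. x \<in> J \<Longrightarrow> \<bar>f x\<bar> \<le> B"
    and g: "L1_loc_on J g" "L1_loc_on J (\<lambda>x. (g x)\<^sup>2)"
    and W: "W \<in> borel_measurable (lebesgue_on J)" "AE x in lebesgue_on J. \<bar>W x\<bar> \<le> M"
      "AE x in lebesgue_on J. 0 \<le> W x"
    and \<rho>: "\<rho> \<in> borel_measurable (lebesgue_on J)" "AE x in lebesgue_on J. \<bar>\<rho> x\<bar> \<le> N"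
    and t: "C1_test J \<eta> \<eta>'"
    and eq: "integral\<^sup>L (lebesgue_on J) (\<lambda>x. g x * (g x * (\<eta> x * \<eta> x) + f x * (\<eta> x * \<eta>' x + \<eta>' x * \<eta> x))
        + W x * f x * (f x * (\<eta> x * \<eta> x)))
      = integral\<^sup>L (lebesgue_on J) (\<lambda>x. \<rho> x * \<bar>f x\<bar> powr (p - 2) * f x * (f x * (\<eta> x * \<eta> x)))"
    and st: "0 \<le> integral\<^sup>L (lebesgue_on J) (\<lambda>x. (g x * \<eta> x + f x * \<eta>' x)\<^sup>2 + W x * (f x * \<eta> x)\<^sup>2
        - (p - 1) * \<rho> x * \<bar>f x\<bar> powr (p - 2) * (f x * \<eta> x)\<^sup>2)"
  defines "D \<equiv> integral\<^sup>L (lebesgue_on J) (\<lambda>x. (f x * \<eta>' x)\<^sup>2)"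
  shows "integrable (lebesgue_on J) (\<lambda>x. (g x * \<eta> x)\<^sup>2)"
    and "integrable (lebesgue_on J) (\<lambda>x. W x * (f x * \<eta> x)\<^sup>2)"
    and "integrable (lebesgue_on J) (\<lambda>x. \<rho> x * \<bar>f x\<bar> powr (p - 2) * (f x * \<eta> x)\<^sup>2)"
    and "integrable (lebesgue_on J) (\<lambda>x. (f x * \<eta>' x)\<^sup>2)"
    and "integral\<^sup>L (lebesgue_on J) (\<lambda>x. \<rho> x * \<bar>f x\<bar> powr (p - 2) * (f x * \<eta> x)\<^sup>2) \<le> D / (p - 2)"
    and "integral\<^sup>L (lebesgue_on J) (\<lambda>x. W x * (f x * \<eta> x)\<^sup>2) \<le> D / (p - 2) + 2 * D"
    and "integral\<^sup>L (lebesgue_on J) (\<lambda>x. (g x * \<eta> x)\<^sup>2) \<le> 2 * (D / (p - 2) + 2 * D)"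
proof -
  have Jm: "J \<in> sets lebesgue" using J by auto
  let ?I = "\<lambda>F. integral\<^sup>L (lebesgue_on J) F"
  note i = L1_loc_on_L2_times_continuous_integrable[OF Jm f(1) g t]
  have fm: "f \<in> borel_measurable (lebesgue_on J)"
    by (rule L1_loc_on_imp_measurable[OF J L1_loc_on_continuous[OF f(1)]])
  have "integrable (lebesgue_on J) (\<lambda>x. (f x * \<eta> x)\<^sup>2 * W x)"
    by (rule integrable_times_bounded[OF i(1) W(1,2)])
  then have V: "integrable (lebesgue_on J) (\<lambda>x. W x * (f x * \<eta> x)\<^sup>2)" by (simp add: mult.commute)
  have "AE x in lebesgue_on J. \<bar>\<rho> x * \<bar>f x\<bar> powr (p - 2)\<bar> \<le> N * B powr (p - 2)"
    using \<rho>(2) AE_space[of "lebesgue_on J"]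
  proof eventually_elim
    case (elim x)
    then have "\<bar>f x\<bar> powr (p - 2) \<le> B powr (p - 2)" using f(2) p by (intro powr_mono2) auto
    then show ?case using elim(1) by (simp add: abs_mult mult_mono)
  qed
  then have "integrable (lebesgue_on J) (\<lambda>x. (f x * \<eta> x)\<^sup>2 * (\<rho> x * \<bar>f x\<bar> powr (p - 2)))"
    by (intro integrable_times_bounded[OF i(1)] borel_measurable_times \<rho>(1) powr_real_measurable
        borel_measurable_abs fm borel_measurable_const)
  then have R: "integrable (lebesgue_on J) (\<lambda>x. \<rho> x * \<bar>f x\<bar> powr (p - 2) * (f x * \<eta> x)\<^sup>2)"
    by (simp add: mult.commute)
  have e1: "?I (\<lambda>x. g x * (g x * (\<eta> x * \<eta> x) + f x * (\<eta> x * \<eta>' x + \<eta>' x * \<eta> x)) + W x * f x * (f x * (\<eta> x * \<eta> x)))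
      = ?I (\<lambda>x. (g x * \<eta> x)\<^sup>2 + 2 * (g x * \<eta> x * (f x * \<eta>' x)) + W x * (f x * \<eta> x)\<^sup>2)"
    by (intro Bochner_Integration.integral_cong) (simp_all add: power2_eq_square algebra_simps)
  have e2: "?I (\<lambda>x. \<rho> x * \<bar>f x\<bar> powr (p - 2) * f x * (f x * (\<eta> x * \<eta> x)))
      = ?I (\<lambda>x. \<rho> x * \<bar>f x\<bar> powr (p - 2) * (f x * \<eta> x)\<^sup>2)"
    by (intro Bochner_Integration.integral_cong) (simp_all add: power2_eq_square)
  have e3: "?I (\<lambda>x. (g x * \<eta> x + f x * \<eta>' x)\<^sup>2 + W x * (f x * \<eta> x)\<^sup>2
        - (p - 1) * \<rho> x * \<bar>f x\<bar> powr (p - 2) * (f x * \<eta> x)\<^sup>2)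
      = ?I (\<lambda>x. (g x * \<eta> x)\<^sup>2 + 2 * (g x * \<eta> x * (f x * \<eta>' x)) + (f x * \<eta>' x)\<^sup>2 + W x * (f x * \<eta> x)\<^sup>2
        - (p - 1) * (\<rho> x * \<bar>f x\<bar> powr (p - 2) * (f x * \<eta> x)\<^sup>2))"
    by (intro Bochner_Integration.integral_cong) (simp_all add: power2_sum)
  \<comment> \<open>Young's inequality for the mixed term, as a completed square; the weight
    \<open>1/2\<close> leaves half of the derivative term to be bounded.\<close>
  have "0 \<le> ?I (\<lambda>x. (1/2) * (g x * \<eta> x)\<^sup>2 + 2 * (g x * \<eta> x * (f x * \<eta>' x)) + 2 * (f x * \<eta>' x)\<^sup>2)"
  proof (rule integral_nonneg_AE, rule AE_I2)
    fix x
    have "0 \<le> (1/2) * (g x * \<eta> x + 2 * (f x * \<eta>' x))\<^sup>2" by simp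
    then show "0 \<le> (1/2) * (g x * \<eta> x)\<^sup>2 + 2 * (g x * \<eta> x * (f x * \<eta>' x)) + 2 * (f x * \<eta>' x)\<^sup>2"
      by (simp add: power2_eq_square algebra_simps)
  qed
  then have young: "0 \<le> (1/2) * ?I (\<lambda>x. (g x * \<eta> x)\<^sup>2) + 2 * ?I (\<lambda>x. g x * \<eta> x * (f x * \<eta>' x)) + 2 * D"
    using i by (simp add: D_def)
  have eq': "?I (\<lambda>x. (g x * \<eta> x)\<^sup>2) + 2 * ?I (\<lambda>x. g x * \<eta> x * (f x * \<eta>' x)) + ?I (\<lambda>x. W x * (f x * \<eta> x)\<^sup>2)
      = ?I (\<lambda>x. \<rho> x * \<bar>f x\<bar> powr (p - 2) * (f x * \<eta> x)\<^sup>2)"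
    using eq[unfolded e1 e2] i V by simp
  have st': "0 \<le> ?I (\<lambda>x. (g x * \<eta> x)\<^sup>2) + 2 * ?I (\<lambda>x. g x * \<eta> x * (f x * \<eta>' x)) + D + ?I (\<lambda>x. W x * (f x * \<eta> x)\<^sup>2)
      - (p - 1) * ?I (\<lambda>x. \<rho> x * \<bar>f x\<bar> powr (p - 2) * (f x * \<eta> x)\<^sup>2)"
    using st[unfolded e3] i V R by (simp add: D_def)
  have "(p - 2) * ?I (\<lambda>x. \<rho> x * \<bar>f x\<bar> powr (p - 2) * (f x * \<eta> x)\<^sup>2) \<le> D"
    using eq' st' by (simp add: algebra_simps)
  then show R': "?I (\<lambda>x. \<rho> x * \<bar>f x\<bar> powr (p - 2) * (f x * \<eta> x)\<^sup>2) \<le> D / (p - 2)"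
    using p by (simp add: pos_le_divide_eq mult.commute)
  have A0: "0 \<le> ?I (\<lambda>x. (g x * \<eta> x)\<^sup>2)" by simp
  have "AE x in lebesgue_on J. 0 \<le> W x * (f x * \<eta> x)\<^sup>2" using W(3) by (rule eventually_mono) simp
  then have V0: "0 \<le> ?I (\<lambda>x. W x * (f x * \<eta> x)\<^sup>2)" by (rule integral_nonneg_AE)
  show "?I (\<lambda>x. W x * (f x * \<eta> x)\<^sup>2) \<le> D / (p - 2) + 2 * D" using R' eq' young A0 by linarith
  show "?I (\<lambda>x. (g x * \<eta> x)\<^sup>2) \<le> 2 * (D / (p - 2) + 2 * D)"
  proof -
    have arith: "A \<le> 2 * (q + 2 * d)"
      if "A + 2 * X + V = R" "R \<le> q" "0 \<le> (1/2) * A + 2 * X + 2 * d" "0 \<le> V" for A X V R d q :: real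
      using that by (simp add: field_simps)
    show ?thesis by (rule arith[OF eq' R' young V0])
  qed
  show "integrable (lebesgue_on J) (\<lambda>x. W x * (f x * \<eta> x)\<^sup>2)"
    "integrable (lebesgue_on J) (\<lambda>x. \<rho> x * \<bar>f x\<bar> powr (p - 2) * (f x * \<eta> x)\<^sup>2)" by (fact V R)+
  show "integrable (lebesgue_on J) (\<lambda>x. (g x * \<eta> x)\<^sup>2)" "integrable (lebesgue_on J) (\<lambda>x. (f x * \<eta>' x)\<^sup>2)"
    by (fact i)+
qed

text \<open>In contrast to \<open>plateau\<close>, the ramps keep unit length as \<open>b\<close>
  grows, so the derivative stays bounded uniformly in the length. The falling ramp lies to the right
  of \<open>b\<close>.\<close>

definition cutoff :: "real \<Rightarrow> real \<Rightarrow> real \<Rightarrow> real" where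
  "cutoff a b s = step1 (s - a) - step1 (s - b)"

definition cutoff' :: "real \<Rightarrow> real \<Rightarrow> real \<Rightarrow> real" where
  "cutoff' a b s = hat (s - a) - hat (s - b)"

lemma cutoff_outside: "a \<le> b \<Longrightarrow> s \<notin> {a..b + 1} \<Longrightarrow> cutoff a b s = 0"
  by (auto simp: cutoff_def not_le)

lemma cutoff_inside: "s \<in> {a + 1..b} \<Longrightarrow> cutoff a b s = 1"
  by (auto simp: cutoff_def)

lemma C1_test_cutoff:
  assumes "a \<le> b" "{a..b + 1} \<subseteq> J"
  shows "C1_test J (cutoff a b) (cutoff' a b)"
  unfolding C1_test_def
proof (intro conjI allI)
  have d: "((\<lambda>s. step1 (s - c)) has_real_derivative hat (s - c)) (at s)" for c s
    using DERIV_shift[of step1 "hat (s - c)" s "- c"] DERIV_step1[of "s - c"] by simp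
  show "(cutoff a b has_real_derivative cutoff' a b s) (at s)" for s
    unfolding cutoff_def[abs_def] cutoff'_def by (intro DERIV_diff d)
  show "continuous_on UNIV (cutoff' a b)"
    unfolding cutoff'_def[abs_def] hat_def by (intro continuous_intros)
  show "\<exists>K. compact K \<and> K \<subseteq> J \<and> (\<forall>s. s \<notin> K \<longrightarrow> cutoff a b s = 0)"
    using assms cutoff_outside by (intro exI[of _ "{a..b + 1}"]) auto
qed

text \<open>The constant is \<open>4 * 2\<close>: the derivative is at most 2 in absolute value, so
  the integrand is at most \<open>4 * B\<^sup>2\<close>, and the two ramps have total length at most
  2. The distance between \<open>a\<close> and \<open>b\<close> does not enter the bound.\<close>

lemma integral_cutoff'_le:
  assumes ab: "a + 1 \<le> b" "{a..b + 1} \<subseteq> J" and J: "J \<in> sets lebesgue"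
    and f: "\<And>x. x \<in> J \<Longrightarrow> \<bar>f x\<bar> \<le> B"
    and int: "integrable (lebesgue_on J) (\<lambda>x. (f x * cutoff' a b x)\<^sup>2)"
  shows "integral\<^sup>L (lebesgue_on J) (\<lambda>x. (f x * cutoff' a b x)\<^sup>2) \<le> 8 * B\<^sup>2"
proof -
  let ?F = "\<lambda>x. (f x * cutoff' a b x)\<^sup>2"
  have z: "?F x = 0" if "x \<notin> {a..a + 1} \<union> {b..b + 1}" for x
    using that hat_outside[of "x - a"] hat_outside[of "x - b"] by (auto simp: cutoff'_def not_le)
  have le: "?F x \<le> 4 * B\<^sup>2" if "x \<in> J" for x
  proof -
    have "\<bar>cutoff' a b x\<bar> \<le> 2"
      using hat_bounds[of "x - a"] hat_bounds[of "x - b"] by (simp add: cutoff'_def abs_le_iff)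
    then have "\<bar>f x * cutoff' a b x\<bar> \<le> B * 2"
      using f[OF that] unfolding abs_mult by (intro mult_mono) auto
    then have "\<bar>f x * cutoff' a b x\<bar>\<^sup>2 \<le> (B * 2)\<^sup>2" by (intro power_mono) auto
    then show ?thesis by (simp add: power_mult_distrib)
  qed
  have sub: "{a..a + 1} \<union> {b..b + 1} \<subseteq> J" using ab by auto
  have m: "{a..a + 1} \<union> {b..b + 1} \<in> lmeasurable" by (intro fmeasurable.Un) auto
  have ms: "{a..a + 1} \<union> {b..b + 1} \<in> sets lebesgue" using m by blast
  have "integral\<^sup>L (lebesgue_on J) ?F = integral\<^sup>L (lebesgue_on ({a..a + 1} \<union> {b..b + 1})) ?F"
    by (rule integral_lebesgue_on_zero_outside[OF sub ms J z])
  also have "\<dots> \<le> integral\<^sup>L (lebesgue_on ({a..a + 1} \<union> {b..b + 1})) (\<lambda>x. 4 * B\<^sup>2)"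
  proof (rule integral_mono)
    show "integrable (lebesgue_on ({a..a + 1} \<union> {b..b + 1})) ?F"
      by (rule integrable_lebesgue_on_subset[OF int sub ms J])
    show "integrable (lebesgue_on ({a..a + 1} \<union> {b..b + 1})) (\<lambda>x. 4 * B\<^sup>2)"
      by (rule finite_measure.integrable_const[OF finite_measure_lebesgue_on[OF m]])
    show "?F x \<le> 4 * B\<^sup>2" if "x \<in> space (lebesgue_on ({a..a + 1} \<union> {b..b + 1}))" for x
      using le[of x] that sub by (metis space_lebesgue_on subsetD)
  qed
  also have "\<dots> = 4 * B\<^sup>2 * measure lebesgue ({a..a + 1} \<union> {b..b + 1})"
    by (simp add: measure_restrict_space ms)
  also have "\<dots> \<le> 4 * B\<^sup>2 * 2"
    using measure_Un_le[of "{a..a + 1}" lebesgue "{b..b + 1}"] by (intro mult_left_mono) auto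
  finally show ?thesis by simp
qed

text \<open>If \<open>|f x| \<ge> \<epsilon>\<close>, the Lipschitz bound keeps \<open>|f|\<close>
  above \<open>\<epsilon> / 2\<close> on \<open>[x, x + r]\<close>. This contributes at least the
  fixed amount \<open>r * (\<epsilon> / 2) powr q\<close> to a tail of the integral, while the tails
  tend to 0.\<close>

lemma lipschitz_integrable_imp_tendsto_0:
  fixes f :: "real \<Rightarrow> real"
  assumes f: "L-lipschitz_on {c..} f" and q: "0 < q"
    and int: "integrable (lebesgue_on {c..}) (\<lambda>x. \<bar>f x\<bar> powr q)"
  shows "(f \<longlongrightarrow> 0) at_top"
proof (rule tendstoI)
  fix \<epsilon> :: real assume \<epsilon>: "0 < \<epsilon>"
  have L: "0 \<le> L" using f by (rule lipschitz_on_nonneg)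
  \<comment> \<open>The denominator contains \<open>L + 1\<close> because \<open>L\<close> may be
    0.\<close>
  define r where "r = \<epsilon> / (2 * (L + 1))"
  have r: "0 < r" "L * r \<le> \<epsilon> / 2"
    using L \<epsilon> by (auto simp: r_def field_simps)
  define h where "h = (\<lambda>x. \<bar>f x\<bar> powr q)"
  \<comment> \<open>Tail integrals, written over the fixed set \<open>{c..}\<close> so that
    dominated convergence with majorant \<open>h\<close> applies.\<close>
  define T where "T = (\<lambda>n::nat. integral\<^sup>L (lebesgue_on {c..}) (\<lambda>x. if x \<in> {real n..} then h x else 0))"
  have hi: "integrable (lebesgue_on {c..}) h" using int by (simp add: h_def)
  have m: "{a..b} \<in> sets lebesgue" "{a..} \<in> sets lebesgue" for a b :: real by auto
  have Tm: "(\<lambda>x. if x \<in> {real n..} then h x else 0) \<in> borel_measurable (lebesgue_on {c..})" for n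
  proof -
    have "(\<lambda>x. indicat_real {real n..} x * h x) \<in> borel_measurable (lebesgue_on {c..})"
      by (intro borel_measurable_times borel_measurable_integrable[OF hi] measurable_restrict_space1
          borel_measurable_indicator m)
    then show ?thesis
      by (rule measurable_cong[THEN iffD1, rotated]) (simp add: indicator_def)
  qed
  have "T \<longlonglongrightarrow> integral\<^sup>L (lebesgue_on {c..}) (\<lambda>x. 0)"
    unfolding T_def
  proof (rule integral_dominated_convergence[where w = h])
    show "AE x in lebesgue_on {c..}. (\<lambda>n. if x \<in> {real n..} then h x else 0) \<longlonglongrightarrow> 0"
    proof (intro AE_I2 tendsto_eventually)
      fix x
      obtain N where "x < real N" using reals_Archimedean2 by blast
      then show "\<forall>\<^sub>F n in sequentially. (if x \<in> {real n..} then h x else 0) = 0"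
        unfolding eventually_sequentially by (intro exI[of _ N]) auto
    qed
    show "AE x in lebesgue_on {c..}. norm (if x \<in> {real n..} then h x else 0) \<le> h x" for n
      by (intro AE_I2) (simp add: h_def)
  qed (use hi Tm in auto)
  then have "T \<longlonglongrightarrow> 0" by simp
  moreover have "0 < r * (\<epsilon> / 2) powr q" using r(1) \<epsilon> by simp
  ultimately obtain n where n: "T n < r * (\<epsilon> / 2) powr q"
    using order_tendstoD(2)[of T 0 sequentially] by (metis eventually_sequentially order_refl)
  have small: "\<bar>f x\<bar> < \<epsilon>" if x: "max c (real n) \<le> x" for x
  proof (rule ccontr)
    assume big: "\<not> \<bar>f x\<bar> < \<epsilon>"
    have sub: "{x..x + r} \<subseteq> {c..}" using x by auto
    have lower: "(\<epsilon> / 2) powr q \<le> h s" if s: "s \<in> {x..x + r}" for s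
    proof -
      have "\<bar>f x - f s\<bar> \<le> L * \<bar>x - s\<bar>"
        using lipschitz_onD[OF f, of x s] x s by (auto simp: dist_real_def)
      also have "\<dots> \<le> L * r" using s L by (intro mult_left_mono) auto
      finally have "\<epsilon> / 2 \<le> \<bar>f s\<bar>" using big r(2) by linarith
      then show ?thesis unfolding h_def using \<epsilon> q by (intro powr_mono2) auto
    qed
    have "r * (\<epsilon> / 2) powr q = integral\<^sup>L (lebesgue_on {x..x + r}) (\<lambda>s. (\<epsilon> / 2) powr q)"
      using r(1) by (simp add: measure_restrict_space)
    also have "\<dots> \<le> integral\<^sup>L (lebesgue_on {x..x + r}) h"
    proof (rule integral_mono)
      show "integrable (lebesgue_on {x..x + r}) (\<lambda>s. (\<epsilon> / 2) powr q)"
        by (rule continuous_imp_integrable_real) simp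
      show "integrable (lebesgue_on {x..x + r}) h"
        by (rule integrable_lebesgue_on_subset[OF hi sub m])
      show "(\<epsilon> / 2) powr q \<le> h s" if "s \<in> space (lebesgue_on {x..x + r})" for s
        using lower that by simp
    qed
    also have "\<dots> = integral\<^sup>L (lebesgue_on {x..x + r}) (\<lambda>s. if s \<in> {real n..} then h s else 0)"
      using x by (intro Bochner_Integration.integral_cong) auto
    also have "\<dots> \<le> T n"
      unfolding T_def
    proof (rule integral_lebesgue_on_mono_set[OF _ _ sub m])
      show "integrable (lebesgue_on {c..}) (\<lambda>x. if x \<in> {real n..} then h x else 0)"
        by (rule Bochner_Integration.integrable_bound[OF hi Tm]) (auto simp: h_def)
    qed (auto simp: h_def)
    finally show False using n by simp
  qed
  then show "\<forall>\<^sub>F x in at_top. dist (f x) 0 < \<epsilon>"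
    unfolding eventually_at_top_linorder by (intro exI[of _ "max c (real n)"]) auto
qed

text \<open>By continuity the points that violate the bound form an open set; if nonempty, it would
  have positive measure.\<close>

lemma AE_bound_imp_bound:
  fixes f :: "real \<Rightarrow> real"
  assumes J: "open J" and f: "continuous_on J f" and ae: "AE x in lebesgue_on J. \<bar>f x\<bar> \<le> M" and x: "x \<in> J"
  shows "\<bar>f x\<bar> \<le> M"
proof (rule ccontr)
  assume "\<not> \<bar>f x\<bar> \<le> M"
  let ?S = "J \<inter> (\<lambda>y. \<bar>f y\<bar>) -` {M<..}"
  have "open ?S"
    using continuous_on_open_vimage[OF J, THEN iffD1, rule_format, of "\<lambda>y. \<bar>f y\<bar>" "{M<..}"] f
    by (auto intro!: continuous_intros simp: Int_commute)
  moreover have "x \<in> ?S" using x \<open>\<not> \<bar>f x\<bar> \<le> M\<close> by auto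
  ultimately have "\<not> negligible ?S" using open_not_negligible by blast
  moreover have "AE y in lebesgue. y \<in> J \<longrightarrow> \<bar>f y\<bar> \<le> M"
    using ae J by (simp add: AE_restrict_space_iff)
  then have "AE y in lebesgue. y \<notin> ?S" by (rule eventually_mono) auto
  then have "negligible ?S"
    using \<open>open ?S\<close> by (subst negligible_iff_null_sets) (auto simp: AE_iff_null_sets)
  ultimately show False by blast
qed

lemma gLinf_restr_bounded:
  assumes G: "class_G G" and u: "gcontinuous G u" "gLinf G (restr G u)"
  obtains B where "0 \<le> B" "\<And>e x. e \<in> edges G \<Longrightarrow> x \<in> edge_int G e \<Longrightarrow> \<bar>restr G u e x\<bar> \<le> B"
proof -
  have mg: "metric_graph G" using G by (simp add: class_G_def)
  obtain M where M: "\<And>e. e \<in> edges G \<Longrightarrow> AE x in lebesgue_on (edge_int G e). \<bar>restr G u e x\<bar> \<le> M"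
    using u(2) unfolding gLinf_def by blast
  have "\<bar>restr G u e x\<bar> \<le> \<bar>M\<bar>" if "e \<in> edges G" "x \<in> edge_int G e" for e x
    using AE_bound_imp_bound[OF open_edge_int[OF mg that(1)]
        continuous_on_subset[OF continuous_on_restr[OF G that(1) u(1)] edge_int_subset_edge_dom] M[OF that(1)] that(2)]
    by linarith
  then show ?thesis by (intro that[of "\<bar>M\<bar>"]) auto
qed

text \<open>The coordinate along \<open>e\<close>, extended by 0 to the rest of the graph, is
  1-Lipschitz, because a half-line is attached only at coordinate 0. Its image of \<open>C\<close>
  is compact, hence bounded.\<close>

lemma compactin_avoids_end:
  assumes G: "class_G G" and e: "e \<in> edges G" "len G e = \<infinity>" and C: "compactin (gtop G) C"
  obtains a where "0 < a" "\<And>x. a \<le> x \<Longrightarrow> pt G e x \<notin> C"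
proof -
  define \<phi> :: "('a, 'b) gpoint \<Rightarrow> real"
    where "\<phi> = (\<lambda>P. case P of Vertex v \<Rightarrow> 0 | Interior e' x \<Rightarrow> if e' = e then x else 0)"
  have \<phi>pt: "\<phi> (pt G e' x) = (if e' = e then x else 0)" for e' x
    using e(2) by (auto simp: \<phi>_def pt_def)
  have "Lipschitz_continuous_map (gmetric G) euclidean_metric \<phi>"
    by (rule Lipschitz_continuous_map_graph[OF G, of _ 1]) (simp add: \<phi>pt)
  from Lipschitz_continuous_imp_continuous_map[OF this]
  have "continuous_map (gtop G) euclideanreal \<phi>" by simp
  then have "compact (\<phi> ` C)" using image_compactin[OF C] by (metis compactin_euclidean_iff)
  then obtain b where b: "\<And>P. P \<in> C \<Longrightarrow> \<bar>\<phi> P\<bar> \<le> b"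
    using compact_imp_bounded[OF \<open>compact (\<phi> ` C)\<close>] by (auto simp: bounded_iff)
  have "pt G e x \<notin> C" if "\<bar>b\<bar> + 1 \<le> x" for x
    using b[of "pt G e x"] that by (auto simp: \<phi>pt)
  then show ?thesis by (intro that[of "\<bar>b\<bar> + 1"]) auto
qed

lemma gH1_locD:
  assumes G: "class_G G" and u: "u \<in> gH1_loc G" and e: "e \<in> edges G"
  shows "gcontinuous G u"
    and "is_weak_deriv (edge_int G e) (restr G u e) (graph_deriv G u e)"
    and "Lp_on 2 (edge_int G e \<inter> {..b}) (restr G u e)"
    and "Lp_on 2 (edge_int G e \<inter> {..b}) (graph_deriv G u e)"
    and "L1_loc_on (edge_int G e) (\<lambda>x. (graph_deriv G u e x)\<^sup>2)"
proof -
  have mg: "metric_graph G" using G by (simp add: class_G_def)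
  show "gcontinuous G u" and l: "Lp_on 2 (edge_int G e \<inter> {..b}) (restr G u e)"
    "Lp_on 2 (edge_int G e \<inter> {..b}) (graph_deriv G u e)" for b
    using u e by (auto simp: gH1_loc_def)
  show "is_weak_deriv (edge_int G e) (restr G u e) (graph_deriv G u e)"
    unfolding graph_deriv_def using u e is_weak_deriv_weak_deriv by (fastforce simp: gH1_loc_def)
  show "L1_loc_on (edge_int G e) (\<lambda>x. (graph_deriv G u e x)\<^sup>2)"
    unfolding L1_loc_on_def
  proof (intro allI impI, elim conjE)
    fix K assume K: "compact K" "K \<subseteq> edge_int G e"
    obtain b where b: "\<And>x. x \<in> K \<Longrightarrow> \<bar>x\<bar> \<le> b"
      using compact_imp_bounded[OF K(1)] by (auto simp: bounded_iff)
    have sub: "K \<subseteq> edge_int G e \<inter> {..b}" using K(2) b by (force simp: abs_le_iff)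
    have "integrable (lebesgue_on (edge_int G e \<inter> {..b})) (\<lambda>x. (graph_deriv G u e x)\<^sup>2)"
      using l(2)[of b] by (simp add: Lp_on_2_iff)
    then show "integrable (lebesgue_on K) (\<lambda>x. (graph_deriv G u e x)\<^sup>2)"
      using sub by (rule integrable_lebesgue_on_subset)
        (use K(1) edge_int_sets_lebesgue[OF mg e] in \<open>auto simp: compact_imp_closed\<close>)
  qed
qed

lemma restr_const: "restr G (\<lambda>P. c) e = (\<lambda>x. c)"
  by (simp add: restr_def[abs_def])

text \<open>With the constant \<open>w = 1\<close> the single-edge equation says that
  \<open>h\<close> is the weak derivative of \<open>u'\<close>. The bound follows from those on
  \<open>W\<close>, \<open>\<rho>\<close> and \<open>u\<close>; for the power term,
  \<open>p > 2\<close> makes \<open>powr (p - 2)\<close> increasing in its base.\<close>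

lemma is_weak_deriv_graph_deriv_of_solution:
  assumes G: "class_G_fin G" and p: "2 < p" and W: "gLinf G W" and \<rho>: "gLinf G \<rho>"
    and u: "solution G p W \<rho> u" and e: "e \<in> edges G"
    and M: "AE x in lebesgue_on (edge_int G e). \<bar>W e x\<bar> \<le> M"
    and N: "AE x in lebesgue_on (edge_int G e). \<bar>\<rho> e x\<bar> \<le> N"
    and B: "\<And>x. x \<in> edge_int G e \<Longrightarrow> \<bar>restr G u e x\<bar> \<le> B"
  defines "h \<equiv> \<lambda>x. W e x * restr G u e x - \<rho> e x * \<bar>restr G u e x\<bar> powr (p - 2) * restr G u e x"
  shows "is_weak_deriv (edge_int G e) (graph_deriv G u e) h"
    and "AE x in lebesgue_on (edge_int G e). \<bar>h x\<bar> \<le> M * B + N * B powr (p - 2) * B"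
proof -
  have cG: "class_G G" and mg: "metric_graph G" using G by (auto simp: class_G_fin_def class_G_def)
  let ?J = "edge_int G e" and ?f = "restr G u e"
  have J: "open ?J" and Jm: "?J \<in> sets lebesgue" using open_edge_int[OF mg e] by auto
  have ul: "u \<in> gH1_loc G" using u by (simp add: solution_def)
  note uD = gH1_locD[OF cG ul e]
  have fc: "continuous_on ?J ?f"
    by (rule continuous_on_subset[OF continuous_on_restr[OF cG e uD(1)] edge_int_subset_edge_dom])
  have meas: "?f \<in> borel_measurable (lebesgue_on ?J)" "W e \<in> borel_measurable (lebesgue_on ?J)"
    "\<rho> e \<in> borel_measurable (lebesgue_on ?J)"
    using restr_measurable[OF cG e uD(1)] W \<rho> e by (auto simp: gLinf_def)
  have R: "AE x in lebesgue_on ?J. \<bar>\<rho> e x * \<bar>?f x\<bar> powr (p - 2) * ?f x\<bar> \<le> N * B powr (p - 2) * B"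
    using N AE_space[of "lebesgue_on ?J"]
  proof eventually_elim
    case (elim x)
    then have "\<bar>?f x\<bar> powr (p - 2) \<le> B powr (p - 2)" using B p by (intro powr_mono2) auto
    then show ?case using elim B[of x] by (simp add: abs_mult mult_mono)
  qed
  have V: "AE x in lebesgue_on ?J. \<bar>W e x * ?f x\<bar> \<le> M * B"
    using M AE_space[of "lebesgue_on ?J"]
  proof eventually_elim
    case (elim x)
    then show ?case using B[of x] by (simp add: abs_mult mult_mono)
  qed
  have one: "L1_loc_on ?J (\<lambda>x. 1)" by (rule L1_loc_on_continuous) simp
  have loc: "L1_loc_on ?J F" if F: "F \<in> borel_measurable (lebesgue_on ?J)" "AE x in lebesgue_on ?J. \<bar>F x\<bar> \<le> c" for F c
    unfolding L1_loc_on_def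
  proof (intro allI impI, elim conjE)
    fix K assume K: "compact K" "K \<subseteq> ?J"
    have Km: "K \<in> sets lebesgue" using K(1) by (simp add: compact_imp_closed)
    have "integrable (lebesgue_on K) (\<lambda>x. 1 * F x)"
    proof (rule integrable_times_bounded)
      show "integrable (lebesgue_on K) (\<lambda>x. 1::real)" using one K by (simp add: L1_loc_on_def)
      show "F \<in> borel_measurable (lebesgue_on K)" by (rule measurable_restrict_mono[OF F(1) K(2)])
      show "AE x in lebesgue_on K. \<bar>F x\<bar> \<le> c" by (rule AE_lebesgue_on_subset[OF F(2) K(2) Km Jm])
    qed
    then show "integrable (lebesgue_on K) F" by simp
  qed
  have LV: "L1_loc_on ?J (\<lambda>x. W e x * ?f x)"
    by (rule loc[OF _ V]) (intro borel_measurable_times meas)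
  have LR: "L1_loc_on ?J (\<lambda>x. \<rho> e x * \<bar>?f x\<bar> powr (p - 2) * ?f x)"
    by (rule loc[OF _ R]) (intro borel_measurable_times powr_real_measurable borel_measurable_abs
        borel_measurable_const meas)
  have Lv: "L1_loc_on ?J (graph_deriv G u e)" using uD(2) by (simp add: is_weak_deriv_def)
  have "integral\<^sup>L (lebesgue_on ?J) (\<lambda>x. graph_deriv G u e x * \<zeta>' x) = - integral\<^sup>L (lebesgue_on ?J) (\<lambda>x. h x * \<zeta> x)"
    if t: "C1_test ?J \<zeta> \<zeta>'" for \<zeta> \<zeta>'
  proof -
    have "gcontinuous G (\<lambda>P. 1)" by (simp add: gcontinuous_def)
    moreover have "is_weak_deriv ?J (restr G (\<lambda>P. 1) e) (\<lambda>x. 0)"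
      unfolding restr_const by (rule is_weak_deriv_const[OF J])
    moreover have "L1_loc_on ?J (\<lambda>x. 0\<^sup>2)" by (rule L1_loc_on_continuous) simp
    ultimately have "integral\<^sup>L (lebesgue_on ?J) (\<lambda>x. graph_deriv G u e x * \<zeta>' x + W e x * ?f x * \<zeta> x)
      = integral\<^sup>L (lebesgue_on ?J) (\<lambda>x. \<rho> e x * \<bar>?f x\<bar> powr (p - 2) * ?f x * \<zeta> x)"
      using solution_edge_test[OF G e W \<rho> u t, of "\<lambda>P. 1" "\<lambda>x. 0"] by (simp add: restr_const)
    moreover have "integral\<^sup>L (lebesgue_on ?J) (\<lambda>x. graph_deriv G u e x * \<zeta>' x + W e x * ?f x * \<zeta> x)
      = integral\<^sup>L (lebesgue_on ?J) (\<lambda>x. graph_deriv G u e x * \<zeta>' x) + integral\<^sup>L (lebesgue_on ?J) (\<lambda>x. W e x * ?f x * \<zeta> x)"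
      by (rule Bochner_Integration.integral_add[OF integrable_L1_loc_times_test(2)[OF Jm Lv t] integrable_L1_loc_times_test(1)[OF Jm LV t]])
    moreover have "integral\<^sup>L (lebesgue_on ?J) (\<lambda>x. h x * \<zeta> x)
      = integral\<^sup>L (lebesgue_on ?J) (\<lambda>x. W e x * ?f x * \<zeta> x) - integral\<^sup>L (lebesgue_on ?J) (\<lambda>x. \<rho> e x * \<bar>?f x\<bar> powr (p - 2) * ?f x * \<zeta> x)"
      unfolding h_def left_diff_distrib
      by (rule Bochner_Integration.integral_diff[OF integrable_L1_loc_times_test(1)[OF Jm LV t] integrable_L1_loc_times_test(1)[OF Jm LR t]])
    ultimately show ?thesis by linarith
  qed
  moreover have "L1_loc_on ?J h" unfolding h_def by (rule L1_loc_on_diff[OF LV LR])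
  ultimately show "is_weak_deriv ?J (graph_deriv G u e) h" using Lv unfolding is_weak_deriv_def by blast
  show "AE x in lebesgue_on ?J. \<bar>h x\<bar> \<le> M * B + N * B powr (p - 2) * B"
    using V R unfolding h_def by eventually_elim linarith
qed

text \<open>Both \<open>u\<close> and its second weak derivative are bounded on the open edge.
  Continuity extends the resulting estimate to the end vertices, as needed for paths that cross
  vertices.\<close>

lemma lipschitz_on_edge_of_solution:
  assumes G: "class_G_fin G" and p: "2 < p" and W: "gLinf G W" and \<rho>: "gLinf G \<rho>"
    and u: "solution G p W \<rho> u" and e: "e \<in> edges G"
    and B: "0 \<le> B" "\<And>x. x \<in> edge_int G e \<Longrightarrow> \<bar>restr G u e x\<bar> \<le> B"
  shows "\<exists>L. L-lipschitz_on (edge_dom G e) (restr G u e)"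
proof -
  have cG: "class_G G" and mg: "metric_graph G" using G by (auto simp: class_G_fin_def class_G_def)
  let ?J = "edge_int G e" and ?f = "restr G u e"
  have ul: "u \<in> gH1_loc G" using u by (simp add: solution_def)
  note uD = gH1_locD[OF cG ul e]
  have c: "continuous_on (edge_dom G e) ?f" by (rule continuous_on_restr[OF cG e uD(1)])
  obtain M where M: "AE x in lebesgue_on ?J. \<bar>W e x\<bar> \<le> M" using W e by (auto simp: gLinf_def)
  obtain N where N: "AE x in lebesgue_on ?J. \<bar>\<rho> e x\<bar> \<le> N" using \<rho> e by (auto simp: gLinf_def)
  note wd = is_weak_deriv_graph_deriv_of_solution[OF G p W \<rho> u e M N B(2)]
  define H where "H = \<bar>M * B + N * B powr (p - 2) * B\<bar>"
  have H: "AE x in lebesgue_on ?J. \<bar>W e x * ?f x - \<rho> e x * \<bar>?f x\<bar> powr (p - 2) * ?f x\<bar> \<le> H" "0 \<le> H"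
    using wd(2) by (auto simp: H_def elim: eventually_mono)
  obtain r where r: "0 < r" "\<And>x. x \<in> ?J \<Longrightarrow> \<exists>c. c \<in> ?J \<and> c + r \<in> ?J \<and> \<bar>x - c\<bar> \<le> r"
  proof (rule edge_length_cases[OF mg e])
    assume "len G e = \<infinity>"
    then show thesis by (intro that[of 1]) (auto simp: edge_int_infinite intro!: exI)
  next
    fix l assume l: "len G e = ereal l" "0 < l"
    \<comment> \<open>Take \<open>c = x\<close> or \<open>c = x - l / 3\<close>. In the second case
      \<open>x \<ge> 2 * l / 3\<close>, so \<open>c\<close> stays strictly inside the edge. With
      \<open>l / 2\<close> both choices would reach an endpoint when \<open>x\<close> is the
      midpoint.\<close>
    show thesis
    proof (rule that[of "l / 3"])
      fix x assume x: "x \<in> ?J"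
      show "\<exists>c. c \<in> ?J \<and> c + l / 3 \<in> ?J \<and> \<bar>x - c\<bar> \<le> l / 3"
      proof (cases "x + l / 3 < l")
        case True
        then show ?thesis using x l by (intro exI[of _ x]) (auto simp: edge_int_finite)
      next
        case False
        then show ?thesis using x l by (intro exI[of _ "x - l / 3"]) (auto simp: edge_int_finite)
      qed
    qed (use l in simp)
  qed
  have "(4 * B / r + 3 * H * r)-lipschitz_on ?J ?f"
    by (rule lipschitz_on_of_bounded_second_weak_deriv[OF open_edge_int[OF mg e] is_interval_edge_int[OF mg e]
          continuous_on_subset[OF c edge_int_subset_edge_dom] uD(2) wd(1) H B(2,1) r])
  then have "(4 * B / r + 3 * H * r)-lipschitz_on (closure ?J) ?f"
    by (rule lipschitz_on_closure) (simp add: closure_edge_int[OF mg e] c)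
  then show ?thesis by (auto simp: closure_edge_int[OF mg e])
qed

text \<open>The cutoffs all start at the same \<open>a\<close>, beyond \<open>C\<close>, and their
  plateaus exhaust \<open>{c..}\<close> with \<open>c = a + 1\<close>. The bound \<open>E\<close>
  does not depend on the plateau length, so the three nonnegative densities are integrable on all of
  \<open>{c..}\<close>.\<close>

lemma halfline_energy_of_stable_solution:
  assumes G: "class_G_fin G" and p: "2 < p"
    and W: "gLinf G W" "gnonneg G W" and \<rho>: "gLinf G \<rho>" "gnonneg G \<rho>"
    and u: "solution G p W \<rho> u" "stable_outside G p W \<rho> u C" and C: "compactin (gtop G) C"
    and e: "e \<in> edges G" "len G e = \<infinity>"
    and B: "\<And>x. x \<in> edge_int G e \<Longrightarrow> \<bar>restr G u e x\<bar> \<le> B"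
  obtains c where "0 < c"
    "integrable (lebesgue_on {c..}) (\<lambda>x. (graph_deriv G u e x)\<^sup>2)"
    "integrable (lebesgue_on {c..}) (\<lambda>x. W e x * (restr G u e x)\<^sup>2)"
    "integrable (lebesgue_on {c..}) (\<lambda>x. \<rho> e x * \<bar>restr G u e x\<bar> powr p)"
proof -
  have cG: "class_G G" and mg: "metric_graph G" using G by (auto simp: class_G_fin_def class_G_def)
  let ?J = "edge_int G e" and ?f = "restr G u e" and ?g = "graph_deriv G u e"
  have JI: "?J = {0<..}" by (rule edge_int_infinite[OF e(2)])
  have J: "open ?J" and Jm: "?J \<in> sets lebesgue" using open_edge_int[OF mg e(1)] by auto
  have ul: "u \<in> gH1_loc G" using u by (simp add: solution_def)
  note uD = gH1_locD[OF cG ul e(1)]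
  have fc: "continuous_on ?J ?f"
    by (rule continuous_on_subset[OF continuous_on_restr[OF cG e(1) uD(1)] edge_int_subset_edge_dom])
  have gL: "L1_loc_on ?J ?g" using uD(2) by (simp add: is_weak_deriv_def)
  obtain M where M: "AE x in lebesgue_on ?J. \<bar>W e x\<bar> \<le> M" using W(1) e by (auto simp: gLinf_def)
  obtain N where N: "AE x in lebesgue_on ?J. \<bar>\<rho> e x\<bar> \<le> N" using \<rho>(1) e by (auto simp: gLinf_def)
  have Wm: "W e \<in> borel_measurable (lebesgue_on ?J)" and \<rho>m: "\<rho> e \<in> borel_measurable (lebesgue_on ?J)"
    using W(1) \<rho>(1) e by (auto simp: gLinf_def)
  have W0: "AE x in lebesgue_on ?J. 0 \<le> W e x" and \<rho>0: "AE x in lebesgue_on ?J. 0 \<le> \<rho> e x"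
    using W(2) \<rho>(2) e by (auto simp: gnonneg_def)
  obtain a where a: "0 < a" "\<And>x. a \<le> x \<Longrightarrow> pt G e x \<notin> C"
    by (rule compactin_avoids_end[OF cG e C]) (rule that)
  define c where "c = a + 1"
  let ?F1 = "\<lambda>x. (?g x)\<^sup>2" and ?F2 = "\<lambda>x. W e x * (?f x)\<^sup>2" and ?F3 = "\<lambda>x. \<rho> e x * \<bar>?f x\<bar> powr p"
  \<comment> \<open>Here \<open>m\<close> bounds the integral \<open>D\<close> of the energy
    estimate, \<open>k\<close> bounds \<open>D / (p - 2)\<close>, and \<open>E\<close> dominates all
    three of its conclusions.\<close>
  define m k E where "m = 8 * B\<^sup>2" and "k = m / (p - 2)" and "E = 2 * (k + 2 * m)"
  have mk: "0 \<le> m" "0 \<le> k" using p by (simp_all add: m_def k_def)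
  have powr_p: "\<bar>y\<bar> powr (p - 2) * y\<^sup>2 = \<bar>y\<bar> powr p" for y :: real
  proof -
    have "\<bar>y\<bar> powr 2 = y\<^sup>2" by (simp add: powr_numeral)
    moreover have "\<bar>y\<bar> powr (p - 2) * \<bar>y\<bar> powr 2 = \<bar>y\<bar> powr (p - 2 + 2)"
      by (rule powr_add[symmetric])
    ultimately show ?thesis by simp
  qed
  have nn: "AE x in lebesgue_on ?J. 0 \<le> ?F2 x" "AE x in lebesgue_on ?J. 0 \<le> ?F3 x"
    using W0 \<rho>0 by (auto elim: eventually_mono)
  have sub: "{c..real n} \<subseteq> ?J" "{c..} \<subseteq> ?J" for n using a(1) by (auto simp: JI c_def)
  have ms: "{c..real n} \<in> sets lebesgue" "{c..} \<in> sets lebesgue" for n by auto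
  have loc: "integrable (lebesgue_on {c..real n}) F \<and> integral\<^sup>L (lebesgue_on {c..real n}) F \<le> E"
    if F: "F = ?F1 \<or> F = ?F2 \<or> F = ?F3" for n F
  \<comment> \<open>For small \<open>n\<close> the interval is empty and there is no room for a
    plateau.\<close>
  proof (cases "c \<le> real n")
    case False
    then have "{c..real n} = {}" by auto
    moreover have "0 \<le> E" using mk by (simp add: E_def)
    ultimately show ?thesis by (simp only: integrable_lebesgue_on_empty integral_lebesgue_on_empty)
  next
    case True
    let ?\<eta> = "cutoff a (real n)" and ?\<eta>' = "cutoff' a (real n)"
    have K: "{a..real n + 1} \<subseteq> ?J" using a(1) by (auto simp: JI)
    have an: "a \<le> real n" "a + 1 \<le> real n" using True by (auto simp: c_def)
    have t: "C1_test ?J ?\<eta> ?\<eta>'" by (rule C1_test_cutoff[OF an(1) K])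
    have t2: "C1_test ?J (\<lambda>x. ?\<eta> x * ?\<eta> x) (\<lambda>x. ?\<eta> x * ?\<eta>' x + ?\<eta>' x * ?\<eta> x)"
      by (rule C1_test_mult[OF t C1_test_DERIV[OF t] C1_test_continuous_deriv[OF t]])
    have av: "pt G e ` {a..real n + 1} \<inter> C = {}" using a(2) by auto
    note cac = caccioppoli_of_stable[OF J p fc B gL uD(5) Wm M W0 \<rho>m N t
        solution_edge_test[OF G e(1) W(1) \<rho>(1) u(1) t2 uD(1,2,5)]
        stable_edge_test[OF G e(1) W(1) \<rho>(1) uD(1) u(2) t uD(1,2,5) compact_Icc K cutoff_outside[OF an(1)] av]]
    have D: "integral\<^sup>L (lebesgue_on ?J) (\<lambda>x. (?f x * ?\<eta>' x)\<^sup>2) \<le> m"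
      unfolding m_def by (rule integral_cutoff'_le[OF an(2) K Jm B cac(4)])
    define d where "d = integral\<^sup>L (lebesgue_on ?J) (\<lambda>x. (?f x * ?\<eta>' x)\<^sup>2)"
    have d: "d / (p - 2) \<le> E" "d / (p - 2) + 2 * d \<le> E" "2 * (d / (p - 2) + 2 * d) \<le> E"
    proof -
      define q where "q = d / (p - 2)"
      have "d \<le> m" using D by (simp add: d_def)
      moreover from this have "q \<le> k" unfolding q_def k_def using p by (intro divide_right_mono) auto
      ultimately show "d / (p - 2) \<le> E" "d / (p - 2) + 2 * d \<le> E" "2 * (d / (p - 2) + 2 * d) \<le> E"
        using mk unfolding E_def q_def[symmetric] by simp_all
    qed
    \<comment> \<open>On \<open>{c..real n}\<close> the cutoff is 1, so the density \<open>H\<close>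
      with cutoff coincides with \<open>F\<close> there; nonnegativity of \<open>H\<close> allows
      the domain of integration to shrink.\<close>
    have conc: "integrable (lebesgue_on {c..real n}) F \<and> integral\<^sup>L (lebesgue_on {c..real n}) F \<le> E"
      if H: "integrable (lebesgue_on ?J) H" "integral\<^sup>L (lebesgue_on ?J) H \<le> E" "AE x in lebesgue_on ?J. 0 \<le> H x"
        and FH: "\<And>x. ?\<eta> x = 1 \<Longrightarrow> H x = F x" for H
    proof -
      have eq: "H x = F x" if "x \<in> space (lebesgue_on {c..real n})" for x
        using that by (intro FH cutoff_inside) (simp add: c_def)
      have "integrable (lebesgue_on {c..real n}) H"
        by (rule integrable_lebesgue_on_subset[OF H(1) sub(1) ms(1) Jm])
      moreover have "integral\<^sup>L (lebesgue_on {c..real n}) H \<le> E"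
        using integral_lebesgue_on_mono_set[OF H(1,3) sub(1) ms(1) Jm] H(2) by (rule order_trans)
      moreover have "integrable (lebesgue_on {c..real n}) H = integrable (lebesgue_on {c..real n}) F"
        "integral\<^sup>L (lebesgue_on {c..real n}) H = integral\<^sup>L (lebesgue_on {c..real n}) F"
        by (rule Bochner_Integration.integrable_cong[OF refl eq], assumption,
            rule Bochner_Integration.integral_cong[OF refl eq])
      ultimately show ?thesis by simp
    qed
    from F show ?thesis
    proof (elim disjE)
      assume "F = ?F1"
      then show ?thesis
        using cac(1) cac(7)[folded d_def] d(3) by (intro conc[of "\<lambda>x. (?g x * ?\<eta> x)\<^sup>2"]) auto
    next
      assume "F = ?F2"
      then show ?thesis
        using cac(2) cac(6)[folded d_def] d(2) W0
        by (intro conc[of "\<lambda>x. W e x * (?f x * ?\<eta> x)\<^sup>2"]) (auto elim: eventually_mono)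
    next
      assume "F = ?F3"
      then show ?thesis
        using cac(3) cac(5)[folded d_def] d(1) \<rho>0
        by (intro conc[of "\<lambda>x. \<rho> e x * \<bar>?f x\<bar> powr (p - 2) * (?f x * ?\<eta> x)\<^sup>2"])
          (auto elim: eventually_mono simp: mult.assoc powr_p)
    qed
  qed
  have "0 < c" using a(1) by (simp add: c_def)
  moreover have "integrable (lebesgue_on {c..}) ?F1"
    using loc[of ?F1] by (intro integrable_halfline_of_bounded_integrals[where C = E]) auto
  moreover have "integrable (lebesgue_on {c..}) ?F2"
    using loc[of ?F2] by (intro integrable_halfline_of_bounded_integrals[where C = E]
        AE_lebesgue_on_subset[OF nn(1) sub(2) ms(2) Jm]) auto
  moreover have "integrable (lebesgue_on {c..}) ?F3"
    using loc[of ?F3] by (intro integrable_halfline_of_bounded_integrals[where C = E]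
        AE_lebesgue_on_subset[OF nn(2) sub(2) ms(2) Jm]) auto
  ultimately show ?thesis by (rule that)
qed

section \<open>Positive lower limits and integrability on edges\<close>

text \<open>Both suprema are resolved by strict inequalities. The extended real bound obtained in
  this way may be infinite, so a real \<open>c\<close> is interposed.\<close>

lemma ess_liminf_at_top_pos:
  assumes "0 < ess_liminf_at_top W"
  obtains R c where "0 < R" "0 < c" "AE x in lebesgue_on {R<..}. c \<le> W x"
proof -
  obtain R where R: "0 < R" "0 < ess_inf_on {R<..} W"
    using assms unfolding ess_liminf_at_top_def less_SUP_iff by auto
  then obtain a where a: "0 < a" "AE x in lebesgue_on {R<..}. a \<le> ereal (W x)"
    unfolding ess_inf_on_def less_Sup_iff by auto
  obtain c where c: "0 < ereal c" "ereal c < a" using ereal_dense2[of 0 a] a(1) by auto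
  have "AE x in lebesgue_on {R<..}. c \<le> W x"
    using a(2) by (rule eventually_mono) (use c(2) in \<open>metis ereal_less_eq(3) less_imp_le order_trans\<close>)
  then show ?thesis using that R(1) c(1) by simp
qed

text \<open>Far out, \<open>W \<ge> d > 0\<close> almost everywhere, hence
  \<open>F \<le> W * F / d\<close>. It serves both for \<open>W\<close> with
  \<open>u\<^sup>2\<close> and for \<open>\<rho>\<close> with \<open>|u|\<^sup>p\<close>.\<close>

lemma integrable_of_ess_liminf_pos:
  assumes "0 < ess_liminf_at_top W" and m: "F \<in> borel_measurable (lebesgue_on {0<..})"
    and F: "\<And>x. 0 \<le> F x" and int: "integrable (lebesgue_on {c..}) (\<lambda>x. W x * F x)"
  obtains b where "c \<le> b" "0 < b" "integrable (lebesgue_on {b..}) F"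
proof -
  obtain R d where R: "0 < R" "0 < d" "AE x in lebesgue_on {R<..}. d \<le> W x"
    by (rule ess_liminf_at_top_pos[OF assms(1)]) (rule that)
  define b where "b = max c (R + 1)"
  have b: "c \<le> b" "0 < b" "{b..} \<subseteq> {c..}" "{b..} \<subseteq> {R<..}" "{b..} \<subseteq> {0<..}"
    using R(1) by (auto simp: b_def)
  have ms: "{b..} \<in> sets lebesgue" "{c..} \<in> sets lebesgue" "{R<..} \<in> sets lebesgue" by auto
  have "integrable (lebesgue_on {b..}) F"
  proof (rule Bochner_Integration.integrable_bound)
    show "integrable (lebesgue_on {b..}) (\<lambda>x. (W x * F x) / d)"
      using integrable_lebesgue_on_subset[OF int b(3) ms(1,2)] by simp
    show "F \<in> borel_measurable (lebesgue_on {b..})"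
      by (rule measurable_restrict_mono[OF m b(5)])
    have "AE x in lebesgue_on {b..}. d \<le> W x"
      by (rule AE_lebesgue_on_subset[OF R(3) b(4) ms(1,3)])
    then show "AE x in lebesgue_on {b..}. norm (F x) \<le> norm ((W x * F x) / d)"
    proof eventually_elim
      case (elim x)
      have "d * F x \<le> W x * F x" using elim F[of x] by (rule mult_right_mono)
      then have "F x \<le> (W x * F x) / d" using R(2) by (simp add: pos_le_divide_eq mult.commute)
      also have "\<dots> \<le> \<bar>(W x * F x) / d\<bar>" by (rule abs_ge_self)
      finally show ?case using F[of x] by (simp only: real_norm_def abs_of_nonneg)
    qed
  qed
  with b(1,2) show ?thesis by (rule that)
qed

lemma integrable_bounded_part:
  fixes F :: "real \<Rightarrow> real"
  assumes J: "J \<in> sets lebesgue" "J \<subseteq> {0..}" and F: "F \<in> borel_measurable (lebesgue_on J)"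
    and bd: "AE x in lebesgue_on J. \<bar>F x\<bar> \<le> B"
  shows "integrable (lebesgue_on (J \<inter> {..b})) F"
proof -
  have m: "J \<inter> {..b} \<in> sets lebesgue" using J(1) by auto
  have "J \<inter> {..b} \<subseteq> {0..b}" using J(2) by auto
  then have "J \<inter> {..b} \<in> lmeasurable" by (intro bounded_set_imp_lmeasurable bounded_subset[OF compact_imp_bounded[OF compact_Icc]] m)
  then interpret finite_measure "lebesgue_on (J \<inter> {..b})" by (rule finite_measure_lebesgue_on)
  have "AE x in lebesgue_on (J \<inter> {..b}). \<bar>F x\<bar> \<le> B"
    by (rule AE_lebesgue_on_subset[OF bd _ m J(1)]) auto
  moreover have "F \<in> borel_measurable (lebesgue_on (J \<inter> {..b}))"
    by (rule measurable_restrict_mono[OF F]) auto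
  ultimately show ?thesis by (intro integrable_const_bound[of F B]) auto
qed

lemma integrable_halfline_split:
  fixes F :: "real \<Rightarrow> real"
  assumes "integrable (lebesgue_on ({0<..} \<inter> {..c})) F" "integrable (lebesgue_on {c..}) F" "0 < c"
  shows "integrable (lebesgue_on {0<..}) F"
proof -
  have "{0<..} \<inter> {..c} \<union> {c..} = {0<..}" using assms(3) by auto
  then show ?thesis using integrable_lebesgue_on_Un[OF assms(1,2)] by simp
qed

theorem proposition2p4:
  fixes G :: "('v, 'e) mgraph" and p :: real
    and W \<rho> :: "'e \<Rightarrow> real \<Rightarrow> real"
    and u :: "('v, 'e) gpoint \<Rightarrow> real" and C :: "('v, 'e) gpoint set"
  assumes "class_G_fin G" and "\<not> compact_graph G"
    and "p > 2"
    and "gLinf G W" and "gnonneg G W"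
    and "gLinf G \<rho>" and "gnonneg G \<rho>"
    and "u \<in> gH1_loc G" and "gLinf G (restr G u)"
    and "solution G p W \<rho> u"
    and "compactin (gtop G) C" and "stable_outside G p W \<rho> u C"
  shows "gLp G 2 (graph_deriv G u) \<and>
    gLp G 1 (\<lambda>e x. \<rho> e x * \<bar>restr G u e x\<bar> powr p) \<and>
    uniformly_continuous_map (gmetric G) euclidean_metric u \<and>
    (\<forall>e\<in>edges G. len G e = \<infinity> \<longrightarrow>
       (ess_liminf_at_top (W e) > 0 \<longrightarrow>
          H1_on (edge_int G e) (restr G u e) \<and> (restr G u e \<longlongrightarrow> 0) at_top) \<and>
       (ess_liminf_at_top (\<rho> e) > 0 \<longrightarrow>
          Lp_on p (edge_int G e) (restr G u e) \<and> (restr G u e \<longlongrightarrow> 0) at_top))"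
proof -
  note G = assms(1) and p = assms(3) and sol = assms(10) and stab = assms(12) and C = assms(11)
  note W = assms(4,5) and \<rho> = assms(6,7)
  have cG: "class_G G" and mg: "metric_graph G" and fin: "finite (edges G)"
    using G by (auto simp: class_G_fin_def class_G_def)
  note uD = gH1_locD[OF cG assms(8)]
  \<comment> \<open>The facts on \<open>gH1_loc\<close> are stated per edge; noncompactness supplies
    an edge from which the global continuity of \<open>u\<close> is read off.\<close>
  obtain e0 where e0: "e0 \<in> edges G"
    using assms(2) fin by (auto simp: compact_graph_def)
  have cu: "gcontinuous G u" by (rule uD(1)[OF e0])
  obtain B where B: "0 \<le> B" "\<And>e x. e \<in> edges G \<Longrightarrow> x \<in> edge_int G e \<Longrightarrow> \<bar>restr G u e x\<bar> \<le> B"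
    by (rule gLinf_restr_bounded[OF cG cu assms(9)]) (rule that)
  have Jm: "edge_int G e \<in> sets lebesgue" "edge_int G e \<subseteq> {0..}" if "e \<in> edges G" for e
    using edge_int_sets_lebesgue[OF mg that] by (auto simp: edge_int_def)
  have fm: "restr G u e \<in> borel_measurable (lebesgue_on (edge_int G e))" if "e \<in> edges G" for e
    by (rule restr_measurable[OF cG that cu])
  have gm: "graph_deriv G u e \<in> borel_measurable (lebesgue_on (edge_int G e))" if "e \<in> edges G" for e
    by (rule graph_deriv_measurable[OF mg that uD(2)[OF that]])
  have \<rho>m: "\<rho> e \<in> borel_measurable (lebesgue_on (edge_int G e))" if "e \<in> edges G" for e
    using \<rho>(1) that by (auto simp: gLinf_def)
  have um: "(\<lambda>x. \<bar>restr G u e x\<bar> powr p) \<in> borel_measurable (lebesgue_on (edge_int G e))" if "e \<in> edges G" for e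
    by (intro powr_real_measurable borel_measurable_abs fm[OF that] borel_measurable_const)
  have rm: "(\<lambda>x. \<rho> e x * \<bar>restr G u e x\<bar> powr p) \<in> borel_measurable (lebesgue_on (edge_int G e))" if "e \<in> edges G" for e
    by (intro borel_measurable_times \<rho>m[OF that] um[OF that])
  have upB: "AE x in lebesgue_on (edge_int G e). \<bar>\<bar>restr G u e x\<bar> powr p\<bar> \<le> B powr p" if "e \<in> edges G" for e
    using B(2)[OF that] p by (intro AE_I2) (auto intro!: powr_mono2)
  \<comment> \<open>The energy estimate starts only at some \<open>c > 0\<close>; on the part of the
    edge before it, \<open>u\<close> is bounded on a set of finite measure.\<close>
  have u_bd: "integrable (lebesgue_on (edge_int G e \<inter> {..b})) (\<lambda>x. \<bar>restr G u e x\<bar> powr p)" if "e \<in> edges G" for e b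
    by (rule integrable_bounded_part[OF Jm[OF that] um[OF that] upB[OF that]])
  have r_bd: "integrable (lebesgue_on (edge_int G e \<inter> {..b})) (\<lambda>x. \<rho> e x * \<bar>restr G u e x\<bar> powr p)" if e: "e \<in> edges G" for e b
  proof -
    obtain N where N: "AE x in lebesgue_on (edge_int G e). \<bar>\<rho> e x\<bar> \<le> N" using \<rho>(1) e by (auto simp: gLinf_def)
    have "AE x in lebesgue_on (edge_int G e). \<bar>\<rho> e x * \<bar>restr G u e x\<bar> powr p\<bar> \<le> N * B powr p"
      using N upB[OF e]
    proof eventually_elim
      case (elim x)
      then show ?case unfolding abs_mult by (intro mult_mono) auto
    qed
    then show ?thesis by (rule integrable_bounded_part[OF Jm[OF e] rm[OF e]])
  qed
  have energy: "\<exists>c>0. integrable (lebesgue_on {c..}) (\<lambda>x. (graph_deriv G u e x)\<^sup>2) \<and>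
      integrable (lebesgue_on {c..}) (\<lambda>x. W e x * (restr G u e x)\<^sup>2) \<and>
      integrable (lebesgue_on {c..}) (\<lambda>x. \<rho> e x * \<bar>restr G u e x\<bar> powr p)"
    if e: "e \<in> edges G" "len G e = \<infinity>" for e
    by (rule halfline_energy_of_stable_solution[OF G p W \<rho> sol stab C e B(2)[OF e(1)]], assumption)
      (intro exI conjI)
  have g2: "Lp_on 2 (edge_int G e) (graph_deriv G u e)" if e: "e \<in> edges G" for e
  proof (rule edge_length_cases[OF mg e])
    assume l: "len G e = \<infinity>"
    obtain c where c: "0 < c" "integrable (lebesgue_on {c..}) (\<lambda>x. (graph_deriv G u e x)\<^sup>2)"
      using energy[OF e l] by blast
    have "integrable (lebesgue_on ({0<..} \<inter> {..c})) (\<lambda>x. (graph_deriv G u e x)\<^sup>2)"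
      using uD(4)[OF e, of c] by (simp add: Lp_on_2_iff edge_int_infinite[OF l])
    from integrable_halfline_split[OF this c(2,1)] show ?thesis
      using gm[OF e] by (simp add: Lp_on_2_iff edge_int_infinite[OF l])
  next
    fix l assume l: "len G e = ereal l" "0 < l"
    \<comment> \<open>On a bounded edge, truncation at its length loses nothing, so the local
      information is already global.\<close>
    have "edge_int G e \<inter> {..l} = edge_int G e" by (auto simp: edge_int_finite[OF l(1)])
    then show ?thesis using uD(4)[OF e, of l] by simp
  qed
  have r1: "Lp_on 1 (edge_int G e) (\<lambda>x. \<rho> e x * \<bar>restr G u e x\<bar> powr p)" if e: "e \<in> edges G" for e
  proof -
    have "integrable (lebesgue_on (edge_int G e)) (\<lambda>x. \<rho> e x * \<bar>restr G u e x\<bar> powr p)"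
    proof (rule edge_length_cases[OF mg e])
      assume l: "len G e = \<infinity>"
      obtain c where c: "0 < c" "integrable (lebesgue_on {c..}) (\<lambda>x. \<rho> e x * \<bar>restr G u e x\<bar> powr p)"
        using energy[OF e l] by blast
      show ?thesis
        using integrable_halfline_split[OF _ c(2,1)] r_bd[OF e, of c] by (simp add: edge_int_infinite[OF l])
    next
      fix l assume l: "len G e = ereal l" "0 < l"
      have "edge_int G e \<inter> {..l} = edge_int G e" by (auto simp: edge_int_finite[OF l(1)])
      then show ?thesis using r_bd[OF e, of l] by simp
    qed
    then have "integrable (lebesgue_on (edge_int G e)) (\<lambda>x. \<bar>\<rho> e x * \<bar>restr G u e x\<bar> powr p\<bar>)"
      by (rule integrable_abs)
    then show ?thesis unfolding Lp_on_def using rm[OF e] by simp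
  qed
  have lip: "\<exists>L. L-lipschitz_on (edge_dom G e) (restr G u e)" if "e \<in> edges G" for e
    by (rule lipschitz_on_edge_of_solution[OF G p W(1) \<rho>(1) sol that B(1) B(2)[OF that]])
  then obtain L where L: "\<And>e. e \<in> edges G \<Longrightarrow> (L e)-lipschitz_on (edge_dom G e) (restr G u e)" by metis
  have "Lipschitz_continuous_map (gmetric G) euclidean_metric u"
  proof (rule Lipschitz_continuous_map_graph[OF cG])
    fix e x y assume e: "e \<in> edges G" "x \<in> edge_dom G e" "y \<in> edge_dom G e"
    have "\<bar>u (pt G e x) - u (pt G e y)\<bar> \<le> L e * \<bar>x - y\<bar>"
      using lipschitz_onD[OF L[OF e(1)] e(2,3)] by (simp add: restr_def dist_real_def)
    \<comment> \<open>The sum over the finitely many edges is a Lipschitz constant common to all of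
      them, since each summand is nonnegative.\<close>
    also have "L e \<le> (\<Sum>e\<in>edges G. L e)"
      by (rule member_le_sum[OF e(1) _ fin]) (use L lipschitz_on_nonneg in blast)
    finally show "\<bar>u (pt G e x) - u (pt G e y)\<bar> \<le> (\<Sum>e\<in>edges G. L e) * \<bar>x - y\<bar>"
      by (simp add: mult_right_mono)
  qed
  then have unif: "uniformly_continuous_map (gmetric G) euclidean_metric u"
    by (rule Lipschitz_imp_uniformly_continuous_map)
  have Wpart: "H1_on (edge_int G e) (restr G u e) \<and> (restr G u e \<longlongrightarrow> 0) at_top"
    if e: "e \<in> edges G" "len G e = \<infinity>" and pos: "0 < ess_liminf_at_top (W e)" for e
  proof -
    obtain c where c: "0 < c" "integrable (lebesgue_on {c..}) (\<lambda>x. W e x * (restr G u e x)\<^sup>2)"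
      using energy[OF e] by blast
    have "(\<lambda>x. (restr G u e x)\<^sup>2) \<in> borel_measurable (lebesgue_on {0<..})"
      using fm[OF e(1)] by (simp add: edge_int_infinite[OF e(2)])
    then obtain b where b: "c \<le> b" "0 < b" "integrable (lebesgue_on {b..}) (\<lambda>x. (restr G u e x)\<^sup>2)"
      by (rule integrable_of_ess_liminf_pos[OF pos _ _ c(2)]) (simp, rule that)
    have "integrable (lebesgue_on ({0<..} \<inter> {..b})) (\<lambda>x. (restr G u e x)\<^sup>2)"
      using uD(3)[OF e(1), of b] by (simp add: Lp_on_2_iff edge_int_infinite[OF e(2)])
    from integrable_halfline_split[OF this b(3,2)] have "Lp_on 2 (edge_int G e) (restr G u e)"
      using fm[OF e(1)] by (simp add: Lp_on_2_iff edge_int_infinite[OF e(2)])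
    \<comment> \<open>By definition \<open>graph_deriv\<close> is the representative that
      \<open>H1_on\<close> refers to, so the energy bound applies as it stands.\<close>
    moreover have "Lp_on 2 (edge_int G e) (weak_deriv (edge_int G e) (restr G u e))"
      using g2[OF e(1)] by (simp add: graph_deriv_def)
    ultimately have "H1_on (edge_int G e) (restr G u e)"
      using uD(2)[OF e(1)] unfolding H1_on_def by blast
    moreover have "(restr G u e \<longlongrightarrow> 0) at_top"
    proof (rule lipschitz_integrable_imp_tendsto_0[of "L e" b _ 2])
      show "(L e)-lipschitz_on {b..} (restr G u e)"
        using b(2) by (intro lipschitz_on_subset[OF L[OF e(1)]]) (auto simp: edge_dom_infinite[OF e(2)])
      show "integrable (lebesgue_on {b..}) (\<lambda>x. \<bar>restr G u e x\<bar> powr 2)"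
        using b(3) by (simp add: powr_numeral)
    qed simp
    ultimately show ?thesis by simp
  qed
  have \<rho>part: "Lp_on p (edge_int G e) (restr G u e) \<and> (restr G u e \<longlongrightarrow> 0) at_top"
    if e: "e \<in> edges G" "len G e = \<infinity>" and pos: "0 < ess_liminf_at_top (\<rho> e)" for e
  proof -
    obtain c where c: "0 < c" "integrable (lebesgue_on {c..}) (\<lambda>x. \<rho> e x * \<bar>restr G u e x\<bar> powr p)"
      using energy[OF e] by blast
    have "(\<lambda>x. \<bar>restr G u e x\<bar> powr p) \<in> borel_measurable (lebesgue_on {0<..})"
      using um[OF e(1)] by (simp add: edge_int_infinite[OF e(2)])
    then obtain b where b: "c \<le> b" "0 < b" "integrable (lebesgue_on {b..}) (\<lambda>x. \<bar>restr G u e x\<bar> powr p)"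
      by (rule integrable_of_ess_liminf_pos[OF pos _ _ c(2)]) (simp, rule that)
    have "integrable (lebesgue_on (edge_int G e)) (\<lambda>x. \<bar>restr G u e x\<bar> powr p)"
      using integrable_halfline_split[OF _ b(3,2)] u_bd[OF e(1), of b] by (simp add: edge_int_infinite[OF e(2)])
    then have "Lp_on p (edge_int G e) (restr G u e)"
      unfolding Lp_on_def using fm[OF e(1)] by simp
    moreover have "(restr G u e \<longlongrightarrow> 0) at_top"
    proof (rule lipschitz_integrable_imp_tendsto_0[OF _ _ b(3)])
      show "(L e)-lipschitz_on {b..} (restr G u e)"
        using b(2) by (intro lipschitz_on_subset[OF L[OF e(1)]]) (auto simp: edge_dom_infinite[OF e(2)])
    qed (use p in simp)
    ultimately show ?thesis by simp
  qed
  have "gLp G 2 (graph_deriv G u)" "gLp G 1 (\<lambda>e x. \<rho> e x * \<bar>restr G u e x\<bar> powr p)"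
    unfolding gLp_def using g2 r1 fin by (auto intro: summable_on_finite)
  then show ?thesis using unif Wpart \<rho>part by blast
qed

end
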